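(* Let $(n^{eq}, V^{eq})\in H^1(\Omega)^4\times H^1(\Omega)$, $n^{eq}=(n_0^{eq},\vec n^{eq})$, be a steady state, that is, let it satisfy $$\nabla n_0^{eq} + n_0^{eq}\mu(|\nabla V^{eq}|)\nabla V^{eq} = 0,\qquad \lambda_D^2\Delta V^{eq} + 2 n_0^{eq} - C = 0,\qquad \vec n^{eq}=0\qquad\text{in }\Omega,$$ $$n_0^{eq} = n_0^D,\quad V^{eq} = V^D \quad\text{on }\partial\Omega.$$ Let $(n,V)$, $n=(n_0,n_1,n_2,n_3)=(n_0,\vec n)$, be the solution, defined for all $t>0$, of $$\partial_t n_i = \operatorname{div}\Big(\sum_{j=0}^3 a_{ij}(\nabla n_j - n_j v)\Big) + \sum_{j=0}^3 b_{ij}n_j\quad (0\leq i\leq 3)\quad\text{in }\Omega\times(0,\infty),$$ $$v = -\mu(|\nabla V|)\nabla V,\qquad -\lambda_D^2\Delta V = 2 n_0 - C\quad\text{in }\Omega\times(0,\infty),$$ $$n = n^D,\quad V=V^D\quad\text{on }\partial\Omega\times(0,\infty),\qquad n(\cdot,0) = n^I\quad\text{on }\Omega.$$ A constant $K>0$ depending on $D$, $p$, $\Omega$ exists such that, if $$(v^{sat})^2 + L^2\lambda_D^{-4}\|n^{eq}\|_{L^\infty(\Omega)}^2 < K,$$ then $$\|n(t) - n^{eq}\|_{L^2(\Omega)} \leq k_1 e^{-k_2 t}\qquad\text{for all } t>0,$$ for suitable constants $k_1,k_2>0$.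
   Context: $\Omega\subset\mathbb{R}^d$, $d\le 3$, is a bounded domain with $\partial\Omega\in C^1$. $\lambda_D,\gamma,\tau>0$ are constants. $D=D(x)$ (diffusion coefficient), $p=p(x)\in(-1,1)$ (spin polarization) and $C=C(x)$ (doping profile) are given measurable functions on $\Omega$ with $D\in L^\infty(\Omega)$, $\inf_\Omega D>0$, $\sup_\Omega|p|<1$, $C\in L^\infty(\Omega)$; $\eta(x)=\sqrt{1-p(x)^2}$. The boundary data $n^D=(n_0^D,n_1^D,n_2^D,n_3^D)$, $V^D$ and the initial datum $n^I=(n_0^I,n_1^I,n_2^I,n_3^I)$ are functions of $x\in\Omega$ with $n_j^D,V^D\in H^1(\Omega)$, $n_j^I\in L^2(\Omega)$ for $0\le j\le 3$. The mobility $\mu:[0,\infty)\to(0,\infty)$ satisfies, for some constants $v^{sat}>0$, $L>0$ (those appearing in the claim): $\mu\in C^1([0,\infty))$ and, for all $s,\overline s\ge 0$, $\mu'(s)\le 0$, $s\mu(s)\le v^{sat}$, $|s\mu(s)-\overline s\mu(\overline s)|\le L|s-\overline s|$. The magnetization $\vec m=(m_1,m_2,m_3)(x,t)$ has $|\vec m|\equiv 1$, belongs to $L^\infty(0,T;H^1(\Omega))\cap H^1(0,T;L^2(\Omega))$ for all $T>0$, and is a (weak) solution of the Landau–Lifshitz equation $\partial_t\vec m=\vec m\wedge\Delta\vec m-\vec m\wedge(\vec m\wedge\Delta\vec m)$ in $\Omega\times(0,\infty)$, with $\partial_\nu\vec m=0$ on $\partial\Omega\times(0,\infty)$ and $\vec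 m(\cdot,0)=\vec m^I$ on $\Omega$, where $\wedge$ is the cross product in $\mathbb{R}^3$ and $|\vec m^I|\equiv1$. The diffusion matrix $A=(a_{ij})_{i,j=0,\dots,3}$ is $$A=\frac{D}{\eta^{2}}\begin{pmatrix}1&-p\,\vec m^T\\-p\,\vec m&\eta I+(1-\eta)\vec m\otimes\vec m\end{pmatrix},$$ with $I$ the $3\times3$ identity. The matrix $B=(b_{ij})_{i,j=0,\dots,3}$ is given by $b_{ij}=2\gamma\sum_{k=1}^3\varepsilon_{ijk}m_k-\tau^{-1}\delta_{ij}$ for $1\le i,j\le3$ and $b_{ij}=0$ otherwise, where $\varepsilon_{ijk}$ is the Levi-Civita symbol. Solutions are weak solutions, in the class (for every $T>0$) $n_j\in L^2(0,T; H^1(\Omega))\cap H^1(0,T; H^{-1}(\Omega))\cap L^\infty(0,T; L^2(\Omega))$ for $0\le j\le3$ and $V\in L^2(0,T; H^2(\Omega))\cap H^1(0,T; L^2(\Omega))\cap L^\infty(0,T; H^1(\Omega))$: the parabolic equations hold in $L^2(0,T;H^{-1}(\Omega))$, the boundary conditions hold in the sense of traces, and the initial condition holds in $L^2(\Omega)$. The steady state equations are likewise understood in the weak sense.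
   Formalization: The steady state is required to match the boundary data in all four components, n^eq = n^D on ∂Ω, so the spin boundary data n_1^D, n_2^D, n_3^D vanish on ∂Ω; without this the claimed decay is false. *)

theory Defs
  imports "HOL-Analysis.Analysis" "HOL-Probability.Essential_Supremum"
begin

section \<open>Smooth functions and domains\<close>

primrec C_k :: "nat \<Rightarrow> ('a::euclidean_space \<Rightarrow> real) \<Rightarrow> bool" where
  "C_k 0 f \<longleftrightarrow> continuous_on UNIV f"
| "C_k (Suc k) f \<longleftrightarrow> (\<forall>x. f differentiable (at x)) \<and>
     (\<forall>e\<in>Basis. C_k k (\<lambda>x. frechet_derivative f (at x) e))"

definition test_function :: "'a::euclidean_space set \<Rightarrow> ('a \<Rightarrow> real) \<Rightarrow> bool" where
  "test_function \<Omega> \<phi> \<longleftrightarrow> (\<forall>k. C_k k \<phi>) \<and>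
     compact (closure {x. \<phi> x \<noteq> 0}) \<and> closure {x. \<phi> x \<noteq> 0} \<subseteq> \<Omega>"

text \<open>Near every boundary point, and after a rotation sending the last coordinate axis to
  the direction \<open>\<nu>\<close>, the set is the strict epigraph of a \<open>C\<^sup>1\<close> function of the remaining
  coordinates.  Only the values of \<open>h\<close> on the hyperplane orthogonal to \<open>\<nu>\<close> are used.\<close>

definition bounded_C1_domain :: "'a::euclidean_space set \<Rightarrow> bool" where
  "bounded_C1_domain \<Omega> \<longleftrightarrow> open \<Omega> \<and> connected \<Omega> \<and> \<Omega> \<noteq> {} \<and> bounded \<Omega> \<and>
     (\<forall>x\<^sub>0 \<in> frontier \<Omega>. \<exists>r>0. \<exists>\<nu> h. norm \<nu> = 1 \<and> C_k 1 h \<and>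
        \<Omega> \<inter> ball x\<^sub>0 r = {x \<in> ball x\<^sub>0 r. h (x - (x \<bullet> \<nu>) *\<^sub>R \<nu>) < x \<bullet> \<nu>})"


section \<open>Lebesgue and Sobolev spaces on a domain\<close>

text \<open>Elements of these spaces are functions rather than classes modulo null sets; only their
  values on \<open>\<Omega>\<close> matter, and the norms below are seminorms.\<close>

definition L2 :: "'a::euclidean_space set \<Rightarrow> ('a \<Rightarrow> 'b::euclidean_space) set" where
  "L2 \<Omega> = {f \<in> borel_measurable (lebesgue_on \<Omega>).
             integrable (lebesgue_on \<Omega>) (\<lambda>x. (norm (f x))\<^sup>2)}"

definition L2_norm :: "'a::euclidean_space set \<Rightarrow> ('a \<Rightarrow> 'b::euclidean_space) \<Rightarrow> real" where
  "L2_norm \<Omega> f = sqrt (\<integral>x. (norm (f x))\<^sup>2 \<partial>lebesgue_on \<Omega>)"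

definition L2_inner :: "'a::euclidean_space set \<Rightarrow> ('a \<Rightarrow> real) \<Rightarrow> ('a \<Rightarrow> real) \<Rightarrow> real" where
  "L2_inner \<Omega> f g = (\<integral>x. f x * g x \<partial>lebesgue_on \<Omega>)"

definition Linf_norm :: "'a::euclidean_space set \<Rightarrow> ('a \<Rightarrow> real) \<Rightarrow> ennreal" where
  "Linf_norm \<Omega> f = esssup (lebesgue_on \<Omega>) (\<lambda>x. ennreal \<bar>f x\<bar>)"

definition Linf :: "'a::euclidean_space set \<Rightarrow> ('a \<Rightarrow> real) set" where
  "Linf \<Omega> = {f \<in> borel_measurable (lebesgue_on \<Omega>). Linf_norm \<Omega> f < \<infinity>}"

definition weak_gradient ::
    "'a::euclidean_space set \<Rightarrow> ('a \<Rightarrow> real) \<Rightarrow> ('a \<Rightarrow> 'a) \<Rightarrow> bool" where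
  "weak_gradient \<Omega> u G \<longleftrightarrow> (\<forall>\<phi>. test_function \<Omega> \<phi> \<longrightarrow> (\<forall>e\<in>Basis.
     (\<integral>x. u x * frechet_derivative \<phi> (at x) e \<partial>lebesgue_on \<Omega>)
       = - (\<integral>x. (G x \<bullet> e) * \<phi> x \<partial>lebesgue_on \<Omega>)))"

definition H1 :: "'a::euclidean_space set \<Rightarrow> ('a \<Rightarrow> real) set" where
  "H1 \<Omega> = {u \<in> L2 \<Omega>. \<exists>G \<in> L2 \<Omega>. weak_gradient \<Omega> u G}"

text \<open>Meaningful for \<open>u \<in> H1 \<Omega>\<close>; determined up to a null set.\<close>

definition grad :: "'a::euclidean_space set \<Rightarrow> ('a \<Rightarrow> real) \<Rightarrow> 'a \<Rightarrow> 'a" where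
  "grad \<Omega> u = (SOME G. G \<in> L2 \<Omega> \<and> weak_gradient \<Omega> u G)"

definition H1_norm :: "'a::euclidean_space set \<Rightarrow> ('a \<Rightarrow> real) \<Rightarrow> real" where
  "H1_norm \<Omega> u = sqrt ((L2_norm \<Omega> u)\<^sup>2 + (L2_norm \<Omega> (grad \<Omega> u))\<^sup>2)"

definition H2 :: "'a::euclidean_space set \<Rightarrow> ('a \<Rightarrow> real) set" where
  "H2 \<Omega> = {u \<in> H1 \<Omega>. \<forall>e\<in>Basis. (\<lambda>x. grad \<Omega> u x \<bullet> e) \<in> H1 \<Omega>}"

definition H2_norm :: "'a::euclidean_space set \<Rightarrow> ('a \<Rightarrow> real) \<Rightarrow> real" where
  "H2_norm \<Omega> u = sqrt ((H1_norm \<Omega> u)\<^sup>2 +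
     (\<Sum>e\<in>Basis. (L2_norm \<Omega> (grad \<Omega> (\<lambda>x. grad \<Omega> u x \<bullet> e)))\<^sup>2))"

definition H10 :: "'a::euclidean_space set \<Rightarrow> ('a \<Rightarrow> real) set" where
  "H10 \<Omega> = {u \<in> H1 \<Omega>. \<exists>\<phi>. (\<forall>k. test_function \<Omega> (\<phi> k)) \<and>
              (\<lambda>k::nat. H1_norm \<Omega> (u - \<phi> k)) \<longlonglongrightarrow> 0}"

text \<open>Equality of \<open>H\<^sup>1\<close> functions on the boundary, in the sense of traces.\<close>

definition trace_eq :: "'a::euclidean_space set \<Rightarrow> ('a \<Rightarrow> real) \<Rightarrow> ('a \<Rightarrow> real) \<Rightarrow> bool" where
  "trace_eq \<Omega> u w \<longleftrightarrow> u - w \<in> H10 \<Omega>"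

text \<open>The dual of \<open>H10 \<Omega>\<close>.  A function \<open>u\<close> in \<open>L2 \<Omega>\<close> is identified with the functional
  \<open>L2_inner \<Omega> u\<close>.  The values of functionals outside \<open>H10 \<Omega>\<close> are irrelevant.\<close>

definition Hminus1 :: "'a::euclidean_space set \<Rightarrow> (('a \<Rightarrow> real) \<Rightarrow> real) set" where
  "Hminus1 \<Omega> = {F.
     (\<forall>\<phi>\<in>H10 \<Omega>. \<forall>\<psi>\<in>H10 \<Omega>. F (\<lambda>x. \<phi> x + \<psi> x) = F \<phi> + F \<psi>) \<and>
     (\<forall>c. \<forall>\<phi>\<in>H10 \<Omega>. F (\<lambda>x. c * \<phi> x) = c * F \<phi>) \<and>
     (\<exists>M. \<forall>\<phi>\<in>H10 \<Omega>. \<bar>F \<phi>\<bar> \<le> M * H1_norm \<Omega> \<phi>)}"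

definition Hminus1_norm :: "'a::euclidean_space set \<Rightarrow> (('a \<Rightarrow> real) \<Rightarrow> real) \<Rightarrow> real" where
  "Hminus1_norm \<Omega> F = (SUP \<phi> \<in> {\<phi> \<in> H10 \<Omega>. H1_norm \<Omega> \<phi> \<le> 1}. \<bar>F \<phi>\<bar>)"


section \<open>Bochner spaces on a time interval\<close>

text \<open>A Banach space of functions (or functionals) is given by its carrier \<open>X\<close> and its
  (semi)norm \<open>N\<close>.  Strong measurability on \<open>(0,T)\<close> is almost everywhere approximation in \<open>N\<close>
  by measurable functions with finitely many values.\<close>

definition strongly_measurable ::
    "real \<Rightarrow> 'b::minus set \<Rightarrow> ('b \<Rightarrow> real) \<Rightarrow> (real \<Rightarrow> 'b) \<Rightarrow> bool" where
  "strongly_measurable T X N u \<longleftrightarrow>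
     (AE t in lebesgue_on {0<..<T}. u t \<in> X) \<and>
     (\<exists>s :: nat \<Rightarrow> real \<Rightarrow> 'b.
        (\<forall>k. finite (s k ` {0<..<T}) \<and> s k ` {0<..<T} \<subseteq> X \<and>
             (\<forall>y. {t \<in> {0<..<T}. s k t = y} \<in> sets lebesgue)) \<and>
        (AE t in lebesgue_on {0<..<T}. (\<lambda>k. N (u t - s k t)) \<longlonglongrightarrow> 0))"

definition bochner_L2 ::
    "real \<Rightarrow> 'b::minus set \<Rightarrow> ('b \<Rightarrow> real) \<Rightarrow> (real \<Rightarrow> 'b) \<Rightarrow> bool" where
  "bochner_L2 T X N u \<longleftrightarrow> strongly_measurable T X N u \<and>
     integrable (lebesgue_on {0<..<T}) (\<lambda>t. (N (u t))\<^sup>2)"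

definition bochner_Linf ::
    "real \<Rightarrow> 'b::minus set \<Rightarrow> ('b \<Rightarrow> real) \<Rightarrow> (real \<Rightarrow> 'b) \<Rightarrow> bool" where
  "bochner_Linf T X N u \<longleftrightarrow> strongly_measurable T X N u \<and>
     (\<exists>M. AE t in lebesgue_on {0<..<T}. N (u t) \<le> M)"

text \<open>\<open>u\<close> belongs to \<open>H\<^sup>1(0,T;X)\<close> with distributional time derivative \<open>w\<close>.  The identity between
  the two \<open>X\<close>-valued integrals is tested with the functionals \<open>\<lambda>z. pair z \<phi>\<close>, \<open>\<phi> \<in> \<Phi>\<close>, which
  separate the points of \<open>X\<close>.\<close>

definition bochner_H1 ::
    "real \<Rightarrow> 'b::minus set \<Rightarrow> ('b \<Rightarrow> real) \<Rightarrow> ('b \<Rightarrow> 'c \<Rightarrow> real) \<Rightarrow> 'c set \<Rightarrow>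
     (real \<Rightarrow> 'b) \<Rightarrow> (real \<Rightarrow> 'b) \<Rightarrow> bool" where
  "bochner_H1 T X N pair \<Phi> u w \<longleftrightarrow> bochner_L2 T X N u \<and> bochner_L2 T X N w \<and>
     (\<forall>\<phi>\<in>\<Phi>. \<forall>\<psi>. test_function {0<..<T} \<psi> \<longrightarrow>
        (\<integral>t. pair (u t) \<phi> * deriv \<psi> t \<partial>lebesgue_on {0<..<T})
          = - (\<integral>t. pair (w t) \<phi> * \<psi> t \<partial>lebesgue_on {0<..<T}))"

definition H1_time_L2 ::
    "'a::euclidean_space set \<Rightarrow> real \<Rightarrow> (real \<Rightarrow> 'a \<Rightarrow> real) \<Rightarrow> (real \<Rightarrow> 'a \<Rightarrow> real) \<Rightarrow> bool" where
  "H1_time_L2 \<Omega> T u w \<longleftrightarrow> bochner_H1 T (L2 \<Omega>) (L2_norm \<Omega>) (L2_inner \<Omega>) (L2 \<Omega>) u w"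

definition H1_time_Hminus1 ::
    "'a::euclidean_space set \<Rightarrow> real \<Rightarrow> (real \<Rightarrow> 'a \<Rightarrow> real) \<Rightarrow>
     (real \<Rightarrow> ('a \<Rightarrow> real) \<Rightarrow> real) \<Rightarrow> bool" where
  "H1_time_Hminus1 \<Omega> T u w \<longleftrightarrow>
     bochner_H1 T (Hminus1 \<Omega>) (Hminus1_norm \<Omega>) (\<lambda>F. F) (H10 \<Omega>) (\<lambda>t. L2_inner \<Omega> (u t)) w"


section \<open>The magnetization\<close>

definition partial_deriv ::
    "'a::euclidean_space set \<Rightarrow> ('a \<Rightarrow> real^3) \<Rightarrow> 'a \<Rightarrow> 'a \<Rightarrow> real^3" where
  "partial_deriv \<Omega> u e x = (\<chi> k. grad \<Omega> (\<lambda>y. u y $ k) x \<bullet> e)"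

text \<open>The weak form is obtained by testing the Landau--Lifshitz equation with \<open>\<phi>\<close>, writing
  \<open>m \<and> \<Delta>m = \<Sum>\<^sub>e \<partial>\<^sub>e (m \<and> \<partial>\<^sub>e m)\<close> and \<open>- (m \<and> (m \<and> \<Delta>m)) \<bullet> \<phi> = (m \<and> \<Delta>m) \<bullet> (m \<and> \<phi>)\<close>, and
  integrating by parts.  As \<open>\<phi>\<close> is not required to vanish on the boundary, the homogeneous
  Neumann condition is contained in it.

  Membership in \<open>H\<^sup>1(0,T;L\<^sup>2)\<close> determines \<open>m\<close> only for almost every time; the continuity clause
  selects the continuous representative, for which the initial condition makes sense.\<close>

definition landau_lifshitz_solution ::
    "'a::euclidean_space set \<Rightarrow> ('a \<Rightarrow> real^3) \<Rightarrow> (real \<Rightarrow> 'a \<Rightarrow> real^3) \<Rightarrow> bool" where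
  "landau_lifshitz_solution \<Omega> m\<^sub>I m \<longleftrightarrow>
     (AE t in lebesgue_on {0<..}. AE x in lebesgue_on \<Omega>. norm (m t x) = 1) \<and>
     (\<forall>T>0. \<forall>k. bochner_Linf T (H1 \<Omega>) (H1_norm \<Omega>) (\<lambda>t x. m t x $ k)) \<and>
     (\<exists>m'. (\<forall>T>0. \<forall>k. H1_time_L2 \<Omega> T (\<lambda>t x. m t x $ k) (\<lambda>t x. m' t x $ k)) \<and>
        (AE t in lebesgue_on {0<..}. \<forall>\<phi>. (\<forall>k. (\<lambda>x. \<phi> x $ k) \<in> H1 \<Omega> \<inter> Linf \<Omega>) \<longrightarrow>
           (\<integral>x. m' t x \<bullet> \<phi> x \<partial>lebesgue_on \<Omega>) =
           - (\<integral>x. (\<Sum>e\<in>Basis. cross3 (m t x) (partial_deriv \<Omega> (m t) e x)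
                                \<bullet> partial_deriv \<Omega> \<phi> e x) \<partial>lebesgue_on \<Omega>)
           - (\<integral>x. (\<Sum>e\<in>Basis. cross3 (m t x) (partial_deriv \<Omega> (m t) e x)
                                \<bullet> (cross3 (partial_deriv \<Omega> (m t) e x) (\<phi> x)
                                   + cross3 (m t x) (partial_deriv \<Omega> \<phi> e x)))
                \<partial>lebesgue_on \<Omega>))) \<and>
     (\<forall>t\<ge>0. \<forall>k. (\<lambda>x. m t x $ k) \<in> L2 \<Omega>) \<and>
     (\<forall>k. \<forall>\<phi>\<in>L2 \<Omega>. continuous_on {0..} (\<lambda>t. L2_inner \<Omega> (\<lambda>x. m t x $ k) \<phi>)) \<and>
     (AE x in lebesgue_on \<Omega>. m 0 x = m\<^sub>I x)"


section \<open>The spin drift-diffusion system\<close>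

text \<open>The charge density and the spin density components are numbered \<open>0, 1, 2, 3\<close> by natural
  numbers.  A component \<open>k \<in> {1,2,3}\<close> of a vector \<open>m :: real^3\<close> is \<open>m $ of_nat k\<close> (the index
  type \<open>3\<close> is arithmetic modulo 3, so that \<open>of_nat 3 = 3\<close> denotes the last component).\<close>

definition diffusion_matrix :: "real \<Rightarrow> real \<Rightarrow> real^3 \<Rightarrow> nat \<Rightarrow> nat \<Rightarrow> real" where
  "diffusion_matrix D p m i j = (let \<eta> = sqrt (1 - p\<^sup>2) in
     D / \<eta>\<^sup>2 *
       (if i = 0 \<and> j = 0 then 1
        else if i = 0 then - p * m $ of_nat j
        else if j = 0 then - p * m $ of_nat i
        else \<eta> * (if i = j then 1 else 0) + (1 - \<eta>) * (m $ of_nat i * m $ of_nat j)))"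

definition levi_civita :: "nat \<Rightarrow> nat \<Rightarrow> nat \<Rightarrow> real" where
  "levi_civita i j k =
     (if (i, j, k) \<in> {(1, 2, 3), (2, 3, 1), (3, 1, 2)} then 1
      else if (i, j, k) \<in> {(1, 3, 2), (2, 1, 3), (3, 2, 1)} then - 1 else 0)"

definition relaxation_matrix :: "real \<Rightarrow> real \<Rightarrow> real^3 \<Rightarrow> nat \<Rightarrow> nat \<Rightarrow> real" where
  "relaxation_matrix \<gamma> \<tau> m i j =
     (if i \<in> {1..3} \<and> j \<in> {1..3}
      then 2 * \<gamma> * (\<Sum>k=1..3. levi_civita i j k * m $ of_nat k) - (if i = j then 1 / \<tau> else 0)
      else 0)"

definition mobility :: "(real \<Rightarrow> real) \<Rightarrow> real \<Rightarrow> real \<Rightarrow> bool" where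
  "mobility \<mu> v_sat L \<longleftrightarrow> v_sat > 0 \<and> L > 0 \<and> (\<forall>s\<ge>0. \<mu> s > 0) \<and>
     (\<exists>\<mu>'. continuous_on {0..} \<mu>' \<and>
        (\<forall>s\<ge>0. (\<mu> has_real_derivative \<mu>' s) (at s within {0..}) \<and> \<mu>' s \<le> 0)) \<and>
     (\<forall>s\<ge>0. s * \<mu> s \<le> v_sat) \<and>
     (\<forall>s\<ge>0. \<forall>s'\<ge>0. \<bar>s * \<mu> s - s' * \<mu> s'\<bar> \<le> L * \<bar>s - s'\<bar>)"

definition drift :: "'a::euclidean_space set \<Rightarrow> (real \<Rightarrow> real) \<Rightarrow> ('a \<Rightarrow> real) \<Rightarrow> 'a \<Rightarrow> 'a" where
  "drift \<Omega> \<mu> V x = - (\<mu> (norm (grad \<Omega> V x)) *\<^sub>R grad \<Omega> V x)"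

text \<open>Weak form of \<open>- lam\<^sup>2 \<Delta>V = 2 n\<^sub>0 - C\<close> in \<open>\<Omega>\<close>.\<close>

definition poisson_equation ::
    "'a::euclidean_space set \<Rightarrow> real \<Rightarrow> ('a \<Rightarrow> real) \<Rightarrow> ('a \<Rightarrow> real) \<Rightarrow> ('a \<Rightarrow> real) \<Rightarrow> bool" where
  "poisson_equation \<Omega> lam C n\<^sub>0 V \<longleftrightarrow> (\<forall>\<phi>\<in>H10 \<Omega>.
     lam\<^sup>2 * (\<integral>x. grad \<Omega> V x \<bullet> grad \<Omega> \<phi> x \<partial>lebesgue_on \<Omega>)
       = (\<integral>x. (2 * n\<^sub>0 x - C x) * \<phi> x \<partial>lebesgue_on \<Omega>))"

text \<open>A steady state attains the time-independent boundary data of the evolution problem in all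
  four components of \<open>n\<close>.  For the spin components, which vanish in \<open>\<Omega>\<close>, this says that \<open>n\<^sub>D j\<close>
  has zero trace; otherwise no solution could converge to the steady state.\<close>

definition steady_state ::
    "'a::euclidean_space set \<Rightarrow> real \<Rightarrow> ('a \<Rightarrow> real) \<Rightarrow> (real \<Rightarrow> real) \<Rightarrow>
     (nat \<Rightarrow> 'a \<Rightarrow> real) \<Rightarrow> ('a \<Rightarrow> real) \<Rightarrow> (nat \<Rightarrow> 'a \<Rightarrow> real) \<Rightarrow> ('a \<Rightarrow> real) \<Rightarrow> bool" where
  "steady_state \<Omega> lam C \<mu> n\<^sub>D V\<^sub>D n\<^sub>e V\<^sub>e \<longleftrightarrow>
     (\<forall>j\<le>3. n\<^sub>e j \<in> H1 \<Omega>) \<and> V\<^sub>e \<in> H1 \<Omega> \<and>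
     (AE x in lebesgue_on \<Omega>.
        grad \<Omega> (n\<^sub>e 0) x + (n\<^sub>e 0 x * \<mu> (norm (grad \<Omega> V\<^sub>e x))) *\<^sub>R grad \<Omega> V\<^sub>e x = 0) \<and>
     poisson_equation \<Omega> lam C (n\<^sub>e 0) V\<^sub>e \<and>
     (\<forall>j\<in>{1..3}. AE x in lebesgue_on \<Omega>. n\<^sub>e j x = 0) \<and>
     (\<forall>j\<le>3. trace_eq \<Omega> (n\<^sub>e j) (n\<^sub>D j)) \<and> trace_eq \<Omega> V\<^sub>e V\<^sub>D"

text \<open>The functional \<open>n' i t\<close> is the time derivative of \<open>n i\<close>.  As for the magnetization,
  membership in \<open>H\<^sup>1(0,T;H\<^sup>-\<^sup>1)\<close> determines \<open>n i\<close> only for almost every time, and the continuity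
  clause selects the representative continuous with respect to \<open>t\<close>; \<open>n i t\<close> is then
  determined for every \<open>t \<ge> 0\<close>, in particular at \<open>t = 0\<close>.\<close>

definition spin_drift_diffusion_solution ::
    "'a::euclidean_space set \<Rightarrow> ('a \<Rightarrow> real) \<Rightarrow> ('a \<Rightarrow> real) \<Rightarrow> ('a \<Rightarrow> real) \<Rightarrow>
     real \<Rightarrow> real \<Rightarrow> real \<Rightarrow> (real \<Rightarrow> real) \<Rightarrow> (real \<Rightarrow> 'a \<Rightarrow> real^3) \<Rightarrow>
     (nat \<Rightarrow> 'a \<Rightarrow> real) \<Rightarrow> ('a \<Rightarrow> real) \<Rightarrow> (nat \<Rightarrow> 'a \<Rightarrow> real) \<Rightarrow>
     (nat \<Rightarrow> real \<Rightarrow> 'a \<Rightarrow> real) \<Rightarrow> (real \<Rightarrow> 'a \<Rightarrow> real) \<Rightarrow> bool" where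
  "spin_drift_diffusion_solution \<Omega> D p C lam \<gamma> \<tau> \<mu> m n\<^sub>D V\<^sub>D n\<^sub>I n V \<longleftrightarrow>
     (\<forall>T>0. \<forall>i\<le>3. bochner_L2 T (H1 \<Omega>) (H1_norm \<Omega>) (n i) \<and>
                   bochner_Linf T (L2 \<Omega>) (L2_norm \<Omega>) (n i)) \<and>
     (\<forall>T>0. bochner_L2 T (H2 \<Omega>) (H2_norm \<Omega>) V \<and>
             bochner_Linf T (H1 \<Omega>) (H1_norm \<Omega>) V \<and>
             (\<exists>V'. H1_time_L2 \<Omega> T V V')) \<and>
     (\<exists>n'. (\<forall>T>0. \<forall>i\<le>3. H1_time_Hminus1 \<Omega> T (n i) (n' i)) \<and>
        (AE t in lebesgue_on {0<..}. \<forall>i\<le>3. \<forall>\<phi>\<in>H10 \<Omega>.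
           n' i t \<phi> =
           - (\<integral>x. (\<Sum>j\<le>3. diffusion_matrix (D x) (p x) (m t x) i j *\<^sub>R
                       (grad \<Omega> (n j t) x - n j t x *\<^sub>R drift \<Omega> \<mu> (V t) x)) \<bullet> grad \<Omega> \<phi> x
                \<partial>lebesgue_on \<Omega>)
           + (\<integral>x. (\<Sum>j\<le>3. relaxation_matrix \<gamma> \<tau> (m t x) i j * n j t x) * \<phi> x
                \<partial>lebesgue_on \<Omega>))) \<and>
     (AE t in lebesgue_on {0<..}. poisson_equation \<Omega> lam C (n 0 t) (V t)) \<and>
     (AE t in lebesgue_on {0<..}. (\<forall>i\<le>3. trace_eq \<Omega> (n i t) (n\<^sub>D i)) \<and> trace_eq \<Omega> (V t) V\<^sub>D) \<and>
     (\<forall>t\<ge>0. \<forall>i\<le>3. n i t \<in> L2 \<Omega>) \<and>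
     (\<forall>i\<le>3. \<forall>\<phi>\<in>H10 \<Omega>. continuous_on {0..} (\<lambda>t. L2_inner \<Omega> (n i t) \<phi>)) \<and>
     (\<forall>i\<le>3. AE x in lebesgue_on \<Omega>. n i 0 x = n\<^sub>I i x)"

end

theory Submission
  imports Defs
begin

text \<open>With \<open>w = n - n\<^sub>e\<close>, testing the equation with \<open>w\<close> gives
  \<open>d/dt |w|\<^sup>2 \<le> - k |w|\<^sup>2\<close>: the matrix \<open>A\<close> is uniformly coercive, \<open>B\<close> is
  dissipative, the flux difference is \<open>\<nabla>w - w v - n\<^sub>e (v - v\<^sub>e)\<close> because the flux of the steady state
  vanishes, \<open>|v| \<le> v_sat\<close>, and \<open>v - v\<^sub>e\<close> is bounded by \<open>L |\<nabla>(V - V\<^sub>e)|\<close>, hence by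
  \<open>L lam\<^sup>-\<^sup>2 |w|\<close>, so that Poincare's inequality absorbs all perturbations when \<open>K\<close> is small.

  The chain rule for \<open>|w|\<^sup>2\<close> is avoided. The identity \<open>|w(t+h)|\<^sup>2 - |w(t)|\<^sup>2 =
  \<integral> \<langle>w'(r), w(t+h) + w(t)\<rangle> dr\<close> over the interval from \<open>t\<close> to \<open>t+h\<close>, together with continuity of
  translations in \<open>L\<^sup>2(0,T;H\<^sup>1)\<close>, yields a Gronwall inequality for averages of \<open>|w|\<^sup>2\<close> over short
  intervals, up to an error that vanishes with their length. Weak lower semicontinuity of the norm
  transfers the decay to every time.\<close>

section \<open>Smooth functions of one and several variables\<close>

text \<open>The obstacle is that the difference w lies in \<open>H10 \<Omega>\<close> only for
  almost every time, while each derivative \<open>n' i t\<close> is a functional attached to its own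
  time. On a short interval the functional at time r therefore meets the fixed sum w(t+h) + w(t),
  and replacing this sum by 2 w(r) costs the dual norm times a translation error in H1. Young's
  inequality with a weight fixed beforehand splits the product: the dual part is small by the
  weight, the translation part because the times are close. \<open>K\<close> carries no
  \<open>lam\<close> because the potential estimate contributes exactly the factor L^2 lam^-4
  |n_e|^2 of the smallness condition; what remains are Poincare's constant and bounds of D and p.
  The prefactor of the decay is an essential bound of |w|^2 on (0,1), so no pointwise control at
  time 0 enters. Gradients are arbitrarily chosen representatives. Every identity between them rests
  on uniqueness of weak gradients, hence on the density of test functions in L2, and this is what
  the smooth steps and plateaus are built for; the plateaus serve again as test functions in
  time.\<close>

lemma C_k_imp_continuous: "C_k k f \<Longrightarrow> continuous_on UNIV f"
  by (cases k) (auto simp: continuous_on_eq_continuous_at intro: differentiable_imp_continuous_within)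

lemma C_k_lower: "C_k (Suc k) f \<Longrightarrow> C_k k f"
proof (induction k arbitrary: f)
  case 0
  then show ?case using C_k_imp_continuous by (metis C_k.simps(1))
qed auto

lemma C_k_const [simp]: "C_k k (\<lambda>x. c)"
proof (induction k arbitrary: c)
  case (Suc k)
  have "frechet_derivative (\<lambda>x::'a. c) (at x) = (\<lambda>h. 0)" for x
    by (metis frechet_derivative_at has_derivative_const)
  with Suc show ?case by simp
qed auto

lemma C_k_add: "C_k k f \<Longrightarrow> C_k k g \<Longrightarrow> C_k k (\<lambda>x. f x + g x)"
proof (induction k arbitrary: f g)
  case (Suc k)
  have "frechet_derivative (\<lambda>x. f x + g x) (at x) e
        = frechet_derivative f (at x) e + frechet_derivative g (at x) e" for x e
    using Suc.prems by (subst frechet_derivative_at[symmetric, OF has_derivative_add])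
      (auto simp: frechet_derivative_works[symmetric])
  with Suc show ?case by auto
qed (auto intro: continuous_intros)

lemma C_k_mult: "C_k k f \<Longrightarrow> C_k k g \<Longrightarrow> C_k k (\<lambda>x. f x * g x)"
proof (induction k arbitrary: f g)
  case (Suc k)
  have "frechet_derivative (\<lambda>x. f x * g x) (at x) e
        = f x * frechet_derivative g (at x) e + frechet_derivative f (at x) e * g x" for x e
    using Suc.prems by (subst frechet_derivative_at[symmetric, OF has_derivative_mult])
      (auto simp: frechet_derivative_works[symmetric])
  moreover have "C_k k (\<lambda>x. f x * frechet_derivative g (at x) e + frechet_derivative f (at x) e * g x)"
    if "e \<in> Basis" for e
    using Suc C_k_lower that by (intro C_k_add Suc.IH) auto
  ultimately show ?case using Suc.prems by auto
qed (auto intro: continuous_intros)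

lemma C_k_prod: "(\<And>i. i \<in> I \<Longrightarrow> C_k k (f i)) \<Longrightarrow> C_k k (\<lambda>x. \<Prod>i\<in>I. f i x)"
  by (induction I rule: infinite_finite_induct) (auto intro: C_k_mult)

lemma C_k_inner [simp]: "C_k k (\<lambda>x. x \<bullet> a)"
proof (cases k)
  case (Suc n)
  have "frechet_derivative (\<lambda>x. x \<bullet> a) (at x) = (\<lambda>h. h \<bullet> a)" for x
    by (rule frechet_derivative_at[symmetric]) (auto intro!: derivative_eq_intros)
  then show ?thesis by (auto simp: Suc)
qed (auto intro: continuous_intros)

lemma frechet_derivative_real:
  fixes f :: "real \<Rightarrow> real"
  assumes "(f has_real_derivative d) (at x)"
  shows "frechet_derivative f (at x) 1 = d"
  using frechet_derivative_at[OF assms[unfolded has_field_derivative_def], symmetric] by simp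

lemma C_k_Suc_realI:
  fixes f f' :: "real \<Rightarrow> real"
  assumes "\<And>x. (f has_real_derivative f' x) (at x)" "C_k k f'"
  shows "C_k (Suc k) f"
proof -
  have "frechet_derivative f (at x) 1 = f' x" for x
    by (rule frechet_derivative_real[OF assms(1)])
  with assms show ?thesis by (auto simp: real_differentiable_def)
qed

lemma C_k_Suc_realD:
  fixes f :: "real \<Rightarrow> real"
  assumes "C_k (Suc k) f"
  shows "(f has_real_derivative deriv f x) (at x)" "C_k k (deriv f)"
proof -
  have 1: "(f has_real_derivative deriv f x) (at x)" for x
    using assms by (auto simp: DERIV_deriv_iff_real_differentiable)
  show "(f has_real_derivative deriv f x) (at x)" by (rule 1)
  have "frechet_derivative f (at x) 1 = deriv f x" for x
    by (rule frechet_derivative_real[OF 1])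
  then show "C_k k (deriv f)" using assms by simp
qed

lemma C_k_compose_affine:
  fixes f :: "real \<Rightarrow> real" and a :: "'a::euclidean_space"
  shows "C_k k f \<Longrightarrow> C_k k (\<lambda>x. f (x \<bullet> a + c))"
proof (induction k arbitrary: f)
  case 0
  then show ?case by (auto intro!: continuous_intros continuous_on_compose2[of UNIV f])
next
  case (Suc k)
  note f = C_k_Suc_realD[OF Suc.prems]
  have d: "((\<lambda>x. f (x \<bullet> a + c)) has_derivative (\<lambda>h. deriv f (x \<bullet> a + c) * (h \<bullet> a))) (at x)" for x
    by (rule has_derivative_compose[OF _ f(1)[unfolded has_field_derivative_def], of "\<lambda>x. x \<bullet> a + c", simplified])
      (auto intro!: derivative_eq_intros)
  have "C_k k (\<lambda>x. deriv f (x \<bullet> a + c) * (e \<bullet> a))" for e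
    by (intro C_k_mult Suc.IH f C_k_const)
  then show ?case
    using d by (auto simp: frechet_derivative_at[OF d, symmetric] differentiable_def)
qed

subsection \<open>Smooth step functions\<close>

text \<open>The family of all \<open>P(1/x) exp(-1/x)\<close> with \<open>P\<close> a polynomial is closed under differentiation.\<close>

definition flat :: "real poly \<Rightarrow> real \<Rightarrow> real" where
  "flat P x = (if x > 0 then poly P (1 / x) * exp (- (1 / x)) else 0)"

lemma poly_times_exp_tendsto_0: "((\<lambda>y. poly P y * exp (- y)) \<longlongrightarrow> 0) (at_top :: real filter)"
proof -
  have "((\<lambda>y. \<Sum>i\<le>degree P. coeff P i * (y ^ i / exp y)) \<longlongrightarrow> (\<Sum>i\<le>degree P. coeff P i * 0)) at_top"
    by (intro tendsto_intros tendsto_power_div_exp_0)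
  moreover have "poly P y * exp (- y) = (\<Sum>i\<le>degree P. coeff P i * (y ^ i / exp y))" for y
    by (simp add: poly_altdef sum_distrib_right exp_minus divide_inverse mult.assoc)
  ultimately show ?thesis by simp
qed

text \<open>Differentiation through 1/x turns P into X^2 (P - P'), which is
  \<open>[:0, 0, 1:] * (P - pderiv P)\<close>. The delicate point is 0: there the left quotient
  vanishes identically, and the right one tends to 0 because the exponential beats every
  power.\<close>

lemma flat_has_derivative:
  "(flat P has_real_derivative flat ([:0, 0, 1:] * (P - pderiv P)) x) (at x)"
proof -
  consider "x > 0" | "x < 0" | "x = 0" by linarith
  then show ?thesis
  proof cases
    case 1
    have "((\<lambda>x. poly P (1 / x) * exp (- (1 / x))) has_real_derivative
        flat ([:0, 0, 1:] * (P - pderiv P)) x) (at x)"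
      using 1 by (auto intro!: derivative_eq_intros poly_DERIV[THEN DERIV_chain2]
          simp: flat_def field_simps power2_eq_square)
    then show ?thesis
      by (rule DERIV_cong_ev[THEN iffD1, rotated 3])
        (use 1 in \<open>auto simp: flat_def eventually_nhds intro!: exI[of _ "{0<..}"]\<close>)
  next
    case 2
    have "((\<lambda>x. 0) has_real_derivative flat ([:0, 0, 1:] * (P - pderiv P)) x) (at x)"
      using 2 by (auto simp: flat_def)
    then show ?thesis
      by (rule DERIV_cong_ev[THEN iffD1, rotated 3])
        (use 2 in \<open>auto simp: flat_def eventually_nhds intro!: exI[of _ "{..<0}"]\<close>)
  next
    case 3
    have r: "((\<lambda>h. flat P h / h) \<longlongrightarrow> 0) (at_right 0)"
    proof -
      \<comment> \<open>With y = 1/h, division by h is multiplication by y; hence the factor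
        \<open>[:0, 1:]\<close>.\<close>
      have "((\<lambda>h. poly ([:0, 1:] * P) (inverse h) * exp (- inverse h)) \<longlongrightarrow> 0) (at_right (0::real))"
        by (rule filterlim_compose[OF poly_times_exp_tendsto_0 filterlim_inverse_at_top_right])
      then show ?thesis
        by (rule Lim_transform_eventually)
          (auto simp: eventually_at_filter flat_def field_simps)
    qed
    have l: "((\<lambda>h. flat P h / h) \<longlongrightarrow> 0) (at_left 0)"
      by (rule Lim_transform_eventually[OF tendsto_const]) (auto simp: eventually_at_filter flat_def)
    from l r have "((\<lambda>h. flat P h / h) \<longlongrightarrow> 0) (at 0)"
      by (rule filterlim_split_at)
    then show ?thesis
      using 3 by (simp add: DERIV_def flat_def)
  qed
qed

lemma C_k_flat: "C_k k (flat P)"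
proof (induction k arbitrary: P)
  case 0
  show ?case
    using DERIV_isCont[OF flat_has_derivative] by (simp add: continuous_on_eq_continuous_at)
next
  case (Suc k)
  show ?case by (rule C_k_Suc_realI[OF flat_has_derivative Suc])
qed

definition bump :: "real \<Rightarrow> real" where
  "bump x = flat 1 x * flat 1 (1 - x)"

lemma C_k_bump: "C_k k bump"
  using C_k_mult[OF C_k_flat C_k_compose_affine[OF C_k_flat, where a = "-1::real" and c = 1]]
  unfolding bump_def[abs_def] by simp

lemma bump_nonneg: "bump x \<ge> 0" by (auto simp: bump_def flat_def)
lemma bump_pos: "0 < x \<Longrightarrow> x < 1 \<Longrightarrow> bump x > 0" by (auto simp: bump_def flat_def)
lemma bump_eq_0: "x \<le> 0 \<or> x \<ge> 1 \<Longrightarrow> bump x = 0" by (auto simp: bump_def flat_def)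
lemma continuous_on_bump: "continuous_on A bump"
  using C_k_bump[of 0] continuous_on_subset by auto

text \<open>Primitive of \<open>bump\<close> normalized to total mass 1. For negative
  \<open>x\<close> the interval is empty and the integral 0, the correct value because
  \<open>bump\<close> vanishes there.\<close>

definition smooth_step :: "real \<Rightarrow> real" where
  "smooth_step x = integral {0..x} bump / integral {0..1} bump"

lemma bump_integral_pos: "integral {0..1} bump > 0"
proof -
  have "integral {0..1} bump \<noteq> 0"
    using integral_eq_0_iff[of 0 1 bump, OF continuous_on_bump] bump_nonneg bump_pos[of "1/2"]
    by force
  moreover have "integral {0..1} bump \<ge> 0"
    by (intro integral_nonneg integrable_continuous_interval continuous_on_bump bump_nonneg)
  ultimately show ?thesis by linarith
qed

lemma smooth_step_has_derivative:
  "(smooth_step has_real_derivative bump x / integral {0..1} bump) (at x)"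
proof -
  define F where "F x = integral {-\<bar>x\<bar>-1..x} bump" for x
  \<comment> \<open>Every base point left of 0 gives the same primitive. A base point further left
    is needed so that also an \<open>x \<le> 0\<close> is interior to the interval of integration,
    as the two-sided derivative requires.\<close>
  have eq: "integral {0..y} bump = integral {a..y} bump" if "a \<le> 0" for a y
  proof (cases "y \<le> 0")
    case True
    then have "integral {a..y} bump = integral {a..y} (\<lambda>x. 0)"
      by (intro integral_cong) (auto simp: bump_eq_0)
    moreover have "integral {0..y} bump = integral {0..y} (\<lambda>x. 0)"
      using True by (intro integral_cong) (auto simp: bump_eq_0)
    ultimately show ?thesis by simp
  next
    case False
    have "integral {a..0} bump + integral {0..y} bump = integral {a..y} bump"
      using that False by (intro Henstock_Kurzweil_Integration.integral_combine
          integrable_continuous_interval continuous_on_bump) auto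
    moreover have "integral {a..0} bump = integral {a..0} (\<lambda>x. 0)"
      by (intro integral_cong) (auto simp: bump_eq_0)
    ultimately show ?thesis by simp
  qed
  let ?a = "min 0 x - 1" and ?b = "x + 1"
  have "((\<lambda>u. integral {?a..u} bump) has_real_derivative bump x) (at x within {?a..?b})"
    by (rule integral_has_real_derivative[OF continuous_on_bump]) auto
  then have "((\<lambda>u. integral {?a..u} bump) has_real_derivative bump x) (at x)"
    by (subst (asm) at_within_interior) auto
  then have "((\<lambda>u. integral {0..u} bump) has_real_derivative bump x) (at x)"
    using eq[of ?a] by (auto simp: min_def)
  then show ?thesis
    unfolding smooth_step_def[abs_def] by (rule DERIV_cdivide)
qed

lemma C_k_smooth_step: "C_k k smooth_step"
proof -
  have "C_k k (\<lambda>x. bump x * (1 / integral {0..1} bump))"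
    by (intro C_k_mult C_k_bump C_k_const)
  then have "C_k (Suc k) smooth_step"
    using smooth_step_has_derivative by (intro C_k_Suc_realI[of _ "\<lambda>x. bump x / integral {0..1} bump"]) auto
  then show ?thesis by (rule C_k_lower)
qed

lemma smooth_step_mono: "x \<le> y \<Longrightarrow> smooth_step x \<le> smooth_step y"
  by (rule DERIV_nonneg_imp_nondecreasing[of x y])
     (use smooth_step_has_derivative bump_nonneg bump_integral_pos in \<open>auto intro!: exI divide_nonneg_pos\<close>)

lemma smooth_step_0: "x \<le> 0 \<Longrightarrow> smooth_step x = 0"
  using integral_cong[of "{0..x}" bump "\<lambda>_. 0"] by (simp add: smooth_step_def bump_eq_0)

lemma smooth_step_1: "x \<ge> 1 \<Longrightarrow> smooth_step x = 1"
proof -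
  assume x: "x \<ge> 1"
  have "integral {0..1} bump + integral {1..x} bump = integral {0..x} bump"
    using x by (intro Henstock_Kurzweil_Integration.integral_combine
          integrable_continuous_interval continuous_on_bump) auto
  moreover have "integral {1..x} bump = integral {1..x} (\<lambda>x. 0)"
    by (intro integral_cong) (auto simp: bump_eq_0)
  ultimately show ?thesis using bump_integral_pos by (simp add: smooth_step_def)
qed

lemma smooth_step_bounds: "0 \<le> smooth_step x" "smooth_step x \<le> 1"
  using smooth_step_mono[of "min 0 x" x] smooth_step_mono[of x "max 1 x"]
  by (auto simp: smooth_step_0 smooth_step_1)

section \<open>Plateau functions on intervals and boxes\<close>

definition plateau :: "real \<Rightarrow> real \<Rightarrow> real \<Rightarrow> real \<Rightarrow> real" where
  "plateau k a b x = smooth_step (k * (x - a) - 1) * smooth_step (k * (b - x) - 1)"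

lemma C_k_plateau: "C_k n (plateau k a b)"
proof -
  have "C_k n (\<lambda>x. smooth_step (x \<bullet> k + (-k*a-1)) * smooth_step (x \<bullet> (-k) + (k*b-1)))"
    by (intro C_k_mult C_k_compose_affine C_k_smooth_step)
  then show ?thesis unfolding plateau_def[abs_def] by (simp add: algebra_simps)
qed

lemma plateau_bounds: "0 \<le> plateau k a b x" "plateau k a b x \<le> 1"
  using smooth_step_bounds by (auto simp: plateau_def intro: mult_le_one)

lemma plateau_eq_0: "k > 0 \<Longrightarrow> x \<le> a + 1 / k \<or> x \<ge> b - 1 / k \<Longrightarrow> plateau k a b x = 0"
  by (auto simp: plateau_def smooth_step_0 field_simps)

lemma plateau_eq_1: "k > 0 \<Longrightarrow> a + 2 / k \<le> x \<Longrightarrow> x \<le> b - 2 / k \<Longrightarrow> plateau k a b x = 1"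
  by (auto simp: plateau_def smooth_step_1 field_simps)

text \<open>The shift by 1 inside \<open>plateau\<close> is made for this: the function vanishes
  within \<open>1 / k\<close> of both end points, which leaves a closed interval around its support
  inside the open one.\<close>

lemma test_function_plateau:
  fixes a b k :: real
  assumes "k > 0" "{a<..<b} \<subseteq> \<Omega>"
  shows "test_function \<Omega> (plateau k a b)"
proof -
  have "{x. plateau k a b x \<noteq> 0} \<subseteq> {a + 1 / k .. b - 1 / k}"
  proof
    fix x assume "x \<in> {x. plateau k a b x \<noteq> 0}"
    then show "x \<in> {a + 1 / k .. b - 1 / k}"
      using plateau_eq_0[OF assms(1), of x a b] unfolding mem_Collect_eq atLeastAtMost_iff by linarith
  qed
  then have cl: "closure {x. plateau k a b x \<noteq> 0} \<subseteq> {a + 1 / k .. b - 1 / k}"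
    by (rule closure_minimal) auto
  also have "\<dots> \<subseteq> {a<..<b}"
  proof
    fix x assume "x \<in> {a + 1 / k .. b - 1 / k}"
    then have "a + 1 / k \<le> x" "x \<le> b - 1 / k" "1 / k > 0" using assms(1) by auto
    then show "x \<in> {a<..<b}" unfolding greaterThanLessThan_iff by linarith
  qed
  finally have "closure {x. plateau k a b x \<noteq> 0} \<subseteq> \<Omega>" using assms(2) by blast
  moreover have "compact (closure {x. plateau k a b x \<noteq> 0})"
    using cl by (meson bounded_closed_interval bounded_subset closed_closure compact_eq_bounded_closed)
  ultimately show ?thesis by (auto simp: test_function_def C_k_plateau)
qed

definition box_plateau :: "real \<Rightarrow> 'a::euclidean_space \<Rightarrow> 'a \<Rightarrow> 'a \<Rightarrow> real" where
  "box_plateau k a b x = (\<Prod>e\<in>Basis. plateau k (a \<bullet> e) (b \<bullet> e) (x \<bullet> e))"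

lemma test_function_box_plateau:
  assumes "k > 0" "box a b \<subseteq> \<Omega>"
  shows "test_function \<Omega> (box_plateau k a b)"
proof -
  \<comment> \<open>Margin vector: the box shrunk by \<open>1 / k\<close> in every coordinate is
    closed and contains the support.\<close>
  define d :: 'a where "d = (\<Sum>e\<in>Basis. (1 / k) *\<^sub>R e)"
  have d: "d \<bullet> e = 1 / k" if "e \<in> Basis" for e
    using that by (simp add: d_def)
  have "{x. box_plateau k a b x \<noteq> 0} \<subseteq> cbox (a + d) (b - d)"
  proof
    fix x assume "x \<in> {x. box_plateau k a b x \<noteq> 0}"
    then have nz: "plateau k (a \<bullet> e) (b \<bullet> e) (x \<bullet> e) \<noteq> 0" if "e \<in> Basis" for e
      using that by (auto simp: box_plateau_def)
    have "a \<bullet> e + 1 / k \<le> x \<bullet> e \<and> x \<bullet> e \<le> b \<bullet> e - 1 / k" if "e \<in> Basis" for e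
      using nz[OF that]
        plateau_eq_0[OF assms(1), of "x \<bullet> e" "a \<bullet> e" "b \<bullet> e"]
      by linarith
    then show "x \<in> cbox (a + d) (b - d)"
      by (simp add: mem_box inner_simps d)
  qed
  then have cl: "closure {x. box_plateau k a b x \<noteq> 0} \<subseteq> cbox (a + d) (b - d)"
    by (rule closure_minimal) auto
  also have "\<dots> \<subseteq> box a b"
  proof
    fix x assume x: "x \<in> cbox (a + d) (b - d)"
    have "a \<bullet> e < x \<bullet> e \<and> x \<bullet> e < b \<bullet> e" if "e \<in> Basis" for e
    proof -
      have "a \<bullet> e + 1 / k \<le> x \<bullet> e" "x \<bullet> e \<le> b \<bullet> e - 1 / k" "1 / k > 0"
        using x that assms(1) by (auto simp: mem_box inner_simps d)
      then show ?thesis by linarith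
    qed
    then show "x \<in> box a b" by (simp add: mem_box)
  qed
  finally have "closure {x. box_plateau k a b x \<noteq> 0} \<subseteq> \<Omega>" using assms(2) by blast
  moreover have "compact (closure {x. box_plateau k a b x \<noteq> 0})"
    using cl by (meson bounded_cbox bounded_subset closed_closure compact_eq_bounded_closed)
  moreover have "C_k n (box_plateau k a b)" for n
  proof -
    have "C_k n (\<lambda>x. \<Prod>e\<in>Basis. plateau k (a \<bullet> e) (b \<bullet> e) (x \<bullet> e + 0))"
      by (intro C_k_prod C_k_compose_affine C_k_plateau)
    then show ?thesis by (simp add: box_plateau_def[abs_def])
  qed
  ultimately show ?thesis by (auto simp: test_function_def)
qed

lemma box_plateau_bounds: "0 \<le> box_plateau k a b x" "box_plateau k a b x \<le> 1"
  using plateau_bounds by (auto simp: box_plateau_def intro!: prod_nonneg prod_le_1)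

text \<open>At an interior point the value is 1 as soon as 2/(n+1) is below the distance to both
  ends; at all other points it is constantly 0. \<open>Suc n\<close> keeps the steepness
  positive.\<close>

lemma plateau_tendsto:
  "(\<lambda>n. plateau (Suc n) a b x) \<longlonglongrightarrow> indicator {a<..<b} x"
proof (cases "a < x \<and> x < b")
  case True
  have "\<forall>\<^sub>F n in sequentially. 2 / real (Suc n) < min (x - a) (b - x)"
    using True by (intro order_tendstoD(2)[OF LIMSEQ_Suc[OF lim_const_over_n]]) auto
  then have "\<forall>\<^sub>F n in sequentially. plateau (Suc n) a b x = 1"
    by eventually_elim (intro plateau_eq_1, auto)
  then show ?thesis using True by (auto intro: tendsto_eventually)
next
  case False
  have "plateau (Suc n) a b x = 0" for n
  proof (rule plateau_eq_0)
    show "x \<le> a + 1 / real (Suc n) \<or> b - 1 / real (Suc n) \<le> x"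
    proof -
      have "1 / real (Suc n) > 0" by simp
      then show ?thesis using False by linarith
    qed
  qed auto
  then have "plateau (Suc n) a b x = indicator {a<..<b} x" for n
    using False by (simp del: of_nat_Suc)
  then show ?thesis by (simp del: of_nat_Suc)
qed

lemma box_plateau_tendsto:
  "(\<lambda>n. box_plateau (Suc n) a b x) \<longlonglongrightarrow> indicator (box a b) x"
proof -
  have "(\<Prod>e\<in>Basis. indicator {a \<bullet> e<..<b \<bullet> e} (x \<bullet> e) :: real) = indicator (box a b) x"
    by (auto simp: indicator_def mem_box)
  moreover have "(\<lambda>n. box_plateau (Suc n) a b x) \<longlonglongrightarrow> (\<Prod>e\<in>Basis. indicator {a \<bullet> e<..<b \<bullet> e} (x \<bullet> e))"
    unfolding box_plateau_def by (intro tendsto_prod plateau_tendsto)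
  ultimately show ?thesis by simp
qed

section \<open>Lebesgue spaces and density of test functions\<close>

lemma test_function_imp_C_k: "test_function \<Omega> \<phi> \<Longrightarrow> C_k k \<phi>"
  by (simp add: test_function_def)

lemma test_function_continuous: "test_function \<Omega> \<phi> \<Longrightarrow> continuous_on A \<phi>"
  by (meson C_k_imp_continuous continuous_on_subset subset_UNIV test_function_imp_C_k)

lemma test_function_support_subset:
  assumes "\<And>k. C_k k \<phi>" and "closure {x. \<phi> x \<noteq> 0} \<subseteq> K" "compact K" "K \<subseteq> \<Omega>"
  shows "test_function \<Omega> \<phi>"
  using assms
  by (auto simp: test_function_def) (metis compact_closure compact_imp_bounded bounded_subset closure_subset)

lemma test_function_mult_left:
  assumes "\<And>k. C_k k f" and g: "test_function \<Omega> g"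
  shows "test_function \<Omega> (\<lambda>x. f x * g x)"
proof (rule test_function_support_subset)
  show "C_k k (\<lambda>x. f x * g x)" for k
    by (intro C_k_mult assms test_function_imp_C_k[OF g])
  show "closure {x. f x * g x \<noteq> 0} \<subseteq> closure {x. g x \<noteq> 0}"
    by (rule closure_mono) auto
qed (use g in \<open>auto simp: test_function_def\<close>)

lemma test_function_add:
  assumes f: "test_function \<Omega> f" and g: "test_function \<Omega> g"
  shows "test_function \<Omega> (\<lambda>x. f x + g x)"
proof (rule test_function_support_subset)
  show "C_k k (\<lambda>x. f x + g x)" for k
    by (intro C_k_add test_function_imp_C_k[OF f] test_function_imp_C_k[OF g])
  have "closure {x. f x + g x \<noteq> 0} \<subseteq> closure ({x. f x \<noteq> 0} \<union> {x. g x \<noteq> 0})"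
    by (rule closure_mono) auto
  then show "closure {x. f x + g x \<noteq> 0} \<subseteq> closure {x. f x \<noteq> 0} \<union> closure {x. g x \<noteq> 0}"
    by simp
qed (use f g in \<open>auto simp: test_function_def\<close>)

lemma test_function_cmult: "test_function \<Omega> g \<Longrightarrow> test_function \<Omega> (\<lambda>x. c * g x)"
  by (rule test_function_mult_left) auto

lemma test_function_diff: "test_function \<Omega> f \<Longrightarrow> test_function \<Omega> g \<Longrightarrow> test_function \<Omega> (\<lambda>x. f x - g x)"
  using test_function_add[of \<Omega> f "\<lambda>x. (-1) * g x"] test_function_cmult[of \<Omega> g "-1"] by simp

lemma test_function_zero: "test_function \<Omega> (\<lambda>x. 0)"
  by (simp add: test_function_def)

lemma test_function_support: "test_function \<Omega> \<phi> \<Longrightarrow> x \<notin> \<Omega> \<Longrightarrow> \<phi> x = 0"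
  using closure_subset[of "{x. \<phi> x \<noteq> 0}"] by (auto simp: test_function_def)

lemma test_function_bounded:
  assumes "test_function \<Omega> \<phi>"
  obtains B where "B > 0" "\<And>x. \<bar>\<phi> x\<bar> \<le> B"
proof -
  let ?K = "closure {x. \<phi> x \<noteq> 0}"
  have "compact ?K" using assms by (simp add: test_function_def)
  then have "bounded (\<phi> ` ?K)"
    by (intro compact_imp_bounded compact_continuous_image test_function_continuous[OF assms])
  then obtain B where B: "B > 0" "\<And>x. x \<in> ?K \<Longrightarrow> \<bar>\<phi> x\<bar> \<le> B"
    by (auto simp: bounded_pos)
  have "\<bar>\<phi> x\<bar> \<le> B" for x
    using B closure_subset[of "{x. \<phi> x \<noteq> 0}"] by (cases "\<phi> x = 0") auto
  with B(1) that show ?thesis by blast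
qed

subsection \<open>Square integrable functions\<close>

lemma L2_measurable: "f \<in> L2 S \<Longrightarrow> f \<in> borel_measurable (lebesgue_on S)"
  by (simp add: L2_def)

lemma L2_integrable_square: "f \<in> L2 S \<Longrightarrow> integrable (lebesgue_on S) (\<lambda>x. (norm (f x))\<^sup>2)"
  by (simp add: L2_def)

lemma L2_mult_norm_integrable:
  assumes "f \<in> L2 S" "g \<in> L2 S"
  shows "integrable (lebesgue_on S) (\<lambda>x. norm (f x) * norm (g x))"
proof (rule Bochner_Integration.integrable_bound)
  show "integrable (lebesgue_on S) (\<lambda>x. (norm (f x))\<^sup>2 + (norm (g x))\<^sup>2)"
    using assms by (intro Bochner_Integration.integrable_add L2_integrable_square)
  have "norm (norm (f x) * norm (g x)) \<le> norm ((norm (f x))\<^sup>2 + (norm (g x))\<^sup>2)" for x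
  proof -
    have "0 \<le> norm (f x) * norm (g x)" by simp
    then have "norm (f x) * norm (g x) \<le> (norm (f x))\<^sup>2 + (norm (g x))\<^sup>2"
      using sum_squares_bound[of "norm (f x)" "norm (g x)"] by linarith
    then show ?thesis by simp
  qed
  then show "AE x in lebesgue_on S. norm (norm (f x) * norm (g x)) \<le> norm ((norm (f x))\<^sup>2 + (norm (g x))\<^sup>2)"
    by simp
qed (use assms in \<open>auto simp: L2_def intro!: borel_measurable_times borel_measurable_norm\<close>)

lemma L2_inner_integrable:
  assumes "f \<in> L2 S" "g \<in> L2 S"
  shows "integrable (lebesgue_on S) (\<lambda>x. f x \<bullet> g x)"
proof (rule Bochner_Integration.integrable_bound[OF L2_mult_norm_integrable[OF assms]])
  show "AE x in lebesgue_on S. norm (f x \<bullet> g x) \<le> norm (norm (f x) * norm (g x))"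
    by (intro AE_I2) (simp add: Cauchy_Schwarz_ineq2)
qed (intro borel_measurable_inner L2_measurable assms)

lemma L2_mult_integrable:
  fixes f g :: "'a::euclidean_space \<Rightarrow> real"
  assumes "f \<in> L2 S" "g \<in> L2 S"
  shows "integrable (lebesgue_on S) (\<lambda>x. f x * g x)"
  using L2_inner_integrable[OF assms] by simp

lemma L2_bound:
  assumes "f \<in> borel_measurable (lebesgue_on S)" "g \<in> L2 S"
    and "AE x in lebesgue_on S. norm (f x) \<le> c * norm (g x)"
  shows "f \<in> L2 S"
proof -
  have "integrable (lebesgue_on S) (\<lambda>x. (norm (f x))\<^sup>2)"
  proof (rule Bochner_Integration.integrable_bound)
    show "integrable (lebesgue_on S) (\<lambda>x. c\<^sup>2 * (norm (g x))\<^sup>2)"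
      using L2_integrable_square[OF assms(2)] by (rule integrable_mult_right)
    show "AE x in lebesgue_on S. norm ((norm (f x))\<^sup>2) \<le> norm (c\<^sup>2 * (norm (g x))\<^sup>2)"
      using assms(3) by eventually_elim (auto simp: power_mult_distrib[symmetric] intro: power_mono)
  qed (use assms(1) in auto)
  with assms(1) show ?thesis by (simp add: L2_def)
qed

lemma L2_add:
  assumes "f \<in> L2 S" "g \<in> L2 S"
  shows "(\<lambda>x. f x + g x) \<in> L2 S"
proof -
  have "integrable (lebesgue_on S) (\<lambda>x. (norm (f x))\<^sup>2 + 2 * (f x \<bullet> g x) + (norm (g x))\<^sup>2)"
    using assms by (intro Bochner_Integration.integrable_add integrable_mult_right L2_integrable_square L2_inner_integrable)
  moreover have "(norm (f x + g x))\<^sup>2 = (norm (f x))\<^sup>2 + 2 * (f x \<bullet> g x) + (norm (g x))\<^sup>2" for x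
    by (simp add: power2_norm_eq_inner inner_simps inner_commute)
  ultimately show ?thesis
    using assms by (auto simp: L2_def)
qed

lemma L2_scaleR:
  assumes "f \<in> L2 S"
  shows "(\<lambda>x. c *\<^sub>R f x) \<in> L2 S"
  by (rule L2_bound[OF _ assms, of _ "\<bar>c\<bar>"])
     (intro borel_measurable_scaleR borel_measurable_const L2_measurable[OF assms], simp)

lemma L2_cmult: "f \<in> L2 S \<Longrightarrow> (\<lambda>x. c * f x) \<in> L2 S" for f :: "'a::euclidean_space \<Rightarrow> real"
  using L2_scaleR[of f S c] by simp

lemma L2_minus: "f \<in> L2 S \<Longrightarrow> (\<lambda>x. - f x) \<in> L2 S"
  using L2_scaleR[of f S "-1"] by simp

lemma L2_diff: "f \<in> L2 S \<Longrightarrow> g \<in> L2 S \<Longrightarrow> (\<lambda>x. f x - g x) \<in> L2 S"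
  using L2_add[of f S "\<lambda>x. - g x"] L2_minus[of g S] by simp

lemma L2_fun_diff: "f \<in> L2 S \<Longrightarrow> g \<in> L2 S \<Longrightarrow> f - g \<in> L2 S"
  using L2_diff[of f S g] by (simp add: fun_diff_def)

lemma L2_zero: "(\<lambda>x. 0) \<in> L2 S"
  by (simp add: L2_def)

lemma L2_norm_fn: "f \<in> L2 S \<Longrightarrow> (\<lambda>x. norm (f x)) \<in> L2 S"
  by (auto simp: L2_def intro: borel_measurable_norm)

lemma L2_inner_Basis: "f \<in> L2 S \<Longrightarrow> e \<in> Basis \<Longrightarrow> (\<lambda>x. f x \<bullet> e) \<in> L2 S"
  by (rule L2_bound[of _ _ f 1])
     (auto simp: L2_measurable Basis_le_norm intro!: borel_measurable_inner borel_measurable_const)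

lemma L2_cong_AE:
  assumes "f \<in> L2 S" "g \<in> borel_measurable (lebesgue_on S)" "AE x in lebesgue_on S. f x = g x"
  shows "g \<in> L2 S"
  using assms by (intro L2_bound[of g S f 1]) auto

lemma L2_norm_nonneg: "L2_norm S f \<ge> 0"
  by (simp add: L2_norm_def)

lemma L2_norm_sq: "(L2_norm S f)\<^sup>2 = (\<integral>x. (norm (f x))\<^sup>2 \<partial>lebesgue_on S)"
  by (simp add: L2_norm_def)

lemma L2_norm_cong_AE:
  assumes "f \<in> borel_measurable (lebesgue_on S)" "g \<in> borel_measurable (lebesgue_on S)"
    and "AE x in lebesgue_on S. f x = g x"
  shows "L2_norm S f = L2_norm S g"
  unfolding L2_norm_def
  using assms by (intro arg_cong[of _ _ sqrt] Bochner_Integration.integral_cong_AE) auto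

lemma L2_norm_mono:
  assumes "f \<in> borel_measurable (lebesgue_on S)" "g \<in> L2 S"
    and "AE x in lebesgue_on S. norm (f x) \<le> norm (g x)"
  shows "L2_norm S f \<le> L2_norm S g"
proof -
  have "f \<in> L2 S" using assms by (intro L2_bound[of f S g 1]) auto
  then show ?thesis
    unfolding L2_norm_def using assms(2,3)
    by (intro real_sqrt_le_mono integral_mono_AE L2_integrable_square) (auto elim!: eventually_mono intro: power_mono)
qed

text \<open>The quadratic is evaluated at its minimizer c/b. For b = 0 it is affine in t, and
  nonnegativity on the whole line forces c = 0.\<close>

lemma discriminant_le:
  assumes "\<And>t::real. a - 2 * t * c + t\<^sup>2 * b \<ge> 0" "b \<ge> 0"
  shows "c\<^sup>2 \<le> a * b"
proof (cases "b = 0")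
  case True
  have "c = 0"
  proof (rule ccontr)
    assume "c \<noteq> 0"
    \<comment> \<open>At this argument the affine function equals -1.\<close>
    then show False using assms(1)[of "(a + 1) / (2 * c)"] True by simp
  qed
  then show ?thesis using True by simp
next
  case False
  with assms(2) have "b > 0" by simp
  have "a - 2 * (c / b) * c + (c / b)\<^sup>2 * b = a - c\<^sup>2 / b"
    using \<open>b > 0\<close> by (simp add: power2_eq_square field_simps)
  then have "c\<^sup>2 / b \<le> a" using assms(1)[of "c / b"] by simp
  then show ?thesis using \<open>b > 0\<close> by (simp add: field_simps)
qed

lemma L2_Cauchy_Schwarz:
  assumes "f \<in> L2 S" "g \<in> L2 S"
  shows "\<bar>\<integral>x. f x \<bullet> g x \<partial>lebesgue_on S\<bar> \<le> L2_norm S f * L2_norm S g"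
proof -
  have "(\<integral>x. f x \<bullet> g x \<partial>lebesgue_on S)\<^sup>2 \<le> (L2_norm S f)\<^sup>2 * (L2_norm S g)\<^sup>2"
  proof (rule discriminant_le)
    fix t :: real
    have "0 \<le> (\<integral>x. (norm (f x - t *\<^sub>R g x))\<^sup>2 \<partial>lebesgue_on S)" by simp
    also have "\<dots> = (\<integral>x. ((norm (f x))\<^sup>2 - 2 * t * (f x \<bullet> g x)) + t\<^sup>2 * (norm (g x))\<^sup>2 \<partial>lebesgue_on S)"
      by (intro Bochner_Integration.integral_cong refl, unfold power2_norm_eq_inner)
         (simp add: inner_simps inner_commute power2_eq_square algebra_simps)
    also have "\<dots> = (L2_norm S f)\<^sup>2 - 2 * t * (\<integral>x. f x \<bullet> g x \<partial>lebesgue_on S) + t\<^sup>2 * (L2_norm S g)\<^sup>2"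
      using assms by (simp add: L2_norm_sq L2_integrable_square L2_inner_integrable)
    finally show "0 \<le> (L2_norm S f)\<^sup>2 - 2 * t * (\<integral>x. f x \<bullet> g x \<partial>lebesgue_on S) + t\<^sup>2 * (L2_norm S g)\<^sup>2" .
  qed simp
  then have "\<bar>\<integral>x. f x \<bullet> g x \<partial>lebesgue_on S\<bar>\<^sup>2 \<le> (L2_norm S f * L2_norm S g)\<^sup>2"
    by (simp add: power_mult_distrib)
  then show ?thesis
    by (rule power2_le_imp_le) (simp add: L2_norm_nonneg)
qed

lemma L2_inner_Cauchy_Schwarz:
  assumes "f \<in> L2 S" "g \<in> L2 S"
  shows "\<bar>L2_inner S f g\<bar> \<le> L2_norm S f * L2_norm S g"
  using L2_Cauchy_Schwarz[OF assms] by (simp add: L2_inner_def)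

lemma L2_norm_sq_eq_inner: "(L2_norm S f)\<^sup>2 = L2_inner S f f"
  unfolding L2_norm_sq L2_inner_def by (simp add: power2_eq_square)

lemma L2_norm_triangle:
  assumes "f \<in> L2 S" "g \<in> L2 S"
  shows "L2_norm S (\<lambda>x. f x + g x) \<le> L2_norm S f + L2_norm S g"
proof (rule power2_le_imp_le)
  have "(L2_norm S (\<lambda>x. f x + g x))\<^sup>2 = (\<integral>x. (norm (f x))\<^sup>2 + 2 * (f x \<bullet> g x) + (norm (g x))\<^sup>2 \<partial>lebesgue_on S)"
    unfolding L2_norm_sq
    by (intro Bochner_Integration.integral_cong refl, unfold power2_norm_eq_inner) (simp add: inner_simps inner_commute)
  also have "\<dots> = (L2_norm S f)\<^sup>2 + 2 * (\<integral>x. f x \<bullet> g x \<partial>lebesgue_on S) + (L2_norm S g)\<^sup>2"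
    using assms by (simp add: L2_norm_sq L2_integrable_square L2_inner_integrable)
  also have "\<dots> \<le> (L2_norm S f + L2_norm S g)\<^sup>2"
    using L2_Cauchy_Schwarz[OF assms] by (simp add: power2_sum)
  finally show "(L2_norm S (\<lambda>x. f x + g x))\<^sup>2 \<le> (L2_norm S f + L2_norm S g)\<^sup>2" .
qed (simp add: L2_norm_nonneg)

lemma L2_norm_scaleR: "L2_norm S (\<lambda>x. c *\<^sub>R f x) = \<bar>c\<bar> * L2_norm S f"
  by (simp add: L2_norm_def power_mult_distrib real_sqrt_mult)

lemma L2_norm_minus: "L2_norm S (\<lambda>x. - f x) = L2_norm S f"
  by (simp add: L2_norm_def)

lemma L2_norm_triangle_diff:
  assumes "f \<in> L2 S" "g \<in> L2 S"
  shows "L2_norm S (\<lambda>x. f x - g x) \<le> L2_norm S f + L2_norm S g"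
  using L2_norm_triangle[OF assms(1) L2_minus[OF assms(2)]] by (simp add: L2_norm_minus)

lemma L2_norm_eq_0:
  assumes "f \<in> L2 S" "L2_norm S f = 0"
  shows "AE x in lebesgue_on S. f x = 0"
proof -
  have "(\<integral>x. (norm (f x))\<^sup>2 \<partial>lebesgue_on S) = 0" using assms(2) by (simp add: L2_norm_def)
  then show ?thesis
    using integral_nonneg_eq_0_iff_AE[OF L2_integrable_square[OF assms(1)]] by simp
qed

lemma L2_tendsto:
  assumes s: "\<And>i. s i \<in> borel_measurable (lebesgue_on S)" and f: "f \<in> L2 S" and w: "w \<in> L2 S"
    and lim: "AE x in lebesgue_on S. (\<lambda>i. s i x) \<longlonglongrightarrow> f x"
    and bnd: "\<And>i. AE x in lebesgue_on S. norm (s i x) \<le> w x"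
  shows "(\<lambda>i. L2_norm S (\<lambda>x. f x - s i x)) \<longlonglongrightarrow> 0"
proof -
  have "(\<lambda>i. \<integral>x. (norm (f x - s i x))\<^sup>2 \<partial>lebesgue_on S) \<longlonglongrightarrow> (\<integral>x. 0 \<partial>lebesgue_on S)"
  proof (rule integral_dominated_convergence)
    show "integrable (lebesgue_on S) (\<lambda>x. (norm (norm (f x) + w x))\<^sup>2)"
      by (intro L2_integrable_square L2_add L2_norm_fn f w)
    show "AE x in lebesgue_on S. (\<lambda>i. (norm (f x - s i x))\<^sup>2) \<longlonglongrightarrow> 0"
      using lim
    proof eventually_elim
      case (elim x)
      have "(\<lambda>i. (norm (f x - s i x))\<^sup>2) \<longlonglongrightarrow> (norm (f x - f x))\<^sup>2"
        by (intro tendsto_intros elim)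
      then show ?case by simp
    qed
    show "AE x in lebesgue_on S. norm ((norm (f x - s i x))\<^sup>2) \<le> (norm (norm (f x) + w x))\<^sup>2" for i
      using bnd[of i]
    proof eventually_elim
      case (elim x)
      have "norm (f x - s i x) \<le> norm (norm (f x) + w x)"
        using norm_triangle_ineq4[of "f x" "s i x"] elim by auto
      then have "(norm (f x - s i x))\<^sup>2 \<le> (norm (norm (f x) + w x))\<^sup>2"
        by (rule power_mono) simp
      then show ?case by simp
    qed
  qed (use s L2_measurable[OF f] in auto)
  then have "(\<lambda>i. sqrt (\<integral>x. (norm (f x - s i x))\<^sup>2 \<partial>lebesgue_on S)) \<longlonglongrightarrow> sqrt 0"
    by (intro tendsto_real_sqrt) simp
  then show ?thesis by (simp add: L2_norm_def)
qed

subsection \<open>Density of test functions\<close>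

lemma finite_measure_lebesgue_on: "bounded S \<Longrightarrow> S \<in> sets lebesgue \<Longrightarrow> finite_measure (lebesgue_on S)"
  by (rule finite_measureI)
     (metis bounded_set_imp_lmeasurable emeasure_restrict_space fmeasurableD2 inf_top.right_neutral
       order_refl sets.top space_lebesgue_on infinity_ennreal_def space_restrict_space sets.Int_space_eq2)

lemma L2_bounded:
  assumes "bounded S" "S \<in> sets lebesgue" "f \<in> borel_measurable (lebesgue_on S)"
    and "AE x in lebesgue_on S. norm (f x) \<le> c"
  shows "f \<in> L2 S"
proof -
  interpret finite_measure "lebesgue_on S" by (rule finite_measure_lebesgue_on[OF assms(1,2)])
  have "(\<lambda>x. 1::real) \<in> L2 S" by (simp add: L2_def)
  then show ?thesis using assms by (intro L2_bound[of f S "\<lambda>x. 1::real" c]) auto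
qed

lemma test_function_measurable: "test_function \<Omega> \<phi> \<Longrightarrow> \<phi> \<in> borel_measurable (lebesgue_on S)"
  using borel_measurable_continuous_onI[OF test_function_continuous, of \<Omega> \<phi>]
  by (intro measurable_restrict_space1 measurable_completion) simp

lemma test_function_L2:
  assumes "bounded S" "S \<in> sets lebesgue" "test_function \<Omega> \<phi>"
  shows "\<phi> \<in> L2 S"
proof -
  obtain B where "\<And>x. \<bar>\<phi> x\<bar> \<le> B" using test_function_bounded[OF assms(3)] by blast
  then show ?thesis
    using assms by (intro L2_bounded[of S \<phi> B] test_function_measurable) auto
qed

text \<open>Stable under sums, multiples and dominated pointwise limits, so that density climbs from
  plateaus over open sets, measurable sets and simple functions to all of L2.\<close>

definition test_approximable :: "'a::euclidean_space set \<Rightarrow> ('a \<Rightarrow> real) \<Rightarrow> bool" where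
  "test_approximable \<Omega> f \<longleftrightarrow> f \<in> L2 \<Omega> \<and>
     (\<forall>e>0. \<exists>\<phi>. test_function \<Omega> \<phi> \<and> L2_norm \<Omega> (\<lambda>x. f x - \<phi> x) < e)"

context
  fixes \<Omega> :: "'a::euclidean_space set"
  assumes op: "open \<Omega>" and bd: "bounded \<Omega>"
begin

lemma domain_sets: "\<Omega> \<in> sets lebesgue"
  using op by (simp add: lebesgue_openin)

lemma test_approximable_test: "test_function \<Omega> \<phi> \<Longrightarrow> test_approximable \<Omega> \<phi>"
  using test_function_L2[OF bd domain_sets] by (auto simp: test_approximable_def L2_norm_def intro!: exI[of _ \<phi>])

lemma test_approximable_close:
  assumes "f \<in> L2 \<Omega>" "\<And>e. e > 0 \<Longrightarrow> \<exists>g. test_approximable \<Omega> g \<and> L2_norm \<Omega> (\<lambda>x. f x - g x) < e"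
  shows "test_approximable \<Omega> f"
  unfolding test_approximable_def
proof (intro conjI allI impI assms(1))
  fix e :: real assume "e > 0"
  then obtain g where g: "test_approximable \<Omega> g" "L2_norm \<Omega> (\<lambda>x. f x - g x) < e / 2"
    using assms(2)[of "e / 2"] by auto
  then obtain \<phi> where \<phi>: "test_function \<Omega> \<phi>" "L2_norm \<Omega> (\<lambda>x. g x - \<phi> x) < e / 2" "g \<in> L2 \<Omega>"
    using \<open>e > 0\<close> by (auto simp: test_approximable_def dest: spec[of _ "e / 2"])
  have "L2_norm \<Omega> (\<lambda>x. (f x - g x) + (g x - \<phi> x)) \<le> L2_norm \<Omega> (\<lambda>x. f x - g x) + L2_norm \<Omega> (\<lambda>x. g x - \<phi> x)"
    using assms(1) \<phi> test_function_L2[OF bd domain_sets] by (intro L2_norm_triangle L2_diff) auto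
  then show "\<exists>\<phi>. test_function \<Omega> \<phi> \<and> L2_norm \<Omega> (\<lambda>x. f x - \<phi> x) < e"
    using g \<phi> by (intro exI[of _ \<phi>]) auto
qed

lemma test_approximable_limit:
  assumes "\<And>i. test_approximable \<Omega> (s i)" "f \<in> L2 \<Omega>" "w \<in> L2 \<Omega>"
    and "\<And>x. x \<in> \<Omega> \<Longrightarrow> (\<lambda>i. s i x) \<longlonglongrightarrow> f x"
    and "\<And>i x. x \<in> \<Omega> \<Longrightarrow> \<bar>s i x\<bar> \<le> w x"
  shows "test_approximable \<Omega> f"
proof (rule test_approximable_close[OF assms(2)])
  fix e :: real assume "e > 0"
  have "(\<lambda>i. L2_norm \<Omega> (\<lambda>x. f x - s i x)) \<longlonglongrightarrow> 0"
    using assms by (intro L2_tendsto[of s \<Omega> f w] AE_I2) (auto simp: test_approximable_def L2_measurable)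
  then have "\<forall>\<^sub>F i in sequentially. L2_norm \<Omega> (\<lambda>x. f x - s i x) < e"
    using \<open>e > 0\<close> by (rule order_tendstoD)
  then obtain i where "L2_norm \<Omega> (\<lambda>x. f x - s i x) < e"
    by (auto simp: eventually_sequentially)
  then show "\<exists>g. test_approximable \<Omega> g \<and> L2_norm \<Omega> (\<lambda>x. f x - g x) < e"
    using assms(1) by auto
qed

lemma test_approximable_add:
  assumes "test_approximable \<Omega> f" "test_approximable \<Omega> g"
  shows "test_approximable \<Omega> (\<lambda>x. f x + g x)"
  unfolding test_approximable_def
proof (intro conjI allI impI L2_add)
  show "f \<in> L2 \<Omega>" "g \<in> L2 \<Omega>" using assms by (auto simp: test_approximable_def)
  fix e :: real assume "e > 0"
  then obtain \<phi> \<psi> where *: "test_function \<Omega> \<phi>" "L2_norm \<Omega> (\<lambda>x. f x - \<phi> x) < e / 2"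
      "test_function \<Omega> \<psi>" "L2_norm \<Omega> (\<lambda>x. g x - \<psi> x) < e / 2"
    using assms unfolding test_approximable_def by (meson half_gt_zero)
  have "L2_norm \<Omega> (\<lambda>x. (f x - \<phi> x) + (g x - \<psi> x)) \<le> L2_norm \<Omega> (\<lambda>x. f x - \<phi> x) + L2_norm \<Omega> (\<lambda>x. g x - \<psi> x)"
    using assms * test_function_L2[OF bd domain_sets]
    by (intro L2_norm_triangle L2_diff) (auto simp: test_approximable_def)
  then show "\<exists>\<phi>. test_function \<Omega> \<phi> \<and> L2_norm \<Omega> (\<lambda>x. f x + g x - \<phi> x) < e"
    using * by (intro exI[of _ "\<lambda>x. \<phi> x + \<psi> x"]) (auto intro: test_function_add simp: algebra_simps)
qed

lemma test_approximable_cmult: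
  assumes "test_approximable \<Omega> f"
  shows "test_approximable \<Omega> (\<lambda>x. c * f x)"
  unfolding test_approximable_def
proof (intro conjI allI impI L2_cmult)
  show "f \<in> L2 \<Omega>" using assms by (auto simp: test_approximable_def)
  fix e :: real assume "e > 0"
  then have "e / (\<bar>c\<bar> + 1) > 0" by simp
  then obtain \<phi> where *: "test_function \<Omega> \<phi>" "L2_norm \<Omega> (\<lambda>x. f x - \<phi> x) < e / (\<bar>c\<bar> + 1)"
    using assms unfolding test_approximable_def by meson
  have "L2_norm \<Omega> (\<lambda>x. c * f x - c * \<phi> x) = \<bar>c\<bar> * L2_norm \<Omega> (\<lambda>x. f x - \<phi> x)"
    using L2_norm_scaleR[of \<Omega> c "\<lambda>x. f x - \<phi> x"] by (simp add: right_diff_distrib)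
  also have "\<dots> \<le> (\<bar>c\<bar> + 1) * L2_norm \<Omega> (\<lambda>x. f x - \<phi> x)"
    by (intro mult_right_mono L2_norm_nonneg) auto
  also have "\<dots> < e" using *(2) by (simp add: field_simps)
  finally show "\<exists>\<phi>. test_function \<Omega> \<phi> \<and> L2_norm \<Omega> (\<lambda>x. c * f x - \<phi> x) < e"
    using * by (intro exI[of _ "\<lambda>x. c * \<phi> x"]) (auto intro: test_function_cmult)
qed

lemma test_approximable_sum:
  "finite I \<Longrightarrow> (\<And>i. i \<in> I \<Longrightarrow> test_approximable \<Omega> (f i)) \<Longrightarrow> test_approximable \<Omega> (\<lambda>x. \<Sum>i\<in>I. f i x)"
  by (induction I rule: finite_induct) (auto intro: test_approximable_add test_approximable_test test_function_zero)

lemma indicator_L2: "A \<in> sets lebesgue \<Longrightarrow> (indicator A :: 'a \<Rightarrow> real) \<in> L2 \<Omega>"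
  by (rule L2_bounded[OF bd domain_sets, of _ 1]) (auto simp: indicator_def intro!: measurable_restrict_space1)

text \<open>If \<open>U\<close> is the union of boxes \<open>B i\<close> then \<open>1 - (\<Prod>i<n. 1 - p i)\<close>, with plateaus \<open>p i\<close>
  supported in \<open>B i\<close>, are test functions converging to the indicator of \<open>U\<close>.\<close>

lemma test_approximable_open:
  assumes "open U" "U \<subseteq> \<Omega>"
  shows "test_approximable \<Omega> (indicator U)"
proof -
  obtain \<D> where \<D>: "countable \<D>" "\<D> \<subseteq> Pow U" "\<And>X. X \<in> \<D> \<Longrightarrow> \<exists>a b. X = box a b" "\<Union>\<D> = U"
    using open_countable_Union_open_box[OF assms(1)] by metis
  \<comment> \<open>The empty box makes the family nonempty, so \<open>from_nat_into\<close>
    enumerates it even if \<open>U\<close> is empty.\<close>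
  define \<D>' where "\<D>' = insert {} \<D>"
  have "{} = box (0::'a) 0" by simp
  then have \<D>': "countable \<D>'" "\<D>' \<noteq> {}" "\<Union>\<D>' = U" "\<And>X. X \<in> \<D>' \<Longrightarrow> \<exists>a b. X = box a b"
    unfolding \<D>'_def using \<D>(1,3,4) by (simp, simp, simp, blast)
  define B where "B = from_nat_into \<D>'"
  have B: "B i \<in> \<D>'" for i using from_nat_into[OF \<D>'(2)] by (simp add: B_def)
  have UB: "U = (\<Union>i. B i)" using range_from_nat_into[OF \<D>'(2,1)] \<D>'(3) by (simp add: B_def)
  obtain a b where ab: "\<And>i. B i = box (a i) (b i)" using \<D>'(4)[OF B] by metis
  define q where "q n m x = 1 - (\<Prod>i<m. 1 - box_plateau (Suc n) (a i) (b i) x)" for n m :: nat and x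
  have q: "test_function \<Omega> (q n m)" for n m
  proof (induction m)
    case 0 then show ?case using test_function_zero by (simp add: q_def[abs_def])
  next
    case (Suc m)
    let ?p = "box_plateau (Suc n) (a m) (b m)"
    have "B m \<subseteq> \<Omega>" using UB assms(2) by blast
    then have p: "test_function \<Omega> ?p" by (intro test_function_box_plateau) (auto simp: ab[symmetric])
    \<comment> \<open>One more box changes q into q + p (1 - q), again a combination of test
      functions.\<close>
    have "test_function \<Omega> (\<lambda>x. q n m x + (?p x - q n m x * ?p x))"
      by (intro test_function_add test_function_diff test_function_mult_left Suc p test_function_imp_C_k[OF Suc])
    also have "(\<lambda>x. q n m x + (?p x - q n m x * ?p x)) = q n (Suc m)"
      by (auto simp: q_def algebra_simps)
    finally show ?case .
  qed
  have pb: "0 \<le> 1 - box_plateau (Suc n) (a i) (b i) x" "1 - box_plateau (Suc n) (a i) (b i) x \<le> 1" for n i x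
    using box_plateau_bounds by auto
  show ?thesis
  proof (rule test_approximable_limit)
    \<comment> \<open>Diagonal choice: the sharpness of the plateaus and the number of boxes grow
      together.\<close>
    show "test_approximable \<Omega> (q n n)" for n by (rule test_approximable_test[OF q])
    show "(indicator U :: 'a \<Rightarrow> real) \<in> L2 \<Omega>" using assms(1) by (intro indicator_L2) (simp add: lebesgue_openin)
    show "(\<lambda>x. 1 :: real) \<in> L2 \<Omega>" by (rule L2_bounded[OF bd domain_sets, of _ 1]) auto
    show "\<bar>q n n x\<bar> \<le> 1" for n x
      using prod_nonneg[of "{..<n}" "\<lambda>i. 1 - box_plateau (Suc n) (a i) (b i) x"]
        prod_le_1[of "{..<n}" "\<lambda>i. 1 - box_plateau (Suc n) (a i) (b i) x"] pb by (auto simp: q_def)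
    show "(\<lambda>n. q n n x) \<longlonglongrightarrow> indicator U x" for x
    proof (cases "x \<in> U")
      case True
      then obtain i where i: "x \<in> B i" using UB by blast
      have "(\<lambda>n. 1 - box_plateau (Suc n) (a i) (b i) x) \<longlonglongrightarrow> 1 - indicator (box (a i) (b i)) x"
        by (intro tendsto_intros box_plateau_tendsto)
      then have l: "(\<lambda>n. 1 - box_plateau (Suc n) (a i) (b i) x) \<longlonglongrightarrow> 0" using i ab by simp
      \<comment> \<open>Once \<open>n\<close> exceeds \<open>i\<close>, the product is at most its
        factor for a box containing \<open>x\<close>, since all other factors lie between 0 and
        1.\<close>
      have "(\<lambda>n. (\<Prod>i<n. 1 - box_plateau (Suc n) (a i) (b i) x)) \<longlonglongrightarrow> 0"
      proof (rule tendsto_sandwich[OF _ _ tendsto_const l])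
        show "\<forall>\<^sub>F n in sequentially. 0 \<le> (\<Prod>i<n. 1 - box_plateau (Suc n) (a i) (b i) x)"
          using pb by (intro always_eventually allI prod_nonneg) auto
        show "\<forall>\<^sub>F n in sequentially. (\<Prod>i<n. 1 - box_plateau (Suc n) (a i) (b i) x) \<le> 1 - box_plateau (Suc n) (a i) (b i) x"
          using eventually_gt_at_top[of i]
        proof eventually_elim
          case (elim n)
          have "(\<Prod>j<n. 1 - box_plateau (Suc n) (a j) (b j) x) =
            (1 - box_plateau (Suc n) (a i) (b i) x) * (\<Prod>j\<in>{..<n}-{i}. 1 - box_plateau (Suc n) (a j) (b j) x)"
            using elim by (intro prod.remove) auto
          also have "\<dots> \<le> (1 - box_plateau (Suc n) (a i) (b i) x) * 1"
            using pb by (intro mult_left_mono prod_le_1) auto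
          finally show ?case by simp
        qed
      qed
      then have "(\<lambda>n. q n n x) \<longlonglongrightarrow> 1 - 0" unfolding q_def by (intro tendsto_intros)
      then show ?thesis using True by simp
    next
      case False
      have "box_plateau (Suc n) (a i) (b i) x = 0" for n i
      proof -
        have "x \<notin> box (a i) (b i)" using False UB ab by auto
        then show ?thesis
          using test_function_support[OF test_function_box_plateau[of "real (Suc n)" "a i" "b i" "box (a i) (b i)"]] by simp
      qed
      then show ?thesis using False by (simp add: q_def)
    qed
  qed
qed

text \<open>Outer regularity: for nested sets the squared L2 distance of the indicators is the
  measure of the gap, whence the tolerance \<open>e\<^sup>2\<close>. Intersecting the outer set with
  \<open>\<Omega>\<close> keeps it inside the domain and still around \<open>A\<close>.\<close>

lemma test_approximable_indicator:
  assumes A: "A \<in> sets lebesgue" "A \<subseteq> \<Omega>"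
  shows "test_approximable \<Omega> (indicator A)"
proof (rule test_approximable_close[OF indicator_L2[OF A(1)]])
  fix e :: real assume "e > 0"
  then obtain T where T: "open T" "A \<subseteq> T" "T - A \<in> lmeasurable" "emeasure lebesgue (T - A) < ennreal (e\<^sup>2)"
    using sets_lebesgue_outer_open[OF A(1), of "e\<^sup>2"] by auto
  let ?U = "T \<inter> \<Omega>"
  have U: "open ?U" "?U \<subseteq> \<Omega>" using T op by auto
  have "(L2_norm \<Omega> (\<lambda>x. indicator A x - indicator ?U x :: real))\<^sup>2 = (\<integral>x. indicator (T - A) x \<partial>lebesgue_on \<Omega>)"
    unfolding L2_norm_sq using T A by (intro Bochner_Integration.integral_cong) (auto simp: indicator_def)
  also have "\<dots> = measure (lebesgue_on \<Omega>) ((T - A) \<inter> \<Omega>)"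
    by (simp add: space_restrict_space)
  also have "\<dots> = measure lebesgue ((T - A) \<inter> \<Omega>)"
    using domain_sets by (intro measure_restrict_space) auto
  also have "\<dots> \<le> measure lebesgue (T - A)"
    using T(3) domain_sets by (intro measure_mono_fmeasurable) auto
  also have "\<dots> < e\<^sup>2"
    using T(4) emeasure_eq_measure2[OF T(3)] by (simp add: ennreal_less_iff)
  finally have "L2_norm \<Omega> (\<lambda>x. indicator A x - indicator ?U x :: real) < e"
    by (rule power2_less_imp_less) (use \<open>e > 0\<close> in simp)
  then show "\<exists>g. test_approximable \<Omega> g \<and> L2_norm \<Omega> (\<lambda>x. indicator A x - g x) < e"
    using test_approximable_open[OF U] by blast
qed

text \<open>The simple functions converging to \<open>f\<close> can be taken below
  \<open>2 * \<bar>f x\<bar>\<close>, which is the square integrable majorant.\<close>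

lemma test_functions_dense:
  assumes "f \<in> L2 \<Omega>"
  shows "test_approximable \<Omega> f"
proof -
  from borel_measurable_implies_sequence_metric[OF L2_measurable[OF assms], of 0]
  obtain s where s: "\<And>i. simple_function (lebesgue_on \<Omega>) (s i)"
      "\<And>x. x \<in> \<Omega> \<Longrightarrow> (\<lambda>i. s i x) \<longlonglongrightarrow> f x" "\<And>i x. x \<in> \<Omega> \<Longrightarrow> \<bar>s i x\<bar> \<le> 2 * \<bar>f x\<bar>"
    unfolding space_lebesgue_on by (simp add: dist_real_def) metis
  show ?thesis
  proof (rule test_approximable_limit[OF _ assms _ s(2,3)])
    fix i
    have fin: "finite (s i ` \<Omega>)" using simple_functionD(1)[OF s(1)] by simp
    have "test_approximable \<Omega> (\<lambda>x. \<Sum>y\<in>s i ` \<Omega>. y * indicator (s i -` {y} \<inter> \<Omega>) x)"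
    proof (intro test_approximable_sum fin test_approximable_cmult test_approximable_indicator)
      show "s i -` {y} \<inter> \<Omega> \<in> sets lebesgue" for y
        using simple_functionD(2)[OF s(1), of i "{y}"] domain_sets by (auto simp: sets_restrict_space_iff)
    qed auto
    \<comment> \<open>The finite sum reproduces \<open>s i\<close> only on \<open>\<Omega>\<close>,
      so the argument passes through a function \<open>g\<close> that agrees with it there.\<close>
    then have *: "\<exists>g. test_approximable \<Omega> g \<and> (\<forall>x\<in>\<Omega>. g x = s i x)"
    proof (intro exI conjI ballI)
      fix x assume "x \<in> \<Omega>"
      then have "(\<Sum>y\<in>s i ` \<Omega>. y * indicator (s i -` {y} \<inter> \<Omega>) x) = (\<Sum>y\<in>{s i x}. y * indicator (s i -` {y} \<inter> \<Omega>) x)"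
        using fin by (intro sum.mono_neutral_right) auto
      then show "(\<Sum>y\<in>s i ` \<Omega>. y * indicator (s i -` {y} \<inter> \<Omega>) x) = s i x"
        using \<open>x \<in> \<Omega>\<close> by simp
    qed
    then obtain g where g: "test_approximable \<Omega> g" "\<And>x. x \<in> \<Omega> \<Longrightarrow> g x = s i x" by blast
    show "test_approximable \<Omega> (s i)"
    proof (rule test_approximable_close)
      have "g \<in> L2 \<Omega>" using g(1) by (simp add: test_approximable_def)
      then show "s i \<in> L2 \<Omega>"
        by (rule L2_cong_AE) (use g s(1) in \<open>auto intro!: AE_I2 borel_measurable_simple_function\<close>)
      have "L2_norm \<Omega> (\<lambda>x. s i x - g x) = L2_norm \<Omega> (\<lambda>x. 0 :: real)"
        unfolding L2_norm_def by (intro arg_cong[of _ _ sqrt] Bochner_Integration.integral_cong) (auto simp: g)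
      then show "\<exists>g. test_approximable \<Omega> g \<and> L2_norm \<Omega> (\<lambda>x. s i x - g x) < e" if "e > 0" for e
        using that g(1) by (auto simp: L2_norm_def)
    qed
  next
    show "(\<lambda>x. 2 * \<bar>f x\<bar>) \<in> L2 \<Omega>"
      using L2_cmult[OF L2_norm_fn[OF assms]] by simp
  qed
qed

lemma test_function_approx:
  assumes "f \<in> L2 \<Omega>" "e > 0"
  obtains \<phi> where "test_function \<Omega> \<phi>" "L2_norm \<Omega> (\<lambda>x. f x - \<phi> x) < e"
  using test_functions_dense[OF assms(1)] assms(2) that by (auto simp: test_approximable_def)

text \<open>Orthogonality gives |f|^2 = (f, f - \<phi>) for test functions \<phi> arbitrarily close
  to f; by Cauchy-Schwarz |f| is below every positive number.\<close>

lemma L2_orthogonal_test_functions_imp_0: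
  assumes f: "f \<in> L2 \<Omega>" and 0: "\<And>\<phi>. test_function \<Omega> \<phi> \<Longrightarrow> L2_inner \<Omega> f \<phi> = 0"
  shows "AE x in lebesgue_on \<Omega>. f x = 0"
proof -
  have "L2_norm \<Omega> f \<le> e" if e: "e > 0" for e
  proof -
    obtain \<phi> where \<phi>: "test_function \<Omega> \<phi>" "L2_norm \<Omega> (\<lambda>x. f x - \<phi> x) < e"
      using test_function_approx[OF f e] by blast
    note \<phi>2 = test_function_L2[OF bd domain_sets \<phi>(1)]
    have "(L2_norm \<Omega> f)\<^sup>2 = L2_inner \<Omega> f f - L2_inner \<Omega> f \<phi>"
      by (simp add: 0[OF \<phi>(1)] L2_norm_sq_eq_inner)
    also have "\<dots> = L2_inner \<Omega> f (\<lambda>x. f x - \<phi> x)"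
      using f \<phi>2 by (simp add: L2_inner_def right_diff_distrib L2_mult_integrable)
    also have "\<dots> \<le> L2_norm \<Omega> f * L2_norm \<Omega> (\<lambda>x. f x - \<phi> x)"
      using L2_inner_Cauchy_Schwarz[OF f L2_diff[OF f \<phi>2]] by simp
    also have "\<dots> \<le> L2_norm \<Omega> f * e"
      using \<phi>(2) by (intro mult_left_mono L2_norm_nonneg) auto
    finally have "L2_norm \<Omega> f * L2_norm \<Omega> f \<le> L2_norm \<Omega> f * e" by (simp add: power2_eq_square)
    then show ?thesis
      using L2_norm_nonneg[of \<Omega> f] e by (cases "L2_norm \<Omega> f = 0") auto
  qed
  then have "L2_norm \<Omega> f = 0"
    using field_le_epsilon[of "L2_norm \<Omega> f" 0] L2_norm_nonneg[of \<Omega> f] by simp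
  then show ?thesis by (rule L2_norm_eq_0[OF f])
qed

end

section \<open>Sobolev spaces\<close>

abbreviation pderiv_fn :: "'a::euclidean_space \<Rightarrow> ('a \<Rightarrow> real) \<Rightarrow> 'a \<Rightarrow> real" where
  "pderiv_fn e f \<equiv> \<lambda>x. frechet_derivative f (at x) e"

lemma test_function_differentiable: "test_function \<Omega> \<phi> \<Longrightarrow> \<phi> differentiable (at x)"
  using test_function_imp_C_k[of \<Omega> \<phi> 1] by simp

text \<open>Off the closed support the function vanishes on a neighbourhood, so the derivative has
  its support in the same compact set.\<close>

lemma test_function_pderiv:
  assumes \<phi>: "test_function \<Omega> \<phi>" and e: "e \<in> Basis"
  shows "test_function \<Omega> (pderiv_fn e \<phi>)"
proof (rule test_function_support_subset)
  show "C_k k (pderiv_fn e \<phi>)" for k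
    using test_function_imp_C_k[OF \<phi>, of "Suc k"] e by simp
  have "{x. pderiv_fn e \<phi> x \<noteq> 0} \<subseteq> closure {x. \<phi> x \<noteq> 0}"
  proof
    fix x assume x: "x \<in> {x. pderiv_fn e \<phi> x \<noteq> 0}"
    show "x \<in> closure {x. \<phi> x \<noteq> 0}"
    proof (rule ccontr)
      assume n: "x \<notin> closure {x. \<phi> x \<noteq> 0}"
      have "((\<lambda>x. 0) has_derivative (\<lambda>h. 0)) (at x)" by simp
      then have "(\<phi> has_derivative (\<lambda>h. 0)) (at x)"
      proof (rule has_derivative_transform_within_open)
        show "open (- closure {x. \<phi> x \<noteq> 0})" by (rule open_Compl) (rule closed_closure)
        show "0 = \<phi> y" if "y \<in> - closure {x. \<phi> x \<noteq> 0}" for y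
          using that closure_subset[of "{x. \<phi> x \<noteq> 0}"] by auto
      qed (use n in auto)
      then have "pderiv_fn e \<phi> x = 0" by (simp add: frechet_derivative_at[symmetric])
      then show False using x by simp
    qed
  qed
  then show "closure {x. pderiv_fn e \<phi> x \<noteq> 0} \<subseteq> closure {x. \<phi> x \<noteq> 0}"
    by (rule closure_minimal) auto
qed (use \<phi> in \<open>auto simp: test_function_def\<close>)

lemma frechet_derivative_mult_real:
  fixes f g :: "'a::real_normed_vector \<Rightarrow> real"
  assumes "f differentiable (at x)" "g differentiable (at x)"
  shows "frechet_derivative (\<lambda>x. f x * g x) (at x) e
    = f x * frechet_derivative g (at x) e + frechet_derivative f (at x) e * g x"
  using assms by (subst frechet_derivative_at[symmetric, OF has_derivative_mult])
      (auto simp: frechet_derivative_works[symmetric])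

text \<open>By translation invariance the integral of every difference quotient vanishes.\<close>

lemma integral_pderiv_eq_0:
  assumes f: "test_function UNIV f" and e: "e \<in> Basis"
  shows "(\<integral>x. pderiv_fn e f x \<partial>lborel) = 0"
proof -
  have fc: "continuous_on A f" for A by (rule test_function_continuous[OF f])
  have [measurable]: "f \<in> borel_measurable borel"
    using fc by (rule borel_measurable_continuous_onI)
  have [measurable]: "pderiv_fn e f \<in> borel_measurable borel"
    by (intro borel_measurable_continuous_onI test_function_continuous[OF test_function_pderiv[OF f e]])
  obtain B where B: "B > 0" "\<And>x. \<bar>pderiv_fn e f x\<bar> \<le> B"
    using test_function_bounded[OF test_function_pderiv[OF f e]] by blast
  have "bounded {x. f x \<noteq> 0}"
    using bounded_subset[OF compact_imp_bounded closure_subset] f unfolding test_function_def by blast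
  then obtain R where R: "\<And>x. f x \<noteq> 0 \<Longrightarrow> norm x \<le> R" by (auto simp: bounded_iff)
  have fi: "integrable lborel f"
  proof -
    obtain C where C: "\<And>x. \<bar>f x\<bar> \<le> C" using test_function_bounded[OF f] by blast
    have "integrable lborel (\<lambda>x. C * indicator (cball 0 R) x :: real)"
      by (intro integrable_mult_right integrable_real_indicator) (use emeasure_bounded_finite[of "cball 0 _"] in auto)
    then show ?thesis
    proof (rule Bochner_Integration.integrable_bound)
      show "AE x in lborel. norm (f x) \<le> norm (C * indicator (cball 0 R) x :: real)"
      proof (rule AE_I2)
        fix x show "norm (f x) \<le> norm (C * indicator (cball 0 R) x :: real)"
          using C[of x] R[of x] by (cases "f x = 0") auto
      qed
    qed simp
  qed
  have der: "(f has_derivative (\<lambda>h. frechet_derivative f (at x) h)) (at x)" for x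
    using test_function_differentiable[OF f] by (simp add: frechet_derivative_works[symmetric])
  have lin: "frechet_derivative f (at x) (t *\<^sub>R e) = t * pderiv_fn e f x" for x t
    using linear_cmul[OF linear_frechet_derivative[OF test_function_differentiable[OF f]]] by simp
  have dt: "((\<lambda>t. f (x + t *\<^sub>R e)) has_real_derivative pderiv_fn e f (x + t *\<^sub>R e)) (at t)" for x t
    unfolding has_field_derivative_def
    by (rule has_derivative_eq_rhs, rule has_derivative_compose[OF _ der, of "\<lambda>t. x + t *\<^sub>R e" "\<lambda>t. t *\<^sub>R e"])
       (auto intro!: derivative_eq_intros simp: lin)
  define h where "h n = 1 / real (Suc n)" for n
  have h: "h n > 0" "h n \<le> 1" for n by (auto simp: h_def)
  define q where "q n x = (f (x + h n *\<^sub>R e) - f x) / h n" for n x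
  have shift: "integrable lborel (\<lambda>x. f (x + c))" "(\<integral>x. f (x + c) \<partial>lborel) = (\<integral>x. f x \<partial>lborel)" for c
  proof -
    have "integrable (distr lborel borel ((+) c)) f" using fi by (simp add: lborel_distr_plus)
    then show "integrable lborel (\<lambda>x. f (x + c))"
      by (subst (asm) integrable_distr_eq) (auto simp: add.commute)
    have "(\<integral>x. f x \<partial>lborel) = (\<integral>x. f x \<partial>distr lborel borel ((+) c))" by (simp add: lborel_distr_plus)
    also have "\<dots> = (\<integral>x. f (c + x) \<partial>lborel)" by (intro integral_distr) auto
    finally show "(\<integral>x. f (x + c) \<partial>lborel) = (\<integral>x. f x \<partial>lborel)" by (simp add: add.commute)
  qed
  have q0: "(\<integral>x. q n x \<partial>lborel) = 0" for n
    using shift fi by (simp add: q_def)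
  have "(\<lambda>n. \<integral>x. q n x \<partial>lborel) \<longlonglongrightarrow> (\<integral>x. pderiv_fn e f x \<partial>lborel)"
  proof (rule integral_dominated_convergence)
    \<comment> \<open>The steps \<open>h n\<close> are at most 1, so all quotients live in the ball
      of radius \<open>R + 1\<close>, and the mean value theorem bounds them by
      \<open>B\<close>.\<close>
    show "integrable lborel (\<lambda>x. B * indicator (cball 0 (R + 1)) x :: real)"
      by (intro integrable_mult_right integrable_real_indicator) (use emeasure_bounded_finite[of "cball 0 _"] in auto)
    show "AE x in lborel. (\<lambda>n. q n x) \<longlonglongrightarrow> pderiv_fn e f x"
    proof (rule AE_I2)
      fix x
      have "((\<lambda>t. (f (x + t *\<^sub>R e) - f x) / t) \<longlongrightarrow> pderiv_fn e f x) (at 0)"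
        using dt[of x 0] by (simp add: has_field_derivative_iff)
      moreover have "filterlim h (at 0) sequentially"
        using h unfolding filterlim_at h_def
        by (auto simp: LIMSEQ_Suc[OF lim_const_over_n] simp del: of_nat_Suc intro!: always_eventually)
      ultimately show "(\<lambda>n. q n x) \<longlonglongrightarrow> pderiv_fn e f x"
        unfolding q_def by (rule filterlim_compose)
    qed
    show "AE x in lborel. norm (q n x) \<le> B * indicator (cball 0 (R + 1)) x" for n
    proof (rule AE_I2)
      fix x
      have "\<bar>f (x + h n *\<^sub>R e) - f x\<bar> \<le> B * h n"
      proof -
        obtain z where "f (x + h n *\<^sub>R e) - f (x + 0 *\<^sub>R e) = (h n - 0) * pderiv_fn e f (x + z *\<^sub>R e)"
          using MVT2[of 0 "h n" "\<lambda>t. f (x + t *\<^sub>R e)" "\<lambda>t. pderiv_fn e f (x + t *\<^sub>R e)"] h[of n] dt by blast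
        then show ?thesis using B(2)[of "x + z *\<^sub>R e"] h[of n] by (simp add: abs_mult mult.commute)
      qed
      then have 1: "\<bar>q n x\<bar> \<le> B" using h[of n] by (simp add: q_def field_simps)
      show "norm (q n x) \<le> B * indicator (cball 0 (R + 1)) x"
      proof (cases "norm x \<le> R + 1")
        case True
        then show ?thesis using 1 by simp
      next
        case False
        have "norm x \<le> norm (x + h n *\<^sub>R e) + norm (h n *\<^sub>R e)"
          using norm_triangle_ineq4[of "x + h n *\<^sub>R e" "h n *\<^sub>R e"] by simp
        then have "norm (x + h n *\<^sub>R e) > R" using False h[of n] e by simp
        then have "f (x + h n *\<^sub>R e) = 0" "f x = 0" using R False by force+
        then show ?thesis using False by (simp add: q_def)
      qed
    qed
  qed (auto simp: q_def)
  then show ?thesis using q0 LIMSEQ_unique by (simp add: LIMSEQ_const_iff)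
qed

lemma H1_L2: "u \<in> H1 S \<Longrightarrow> u \<in> L2 S"
  by (simp add: H1_def)

lemma H1_grad:
  assumes "u \<in> H1 S"
  shows "grad S u \<in> L2 S" "weak_gradient S u (grad S u)"
proof -
  have "\<exists>G. G \<in> L2 S \<and> weak_gradient S u G" using assms by (auto simp: H1_def)
  then have "grad S u \<in> L2 S \<and> weak_gradient S u (grad S u)"
    unfolding grad_def by (rule someI_ex)
  then show "grad S u \<in> L2 S" "weak_gradient S u (grad S u)" by auto
qed

lemma H10_H1: "u \<in> H10 S \<Longrightarrow> u \<in> H1 S"
  by (simp add: H10_def)

lemma H1_norm_nonneg: "H1_norm S u \<ge> 0"
  by (simp add: H1_norm_def)

lemma H1_norm_ge:
  "L2_norm S u \<le> H1_norm S u" "L2_norm S (grad S u) \<le> H1_norm S u"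
  by (auto simp: H1_norm_def L2_norm_nonneg intro: real_le_rsqrt)

context
  fixes \<Omega> :: "'a::euclidean_space set"
  assumes op: "open \<Omega>" and bd: "bounded \<Omega>"
begin

lemma integral_test_pderiv:
  assumes f: "test_function \<Omega> f" and e: "e \<in> Basis"
  shows "(\<integral>x. pderiv_fn e f x \<partial>lebesgue_on \<Omega>) = 0"
proof -
  have f': "test_function UNIV f" using f by (auto simp: test_function_def)
  have [measurable]: "pderiv_fn e f \<in> borel_measurable borel"
    by (intro borel_measurable_continuous_onI test_function_continuous[OF test_function_pderiv[OF f e]])
  have "(\<integral>x. pderiv_fn e f x \<partial>lebesgue_on \<Omega>) = (\<integral>x. indicator \<Omega> x *\<^sub>R pderiv_fn e f x \<partial>lebesgue)"
    using domain_sets[OF op bd] by (intro integral_restrict_space) simp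
  also have "\<dots> = (\<integral>x. pderiv_fn e f x \<partial>lebesgue)"
    using test_function_support[OF test_function_pderiv[OF f e]]
    by (intro Bochner_Integration.integral_cong) (auto simp: indicator_def)
  also have "\<dots> = (\<integral>x. pderiv_fn e f x \<partial>lborel)" by (rule integral_completion) simp
  finally show ?thesis using integral_pderiv_eq_0[OF f' e] by simp
qed

lemma test_function_mem_L2: "test_function \<Omega> \<phi> \<Longrightarrow> \<phi> \<in> L2 \<Omega>"
  by (rule test_function_L2[OF bd domain_sets[OF op bd]])

lemma integration_by_parts:
  assumes f: "test_function \<Omega> f" and g: "test_function \<Omega> g" and e: "e \<in> Basis"
  shows "(\<integral>x. f x * pderiv_fn e g x \<partial>lebesgue_on \<Omega>) = - (\<integral>x. pderiv_fn e f x * g x \<partial>lebesgue_on \<Omega>)"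
proof -
  have "0 = (\<integral>x. pderiv_fn e (\<lambda>x. f x * g x) x \<partial>lebesgue_on \<Omega>)"
    using integral_test_pderiv[OF test_function_mult_left[OF test_function_imp_C_k[OF f] g] e] by simp
  also have "\<dots> = (\<integral>x. f x * pderiv_fn e g x + pderiv_fn e f x * g x \<partial>lebesgue_on \<Omega>)"
    by (intro Bochner_Integration.integral_cong refl frechet_derivative_mult_real
        test_function_differentiable[OF f] test_function_differentiable[OF g])
  also have "\<dots> = (\<integral>x. f x * pderiv_fn e g x \<partial>lebesgue_on \<Omega>) + (\<integral>x. pderiv_fn e f x * g x \<partial>lebesgue_on \<Omega>)"
    using f g e by (intro Bochner_Integration.integral_add L2_mult_integrable test_function_mem_L2 test_function_pderiv)
  finally show ?thesis by linarith
qed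

text \<open>This makes the choice in \<open>grad\<close> harmless: any weak gradient that can be
  computed agrees with it almost everywhere. Each component of the difference is orthogonal to all
  test functions.\<close>

lemma weak_gradient_unique:
  assumes "G \<in> L2 \<Omega>" "H \<in> L2 \<Omega>" "weak_gradient \<Omega> u G" "weak_gradient \<Omega> u H"
  shows "AE x in lebesgue_on \<Omega>. G x = H x"
proof -
  have "AE x in lebesgue_on \<Omega>. (G x - H x) \<bullet> e = 0" if e: "e \<in> Basis" for e
  proof (rule L2_orthogonal_test_functions_imp_0[OF op bd])
    show "(\<lambda>x. (G x - H x) \<bullet> e) \<in> L2 \<Omega>" by (intro L2_inner_Basis L2_diff assms e)
    fix \<phi> assume \<phi>: "test_function \<Omega> \<phi>"
    have "L2_inner \<Omega> (\<lambda>x. (G x - H x) \<bullet> e) \<phi> = (\<integral>x. (G x \<bullet> e) * \<phi> x - (H x \<bullet> e) * \<phi> x \<partial>lebesgue_on \<Omega>)"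
      by (simp add: L2_inner_def inner_diff_left left_diff_distrib)
    also have "\<dots> = (\<integral>x. (G x \<bullet> e) * \<phi> x \<partial>lebesgue_on \<Omega>) - (\<integral>x. (H x \<bullet> e) * \<phi> x \<partial>lebesgue_on \<Omega>)"
      by (intro Bochner_Integration.integral_diff L2_mult_integrable L2_inner_Basis assms e test_function_mem_L2 \<phi>)
    also have "\<dots> = 0"
    proof -
      show ?thesis
        using assms(3)[unfolded weak_gradient_def, rule_format, OF \<phi> e]
          assms(4)[unfolded weak_gradient_def, rule_format, OF \<phi> e] by simp
    qed
    finally show "L2_inner \<Omega> (\<lambda>x. (G x - H x) \<bullet> e) \<phi> = 0" .
  qed
  then have "AE x in lebesgue_on \<Omega>. \<forall>e\<in>Basis. (G x - H x) \<bullet> e = 0"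
    by (intro AE_finite_allI finite_Basis)
  then show ?thesis
    by eventually_elim (metis euclidean_all_zero_iff eq_iff_diff_eq_0)
qed

lemma weak_gradient_lin:
  assumes "G \<in> L2 \<Omega>" "H \<in> L2 \<Omega>" "weak_gradient \<Omega> u G" "weak_gradient \<Omega> w H" "u \<in> L2 \<Omega>" "w \<in> L2 \<Omega>"
  shows "weak_gradient \<Omega> (\<lambda>x. a * u x + b * w x) (\<lambda>x. a *\<^sub>R G x + b *\<^sub>R H x)"
  unfolding weak_gradient_def
proof (intro allI impI ballI)
  fix \<phi> :: "'a \<Rightarrow> real" and e :: 'a assume \<phi>: "test_function \<Omega> \<phi>" and e: "e \<in> Basis"
  have i: "integrable (lebesgue_on \<Omega>) (\<lambda>x. f x * pderiv_fn e \<phi> x)" "integrable (lebesgue_on \<Omega>) (\<lambda>x. (F x \<bullet> e) * \<phi> x)"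
    if "f \<in> L2 \<Omega>" "F \<in> L2 \<Omega>" for f F
    using L2_mult_integrable[OF that(1) test_function_mem_L2[OF test_function_pderiv[OF \<phi> e]]]
      L2_mult_integrable[OF L2_inner_Basis[OF that(2) e] test_function_mem_L2[OF \<phi>]] by auto
  have "(\<integral>x. (a * u x + b * w x) * pderiv_fn e \<phi> x \<partial>lebesgue_on \<Omega>)
      = (\<integral>x. a * (u x * pderiv_fn e \<phi> x) + b * (w x * pderiv_fn e \<phi> x) \<partial>lebesgue_on \<Omega>)"
    by (simp add: algebra_simps)
  also have "\<dots> = a * (\<integral>x. u x * pderiv_fn e \<phi> x \<partial>lebesgue_on \<Omega>) + b * (\<integral>x. w x * pderiv_fn e \<phi> x \<partial>lebesgue_on \<Omega>)"
    using i(1)[OF assms(5,1)] i(1)[OF assms(6,1)] by simp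
  also have "\<dots> = a * - (\<integral>x. (G x \<bullet> e) * \<phi> x \<partial>lebesgue_on \<Omega>) + b * - (\<integral>x. (H x \<bullet> e) * \<phi> x \<partial>lebesgue_on \<Omega>)"
    using assms(3,4) \<phi> e by (simp add: weak_gradient_def)
  also have "\<dots> = - (\<integral>x. a * ((G x \<bullet> e) * \<phi> x) + b * ((H x \<bullet> e) * \<phi> x) \<partial>lebesgue_on \<Omega>)"
    using i(2)[OF assms(5,1)] i(2)[OF assms(5,2)] by simp
  also have "\<dots> = - (\<integral>x. ((a *\<^sub>R G x + b *\<^sub>R H x) \<bullet> e) * \<phi> x \<partial>lebesgue_on \<Omega>)"
    by (simp add: inner_simps algebra_simps)
  finally show "(\<integral>x. (a * u x + b * w x) * pderiv_fn e \<phi> x \<partial>lebesgue_on \<Omega>)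
      = - (\<integral>x. ((a *\<^sub>R G x + b *\<^sub>R H x) \<bullet> e) * \<phi> x \<partial>lebesgue_on \<Omega>)" .
qed

lemma H1_lin:
  assumes "u \<in> H1 \<Omega>" "w \<in> H1 \<Omega>"
  shows "(\<lambda>x. a * u x + b * w x) \<in> H1 \<Omega>"
    and "AE x in lebesgue_on \<Omega>. grad \<Omega> (\<lambda>x. a * u x + b * w x) x = a *\<^sub>R grad \<Omega> u x + b *\<^sub>R grad \<Omega> w x"
proof -
  note g = H1_grad[OF assms(1)] H1_grad[OF assms(2)]
  have G: "(\<lambda>x. a *\<^sub>R grad \<Omega> u x + b *\<^sub>R grad \<Omega> w x) \<in> L2 \<Omega>"
    by (intro L2_add L2_scaleR g)
  have w: "weak_gradient \<Omega> (\<lambda>x. a * u x + b * w x) (\<lambda>x. a *\<^sub>R grad \<Omega> u x + b *\<^sub>R grad \<Omega> w x)"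
    by (intro weak_gradient_lin g H1_L2 assms)
  show 1: "(\<lambda>x. a * u x + b * w x) \<in> H1 \<Omega>"
    using G w L2_add[OF L2_cmult[OF H1_L2[OF assms(1)]] L2_cmult[OF H1_L2[OF assms(2)]]]
    unfolding H1_def by blast
  show "AE x in lebesgue_on \<Omega>. grad \<Omega> (\<lambda>x. a * u x + b * w x) x = a *\<^sub>R grad \<Omega> u x + b *\<^sub>R grad \<Omega> w x"
    by (rule weak_gradient_unique[OF H1_grad(1)[OF 1] G H1_grad(2)[OF 1] w])
qed

lemma H1_diff:
  assumes "u \<in> H1 \<Omega>" "w \<in> H1 \<Omega>"
  shows "u - w \<in> H1 \<Omega>" "AE x in lebesgue_on \<Omega>. grad \<Omega> (u - w) x = grad \<Omega> u x - grad \<Omega> w x"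
  using H1_lin[OF assms, of 1 "-1"] by (auto simp: fun_diff_def)

lemma H1_add:
  assumes "u \<in> H1 \<Omega>" "w \<in> H1 \<Omega>"
  shows "(\<lambda>x. u x + w x) \<in> H1 \<Omega>" "AE x in lebesgue_on \<Omega>. grad \<Omega> (\<lambda>x. u x + w x) x = grad \<Omega> u x + grad \<Omega> w x"
  using H1_lin[OF assms, of 1 1] by auto

lemma H1_norm_lin:
  assumes "u \<in> H1 \<Omega>" "w \<in> H1 \<Omega>"
  shows "H1_norm \<Omega> (\<lambda>x. a * u x + b * w x) \<le> \<bar>a\<bar> * H1_norm \<Omega> u + \<bar>b\<bar> * H1_norm \<Omega> w"
proof -
  have sc: "\<bar>c\<bar> * H1_norm \<Omega> v = sqrt ((\<bar>c\<bar> * L2_norm \<Omega> v)\<^sup>2 + (\<bar>c\<bar> * L2_norm \<Omega> (grad \<Omega> v))\<^sup>2)" for c v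
    by (simp add: H1_norm_def power_mult_distrib distrib_left[symmetric] real_sqrt_mult)
  have g: "grad \<Omega> u \<in> L2 \<Omega>" "grad \<Omega> w \<in> L2 \<Omega>" "u \<in> L2 \<Omega>" "w \<in> L2 \<Omega>" using assms by (auto intro: H1_grad H1_L2)
  have 1: "L2_norm \<Omega> (\<lambda>x. a * u x + b * w x) \<le> \<bar>a\<bar> * L2_norm \<Omega> u + \<bar>b\<bar> * L2_norm \<Omega> w"
    using L2_norm_triangle[OF L2_scaleR[OF g(3), of a] L2_scaleR[OF g(4), of b]] L2_norm_scaleR[of \<Omega> a u] L2_norm_scaleR[of \<Omega> b w]
    by simp
  have "L2_norm \<Omega> (grad \<Omega> (\<lambda>x. a * u x + b * w x)) = L2_norm \<Omega> (\<lambda>x. a *\<^sub>R grad \<Omega> u x + b *\<^sub>R grad \<Omega> w x)"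
    by (intro L2_norm_cong_AE H1_lin assms L2_measurable H1_grad L2_add L2_scaleR g)
  also have "\<dots> \<le> \<bar>a\<bar> * L2_norm \<Omega> (grad \<Omega> u) + \<bar>b\<bar> * L2_norm \<Omega> (grad \<Omega> w)"
    using L2_norm_triangle[OF L2_scaleR[OF g(1), of a] L2_scaleR[OF g(2), of b]]
    by (simp add: L2_norm_scaleR)
  finally have 2: "L2_norm \<Omega> (grad \<Omega> (\<lambda>x. a * u x + b * w x)) \<le> \<bar>a\<bar> * L2_norm \<Omega> (grad \<Omega> u) + \<bar>b\<bar> * L2_norm \<Omega> (grad \<Omega> w)" .
  have "H1_norm \<Omega> (\<lambda>x. a * u x + b * w x) \<le> sqrt ((\<bar>a\<bar> * L2_norm \<Omega> u + \<bar>b\<bar> * L2_norm \<Omega> w)\<^sup>2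
      + (\<bar>a\<bar> * L2_norm \<Omega> (grad \<Omega> u) + \<bar>b\<bar> * L2_norm \<Omega> (grad \<Omega> w))\<^sup>2)"
    unfolding H1_norm_def by (intro real_sqrt_le_mono add_mono power_mono 1 2 L2_norm_nonneg)
  \<comment> \<open>Minkowski's inequality in the plane, applied to the pairs of L2 norms of
    function and gradient.\<close>
  also have "\<dots> \<le> sqrt ((\<bar>a\<bar> * L2_norm \<Omega> u)\<^sup>2 + (\<bar>a\<bar> * L2_norm \<Omega> (grad \<Omega> u))\<^sup>2)
      + sqrt ((\<bar>b\<bar> * L2_norm \<Omega> w)\<^sup>2 + (\<bar>b\<bar> * L2_norm \<Omega> (grad \<Omega> w))\<^sup>2)"
    by (rule real_sqrt_sum_squares_triangle_ineq)
  finally show ?thesis by (simp add: sc)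
qed

text \<open>Integration by parts identifies the classical gradient as a weak one; through
  \<open>grad_test\<close> the computation for Poincare's inequality may then use classical
  derivatives.\<close>

lemma weak_gradient_test:
  assumes \<phi>: "test_function \<Omega> \<phi>"
  shows "(\<lambda>x. \<Sum>e\<in>Basis. pderiv_fn e \<phi> x *\<^sub>R e) \<in> L2 \<Omega>"
    and "weak_gradient \<Omega> \<phi> (\<lambda>x. \<Sum>e\<in>Basis. pderiv_fn e \<phi> x *\<^sub>R e)"
proof -
  have s: "(\<lambda>x. pderiv_fn e \<phi> x *\<^sub>R e) \<in> L2 \<Omega>" if e: "e \<in> Basis" for e
  proof (rule L2_bound[of _ _ "pderiv_fn e \<phi>" 1])
    note d = test_function_mem_L2[OF test_function_pderiv[OF \<phi> e]]
    show "(\<lambda>x. pderiv_fn e \<phi> x *\<^sub>R e) \<in> borel_measurable (lebesgue_on \<Omega>)"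
      by (intro borel_measurable_scaleR borel_measurable_const L2_measurable d)
    show "pderiv_fn e \<phi> \<in> L2 \<Omega>" by (rule d)
  qed (use e in simp)
  have "(\<lambda>x. \<Sum>e\<in>A. pderiv_fn e \<phi> x *\<^sub>R e) \<in> L2 \<Omega>" if "finite A" "A \<subseteq> Basis" for A
    using that by (induction A rule: finite_induct) (auto intro!: L2_add L2_zero s)
  then show "(\<lambda>x. \<Sum>e\<in>Basis. pderiv_fn e \<phi> x *\<^sub>R e) \<in> L2 \<Omega>" by simp
  have "(\<Sum>b\<in>Basis. pderiv_fn b \<phi> x *\<^sub>R b) \<bullet> e = pderiv_fn e \<phi> x" if "e \<in> Basis" for x e
    using that by simp
  then show "weak_gradient \<Omega> \<phi> (\<lambda>x. \<Sum>e\<in>Basis. pderiv_fn e \<phi> x *\<^sub>R e)"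
    unfolding weak_gradient_def using integration_by_parts[OF \<phi>] by simp
qed

lemma test_function_H1: "test_function \<Omega> \<phi> \<Longrightarrow> \<phi> \<in> H1 \<Omega>"
  using weak_gradient_test test_function_mem_L2 by (auto simp: H1_def)

lemma grad_test:
  assumes "test_function \<Omega> \<phi>" "e \<in> Basis"
  shows "AE x in lebesgue_on \<Omega>. grad \<Omega> \<phi> x \<bullet> e = pderiv_fn e \<phi> x"
  using weak_gradient_unique[OF H1_grad(1) weak_gradient_test(1) H1_grad(2) weak_gradient_test(2),
      OF test_function_H1 _ test_function_H1, OF assms(1) assms(1) assms(1) assms(1)]
  by eventually_elim (use assms(2) in simp)

lemma test_function_H10: "test_function \<Omega> \<phi> \<Longrightarrow> \<phi> \<in> H10 \<Omega>"
proof -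
  assume \<phi>: "test_function \<Omega> \<phi>"
  have "H1_norm \<Omega> (\<phi> - \<phi>) \<le> 0"
    using H1_norm_lin[OF test_function_H1[OF \<phi>] test_function_H1[OF \<phi>], of 0 0] by (simp add: fun_diff_def)
  then have "H1_norm \<Omega> (\<phi> - \<phi>) = 0" using H1_norm_nonneg by (rule antisym)
  then show ?thesis using \<phi> test_function_H1[OF \<phi>] by (auto simp: H10_def intro!: exI[of _ "\<lambda>_. \<phi>"])
qed

lemma H10_lin:
  assumes "u \<in> H10 \<Omega>" "w \<in> H10 \<Omega>"
  shows "(\<lambda>x. a * u x + b * w x) \<in> H10 \<Omega>"
proof -
  obtain \<phi> \<psi> where \<phi>: "\<And>k. test_function \<Omega> (\<phi> k)" "(\<lambda>k::nat. H1_norm \<Omega> (u - \<phi> k)) \<longlonglongrightarrow> 0"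
    and \<psi>: "\<And>k. test_function \<Omega> (\<psi> k)" "(\<lambda>k::nat. H1_norm \<Omega> (w - \<psi> k)) \<longlonglongrightarrow> 0"
    using assms by (auto simp: H10_def)
  let ?\<chi> = "\<lambda>k x. a * \<phi> k x + b * \<psi> k x"
  have le: "H1_norm \<Omega> ((\<lambda>x. a * u x + b * w x) - ?\<chi> k) \<le> \<bar>a\<bar> * H1_norm \<Omega> (u - \<phi> k) + \<bar>b\<bar> * H1_norm \<Omega> (w - \<psi> k)" for k
  proof -
    have "(\<lambda>x. a * u x + b * w x) - ?\<chi> k = (\<lambda>x. a * (u - \<phi> k) x + b * (w - \<psi> k) x)"
      by (auto simp: algebra_simps)
    then show ?thesis
      using H1_norm_lin[of "u - \<phi> k" "w - \<psi> k" a b] H1_diff(1) H10_H1 assms test_function_H1 \<phi>(1) \<psi>(1) by metis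
  qed
  have "(\<lambda>k. \<bar>a\<bar> * H1_norm \<Omega> (u - \<phi> k) + \<bar>b\<bar> * H1_norm \<Omega> (w - \<psi> k)) \<longlonglongrightarrow> \<bar>a\<bar> * 0 + \<bar>b\<bar> * 0"
    by (intro tendsto_intros \<phi> \<psi>)
  then have "(\<lambda>k. \<bar>a\<bar> * H1_norm \<Omega> (u - \<phi> k) + \<bar>b\<bar> * H1_norm \<Omega> (w - \<psi> k)) \<longlonglongrightarrow> 0" by simp
  then have "(\<lambda>k. H1_norm \<Omega> ((\<lambda>x. a * u x + b * w x) - ?\<chi> k)) \<longlonglongrightarrow> 0"
    by (rule tendsto_sandwich[OF _ _ tendsto_const, rotated 2]) (auto simp: H1_norm_nonneg le)
  moreover have "test_function \<Omega> (?\<chi> k)" for k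
    by (intro test_function_add test_function_cmult \<phi> \<psi>)
  ultimately show ?thesis
    using H1_lin(1)[OF H10_H1[OF assms(1)] H10_H1[OF assms(2)]]
    unfolding H10_def mem_Collect_eq by (intro conjI exI[of _ ?\<chi>]) auto
qed

lemma H10_diff: "u \<in> H10 \<Omega> \<Longrightarrow> w \<in> H10 \<Omega> \<Longrightarrow> u - w \<in> H10 \<Omega>"
  using H10_lin[of u w 1 "-1"] by (simp add: fun_diff_def)

lemma H10_add: "u \<in> H10 \<Omega> \<Longrightarrow> w \<in> H10 \<Omega> \<Longrightarrow> (\<lambda>x. u x + w x) \<in> H10 \<Omega>"
  using H10_lin[of u w 1 1] by simp

text \<open>The boundary datum cancels in (u - g) - (w - g). Hence the difference of solution and
  steady state is an admissible test function.\<close>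

lemma trace_eq_diff: "trace_eq \<Omega> u g \<Longrightarrow> trace_eq \<Omega> w g \<Longrightarrow> u - w \<in> H10 \<Omega>"
  using H10_diff[of "u - g" "w - g"] by (simp add: trace_eq_def fun_diff_def)

text \<open>The test function \<open>x\<^sub>e \<phi>\<^sup>2\<close> has vanishing integral of its \<open>e\<close>-th derivative
  \<open>\<phi>\<^sup>2 + 2 x\<^sub>e \<phi> \<partial>\<^sub>e\<phi>\<close>.\<close>

lemma Poincare_test:
  assumes \<phi>: "test_function \<Omega> \<phi>" and R: "\<And>x. x \<in> \<Omega> \<Longrightarrow> norm x \<le> R"
  shows "L2_norm \<Omega> \<phi> \<le> 2 * R * L2_norm \<Omega> (grad \<Omega> \<phi>)"
proof (cases "\<Omega> = {}")
  case True
  then show ?thesis by (simp add: L2_norm_def integral_restrict_space)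
next
  case False
  then have "R \<ge> 0" using R norm_ge_zero order_trans by blast
  obtain e :: 'a where e: "e \<in> Basis" using nonempty_Basis by blast
  note d = test_function_pderiv[OF \<phi> e] test_function_differentiable[OF \<phi>]
  have xphi: "test_function \<Omega> (\<lambda>x. (x \<bullet> e) * \<phi> x)" by (intro test_function_mult_left \<phi>) simp
  have "pderiv_fn e (\<lambda>x. (x \<bullet> e) * \<phi> x) x = (x \<bullet> e) * pderiv_fn e \<phi> x + 1 * \<phi> x" for x
  proof -
    have i: "((\<lambda>x. x \<bullet> e) has_derivative (\<lambda>h. h \<bullet> e)) (at x)" by (auto intro!: derivative_eq_intros)
    then have "pderiv_fn e (\<lambda>x. x \<bullet> e) x = 1" using e by (simp add: frechet_derivative_at[OF i, symmetric])
    then show ?thesis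
      using frechet_derivative_mult_real[of "\<lambda>x. x \<bullet> e" x \<phi> e] i d by (auto simp: differentiable_def)
  qed
  then have "(\<integral>x. (x \<bullet> e) * \<phi> x * pderiv_fn e \<phi> x \<partial>lebesgue_on \<Omega>)
      = - (\<integral>x. ((x \<bullet> e) * pderiv_fn e \<phi> x + \<phi> x) * \<phi> x \<partial>lebesgue_on \<Omega>)"
    using integration_by_parts[OF xphi \<phi> e] by simp
  also have "\<dots> = - (\<integral>x. (x \<bullet> e) * \<phi> x * pderiv_fn e \<phi> x + \<phi> x * \<phi> x \<partial>lebesgue_on \<Omega>)"
    by (simp add: algebra_simps)
  also have "\<dots> = - (\<integral>x. (x \<bullet> e) * \<phi> x * pderiv_fn e \<phi> x \<partial>lebesgue_on \<Omega>) - (\<integral>x. \<phi> x * \<phi> x \<partial>lebesgue_on \<Omega>)"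
    using L2_mult_integrable[OF test_function_mem_L2[OF xphi] test_function_mem_L2[OF d(1)]] L2_mult_integrable[OF test_function_mem_L2[OF \<phi>] test_function_mem_L2[OF \<phi>]] by simp
  \<comment> \<open>The same integral stands on both sides; collecting it produces the 2 in the
    constant \<open>2 * R\<close>.\<close>
  finally have "(L2_norm \<Omega> \<phi>)\<^sup>2 = - (2 * (\<integral>x. (x \<bullet> e) * \<phi> x * pderiv_fn e \<phi> x \<partial>lebesgue_on \<Omega>))"
    unfolding L2_norm_sq_eq_inner L2_inner_def by simp
  also have "\<dots> \<le> 2 * (L2_norm \<Omega> (\<lambda>x. (x \<bullet> e) * \<phi> x) * L2_norm \<Omega> (pderiv_fn e \<phi>))"
    using L2_inner_Cauchy_Schwarz[OF test_function_mem_L2[OF xphi] test_function_mem_L2[OF d(1)]] unfolding L2_inner_def by linarith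
  also have "\<dots> \<le> 2 * ((R * L2_norm \<Omega> \<phi>) * L2_norm \<Omega> (grad \<Omega> \<phi>))"
  proof -
    have "L2_norm \<Omega> (\<lambda>x. (x \<bullet> e) * \<phi> x) \<le> L2_norm \<Omega> (\<lambda>x. R *\<^sub>R \<phi> x)"
    proof (rule L2_norm_mono[OF L2_measurable[OF test_function_mem_L2[OF xphi]] L2_scaleR[OF test_function_mem_L2[OF \<phi>]]], rule AE_I2)
      fix x assume "x \<in> space (lebesgue_on \<Omega>)"
      then have "\<bar>x \<bullet> e\<bar> \<le> R" using R[of x] Basis_le_norm[OF e, of x] by (auto simp: space_restrict_space)
      then show "norm ((x \<bullet> e) * \<phi> x) \<le> norm (R *\<^sub>R \<phi> x)" by (auto simp: abs_mult intro!: mult_right_mono)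
    qed
    also have "\<dots> = R * L2_norm \<Omega> \<phi>" using \<open>R \<ge> 0\<close> by (simp only: L2_norm_scaleR abs_of_nonneg)
    finally have 1: "L2_norm \<Omega> (\<lambda>x. (x \<bullet> e) * \<phi> x) \<le> R * L2_norm \<Omega> \<phi>" .
    have 2: "L2_norm \<Omega> (pderiv_fn e \<phi>) \<le> L2_norm \<Omega> (grad \<Omega> \<phi>)"
    proof (rule L2_norm_mono[OF L2_measurable[OF test_function_mem_L2[OF d(1)]] H1_grad(1)[OF test_function_H1[OF \<phi>]]])
      show "AE x in lebesgue_on \<Omega>. norm (pderiv_fn e \<phi> x) \<le> norm (grad \<Omega> \<phi> x)"
        using grad_test[OF \<phi> e]
      proof eventually_elim
        case (elim x)
        show ?case unfolding elim[symmetric] real_norm_def by (rule Basis_le_norm[OF e])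
      qed
    qed
    show ?thesis using 1 2 \<open>R \<ge> 0\<close> by (intro mult_left_mono mult_mono) (auto simp: L2_norm_nonneg)
  qed
  finally have "L2_norm \<Omega> \<phi> * L2_norm \<Omega> \<phi> \<le> (2 * R * L2_norm \<Omega> (grad \<Omega> \<phi>)) * L2_norm \<Omega> \<phi>"
    by (simp add: power2_eq_square algebra_simps)
  then show ?thesis
    using L2_norm_nonneg[of \<Omega> \<phi>] L2_norm_nonneg[of \<Omega> "grad \<Omega> \<phi>"] \<open>R \<ge> 0\<close>
    by (cases "L2_norm \<Omega> \<phi> = 0") auto
qed

text \<open>Both sides are continuous in the H1 norm, so the bound passes from test functions to
  their closure. The constant is twice the radius of a ball about the origin containing the
  domain.\<close>

lemma Poincare:
  obtains c where "c > 0" "\<And>u. u \<in> H10 \<Omega> \<Longrightarrow> L2_norm \<Omega> u \<le> c * L2_norm \<Omega> (grad \<Omega> u)"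
proof -
  obtain R where R: "R > 0" "\<And>x. x \<in> \<Omega> \<Longrightarrow> norm x \<le> R" using bd by (auto simp: bounded_pos)
  have "L2_norm \<Omega> u \<le> 2 * R * L2_norm \<Omega> (grad \<Omega> u)" if u: "u \<in> H10 \<Omega>" for u
  proof -
    obtain \<phi> where \<phi>: "\<And>k. test_function \<Omega> (\<phi> k)" "(\<lambda>k::nat. H1_norm \<Omega> (u - \<phi> k)) \<longlonglongrightarrow> 0"
      using u by (auto simp: H10_def)
    have u1: "u \<in> H1 \<Omega>" by (rule H10_H1[OF u])
    have "L2_norm \<Omega> u \<le> 2 * R * L2_norm \<Omega> (grad \<Omega> u) + (1 + 2 * R) * H1_norm \<Omega> (u - \<phi> k)" for k
    proof -
      note p1 = test_function_H1[OF \<phi>(1)[of k]]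
      note d = H1_diff[OF u1 p1]
      have "L2_norm \<Omega> u = L2_norm \<Omega> (\<lambda>x. (u - \<phi> k) x + \<phi> k x)" by (simp add: fun_diff_def)
      also have "\<dots> \<le> L2_norm \<Omega> (u - \<phi> k) + L2_norm \<Omega> (\<phi> k)"
        by (intro L2_norm_triangle H1_L2 d p1)
      finally have 1: "L2_norm \<Omega> u \<le> L2_norm \<Omega> (u - \<phi> k) + L2_norm \<Omega> (\<phi> k)" .
      have "L2_norm \<Omega> (grad \<Omega> (\<phi> k)) = L2_norm \<Omega> (\<lambda>x. grad \<Omega> u x - grad \<Omega> (u - \<phi> k) x)"
        by (rule L2_norm_cong_AE) (use d(2) in \<open>auto intro!: L2_measurable H1_grad d L2_diff u1 p1\<close>)
      also have "\<dots> \<le> L2_norm \<Omega> (grad \<Omega> u) + L2_norm \<Omega> (grad \<Omega> (u - \<phi> k))"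
        by (intro L2_norm_triangle_diff H1_grad d u1)
      finally have 2: "2 * R * L2_norm \<Omega> (grad \<Omega> (\<phi> k)) \<le> 2 * R * (L2_norm \<Omega> (grad \<Omega> u) + L2_norm \<Omega> (grad \<Omega> (u - \<phi> k)))"
        using R(1) by (intro mult_left_mono) auto
      have 3: "2 * R * L2_norm \<Omega> (grad \<Omega> (u - \<phi> k)) \<le> 2 * R * H1_norm \<Omega> (u - \<phi> k)"
        using R(1) by (intro mult_left_mono H1_norm_ge) auto
      show ?thesis
        using 1 2 3 Poincare_test[OF \<phi>(1)[of k] R(2)] H1_norm_ge(1)[of \<Omega> "u - \<phi> k"]
        by (simp add: algebra_simps)
    qed
    moreover have "(\<lambda>k. 2 * R * L2_norm \<Omega> (grad \<Omega> u) + (1 + 2 * R) * H1_norm \<Omega> (u - \<phi> k))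
        \<longlonglongrightarrow> 2 * R * L2_norm \<Omega> (grad \<Omega> u) + (1 + 2 * R) * 0"
      by (intro tendsto_intros \<phi>)
    ultimately show ?thesis
      by (intro LIMSEQ_le_const[of _ "2 * R * L2_norm \<Omega> (grad \<Omega> u)"]) auto
  qed
  then show ?thesis using that[of "2 * R"] R(1) by auto
qed

end

section \<open>Integral inequalities on the time axis\<close>

lemma AE_negligible:
  fixes S :: "'a::euclidean_space set"
  assumes "AE t in lebesgue_on S. P t" "S \<in> sets lebesgue"
  obtains N where "negligible N" "\<And>t. t \<in> S \<Longrightarrow> t \<notin> N \<Longrightarrow> P t"
proof -
  have "AE t in lebesgue. t \<in> S \<longrightarrow> P t"
    using assms by (subst (asm) AE_restrict_space_iff) auto
  then have "{t. \<not> (t \<in> S \<longrightarrow> P t)} \<in> null_sets lebesgue"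
    by (subst (asm) completion.AE_iff_null_sets) simp
  then show ?thesis
    by (intro that[of "{t. \<not> (t \<in> S \<longrightarrow> P t)}"]) (simp_all add: negligible_iff_null_sets)
qed

lemma integrable_lebesgue_on_subset:
  fixes f :: "'a::euclidean_space \<Rightarrow> real"
  assumes "integrable (lebesgue_on S) f" "T \<subseteq> S" "S \<in> sets lebesgue" "T \<in> sets lebesgue"
  shows "integrable (lebesgue_on T) f"
  using set_integrable_subset[of lebesgue S f T] assms
  by (simp add: integrable_restrict_space set_integrable_def)

lemma integral_le_negligible:
  fixes f g :: "'a::euclidean_space \<Rightarrow> real"
  assumes "f integrable_on S" "g integrable_on S" "negligible N" "\<And>x. x \<in> S \<Longrightarrow> x \<notin> N \<Longrightarrow> f x \<le> g x"
  shows "integral S f \<le> integral S g"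
proof -
  define f' where "f' x = (if x \<in> N then g x else f x)" for x
  have "f' integrable_on S"
    by (rule integrable_spike[OF assms(1,3)]) (simp add: f'_def)
  then have "integral S f' \<le> integral S g"
    using assms by (intro integral_le) (auto simp: f'_def)
  moreover have "integral S f = integral S f'"
    by (rule integral_spike[OF assms(3)]) (simp add: f'_def)
  ultimately show ?thesis by simp
qed

text \<open>The Bochner spaces use Lebesgue integrals over the open interval, the calculus of
  primitives uses gauge integrals over closed ones; the two end points are negligible.\<close>

lemma integrable_on_from_open:
  fixes f :: "real \<Rightarrow> real"
  assumes "integrable (lebesgue_on {0<..<T}) f"
  shows "f integrable_on {0..T}" "integral {0..T} f = (\<integral>t. f t \<partial>lebesgue_on {0<..<T})"
proof -
  have "f integrable_on {0<..<T}" by (rule integrable_on_lebesgue_on[OF assms]) simp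
  then show "f integrable_on {0..T}" by (simp add: integrable_on_open_interval_real)
  show "integral {0..T} f = (\<integral>t. f t \<partial>lebesgue_on {0<..<T})"
    using lebesgue_integral_eq_integral[OF assms] by (simp add: integral_open_interval_real)
qed

lemma integral_interval_diff:
  fixes f :: "real \<Rightarrow> real"
  assumes "f integrable_on {0..T}" "0 \<le> a" "a \<le> b" "b \<le> T"
  shows "integral {a..b} f = integral {0..b} f - integral {0..a} f" "f integrable_on {a..b}"
proof -
  have "f integrable_on {0..b}" by (rule integrable_subinterval_real[OF assms(1)]) (use assms in auto)
  then show "integral {a..b} f = integral {0..b} f - integral {0..a} f"
    using Henstock_Kurzweil_Integration.integral_combine[of 0 a b f] assms by simp
  show "f integrable_on {a..b}" by (rule integrable_subinterval_real[OF assms(1)]) (use assms in auto)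
qed

lemma integral_shift_diff:
  fixes f :: "real \<Rightarrow> real"
  assumes "f integrable_on {0..T}" "0 \<le> a" "a \<le> b" "b + h \<le> T" "0 \<le> h"
  shows "integral {a..b} (\<lambda>t. f (t + h)) = integral {0..b+h} f - integral {0..a+h} f"
    "(\<lambda>t. f (t + h)) integrable_on {a..b}"
proof -
  have i: "f integrable_on {a+h..b+h}" and
    e: "integral {a+h..b+h} f = integral {0..b+h} f - integral {0..a+h} f"
    using integral_interval_diff[OF assms(1), of "a+h" "b+h"] assms by auto
  have "((\<lambda>t. f (t + h)) has_integral (integral {a+h..b+h} f)) {a+h-h..b+h-h}"
    by (rule has_integral_shift_real_ivl[OF integrable_integral[OF i]])
  then show "integral {a..b} (\<lambda>t. f (t + h)) = integral {0..b+h} f - integral {0..a+h} f"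
    "(\<lambda>t. f (t + h)) integrable_on {a..b}"
    using e by (auto simp: integral_unique has_integral_integrable)
qed

text \<open>The hypothesis only compares the final value with earlier ones. For Y(s), the integral
  of y over [s,b], it bounds y(s) = -Y'(s) from below, so an integrating factor produces a
  nonincreasing quantity; the hypothesis at s = a then turns Y(a) back into y(a).\<close>

lemma Gronwall_backward:
  fixes y :: "real \<Rightarrow> real"
  assumes y: "continuous_on {a..b} y" and k: "k > 0" and ab: "a \<le> b"
    and le: "\<And>s. s \<in> {a..b} \<Longrightarrow> y b \<le> y s + \<epsilon> - k * integral {s..b} y"
  shows "y b \<le> \<epsilon> + y a * exp (- k * (b - a))"
proof (cases "a = b")
  case True
  then show ?thesis using le[of b] by simp
next
  case False
  define Y where "Y s = integral {a..b} y - integral {a..s} y" for s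
  have yi: "y integrable_on {a..b}" by (rule integrable_continuous_interval[OF y])
  have Y: "integral {s..b} y = Y s" if "s \<in> {a..b}" for s
    using Henstock_Kurzweil_Integration.integral_combine[of a s b y] that yi by (simp add: Y_def)
  \<comment> \<open>The second summand accounts for the constant \<open>y b - \<epsilon>\<close>, so
    that the derivative of \<open>Z\<close> has exactly the sign provided by
    \<open>le\<close>.\<close>
  define Z where "Z s = Y s * exp (k * s) + (y b - \<epsilon>) / k * exp (k * s)" for s
  have "Z b \<le> Z a"
  proof (rule DERIV_nonpos_imp_decreasing_open[of a b Z, OF ab])
    fix s assume s: "a < s" "s < b"
    have "((\<lambda>u. integral {a..u} y) has_real_derivative y s) (at s within {a..b})"
      by (rule integral_has_real_derivative[OF y]) (use s in auto)
    then have d: "((\<lambda>u. integral {a..u} y) has_real_derivative y s) (at s)"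
      using s by (subst (asm) at_within_interior) auto
    have "(Z has_real_derivative exp (k * s) * (y b - \<epsilon> + k * Y s - y s)) (at s)"
      unfolding Z_def[abs_def] Y_def[abs_def]
      using k by (auto intro!: derivative_eq_intros d simp: field_simps)
    moreover have "exp (k * s) * (y b - \<epsilon> + k * Y s - y s) \<le> 0"
      using le[of s] Y[of s] s by (intro mult_nonneg_nonpos) auto
    ultimately show "\<exists>z. (Z has_real_derivative z) (at s) \<and> z \<le> 0" by blast
  next
    show "continuous_on {a..b} Z"
      unfolding Z_def[abs_def] Y_def[abs_def]
      by (intro continuous_intros indefinite_integral_continuous_1 yi)
  qed
  moreover have "Y b = 0" by (simp add: Y_def)
  ultimately have "(y b - \<epsilon>) / k * exp (k * b) \<le> (Y a + (y b - \<epsilon>) / k) * exp (k * a)"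
    by (simp add: Z_def algebra_simps)
  then have "k * ((y b - \<epsilon>) / k * exp (k * b)) \<le> k * ((Y a + (y b - \<epsilon>) / k) * exp (k * a))"
    by (rule mult_left_mono) (use k in simp)
  then have "(y b - \<epsilon>) * exp (k * b) \<le> (k * Y a + (y b - \<epsilon>)) * exp (k * a)"
    using k by (simp add: distrib_left distrib_right)
  \<comment> \<open>This is the hypothesis at \<open>s = a\<close>, where it reads
    \<open>y b - \<epsilon> + k * Y a \<le> y a\<close>.\<close>
  also have "\<dots> \<le> y a * exp (k * a)"
    using le[of a] Y[of a] ab by (intro mult_right_mono) auto
  finally have "(y b - \<epsilon>) * exp (k * b) * exp (- k * b) \<le> y a * exp (k * a) * exp (- k * b)"
    by (intro mult_right_mono) auto
  then have "y b - \<epsilon> \<le> y a * exp (- k * (b - a))"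
    by (simp add: mult.assoc exp_add[symmetric] algebra_simps)
  then show ?thesis by simp
qed

text \<open>\<open>G\<close> is not known to be continuous, so the Gronwall argument is applied to its averages over
  intervals of length \<open>h\<close>; semicontinuity of \<open>G\<close> allows to let \<open>h \<rightarrow> 0\<close> at the end.\<close>

lemma exponential_decay:
  fixes G :: "real \<Rightarrow> real"
  assumes k: "k > 0" and G0: "\<And>t. G t \<ge> 0" and Gi: "\<And>T. T > 0 \<Longrightarrow> G integrable_on {0..T}"
    and bdd: "negligible N0" "\<And>t. 0 < t \<Longrightarrow> t < 1 \<Longrightarrow> t \<notin> N0 \<Longrightarrow> G t \<le> M"
    and lsc: "\<And>b e. b > 0 \<Longrightarrow> e > 0 \<Longrightarrow> \<exists>\<delta>>0. \<forall>t\<in>{b..b+\<delta>}. G b - e \<le> G t"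
    and step: "\<And>T e. T > 0 \<Longrightarrow> e > 0 \<Longrightarrow> \<exists>\<delta>>0. \<exists>P Q N. negligible N \<and> (\<forall>t. 0 \<le> P t) \<and> (\<forall>t. 0 \<le> Q t) \<and>
       P integrable_on {0..T} \<and> Q integrable_on {0..T} \<and> integral {0..T} P \<le> e \<and> integral {0..T} Q \<le> e \<and>
       (\<forall>t h. 0 < t \<longrightarrow> t + h < T \<longrightarrow> 0 < h \<longrightarrow> h < \<delta> \<longrightarrow> t \<notin> N \<longrightarrow> t + h \<notin> N \<longrightarrow>
          G (t + h) - G t \<le> - k * integral {t..t+h} G + integral {t..t+h} P + h * (Q t + Q (t + h)))"
    and b: "b > 0"
  shows "G b \<le> M * exp (- k * b)"
proof -
  \<comment> \<open>The increment estimate and the bound by \<open>M\<close> are available only at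
    positive times, so the start is some \<open>a\<close> > 0 that tends to 0 at the end. Of the
    error, 3 e stems from \<open>P\<close> and \<open>Q\<close> and one e from
    semicontinuity.\<close>
  have key: "G b \<le> 4 * e + M * exp (- k * (b - a))" if a: "0 < a" "a < b" "a < 1/2" and e: "e > 0" for a e
  proof -
    define T where "T = b + 1"
    have "T > 0" using b by (simp add: T_def)
    obtain \<delta> P Q N where \<delta>: "\<delta> > 0" and N: "negligible N" and P0: "\<And>t. 0 \<le> P t" and Q0: "\<And>t. 0 \<le> Q t"
      and Pi: "P integrable_on {0..T}" and Qi: "Q integrable_on {0..T}"
      and Pe: "integral {0..T} P \<le> e" and Qe: "integral {0..T} Q \<le> e"
      and st: "\<And>t h. 0 < t \<Longrightarrow> t + h < T \<Longrightarrow> 0 < h \<Longrightarrow> h < \<delta> \<Longrightarrow> t \<notin> N \<Longrightarrow> t + h \<notin> N \<Longrightarrow>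
          G (t + h) - G t \<le> - k * integral {t..t+h} G + integral {t..t+h} P + h * (Q t + Q (t + h))"
      using step[OF \<open>T > 0\<close> e] by blast
    obtain \<eta> where \<eta>: "\<eta> > 0" "\<And>t. t \<in> {b..b+\<eta>} \<Longrightarrow> G b - e \<le> G t"
      using lsc[OF b e] by blast
    \<comment> \<open>Below \<open>\<delta>\<close> for the increment estimate, at most
      \<open>\<eta>\<close> for semicontinuity, and at most 1/2 so that \<open>{a..a+h}\<close>
      stays inside (0,1), where \<open>M\<close> bounds \<open>G\<close>, and \<open>b + h\<close>
      stays below \<open>T\<close>.\<close>
    define h where "h = min (min (\<delta> / 2) \<eta>) (1 / 2)"
    have h: "0 < h" "h < \<delta>" "h \<le> \<eta>" "h < 1" "a + h < 1" using \<delta> \<eta>(1) a by (auto simp: h_def min_def)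
    define I where "I t = integral {0..t} G" for t
    define J where "J t = integral {0..t} P" for t
    define \<Phi> where "\<Phi> t = (I (t + h) - I t) / h" for t
    note GT = Gi[OF \<open>T > 0\<close>]
    have Ic: "continuous_on {0..T} I" "continuous_on {0..T} J"
      unfolding I_def J_def by (intro indefinite_integral_continuous_1 GT Pi)+
    then have Ii: "I integrable_on {0..T}" "J integrable_on {0..T}" by (auto intro: integrable_continuous_interval)
    have \<Phi>c: "continuous_on {a..b} \<Phi>"
      unfolding \<Phi>_def using h a
      by (intro continuous_intros continuous_on_compose2[OF Ic(1)]) (auto simp: T_def)
    have J: "0 \<le> J t" "J t \<le> e" if "0 \<le> t" "t \<le> T" for t
    proof -
      have "P integrable_on {0..t}" using integral_interval_diff(2)[OF Pi, of 0 t] that by simp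
      then show "0 \<le> J t" unfolding J_def by (rule Henstock_Kurzweil_Integration.integral_nonneg) (simp add: P0)
      have "J t \<le> integral {0..T} P"
        unfolding J_def using that
        by (intro integral_subset_le integrable_subinterval_real[OF Pi] Pi) (auto simp: P0)
      then show "J t \<le> e" using Pe by simp
    qed
    \<comment> \<open>The increment estimate, integrated over t from s to b and divided by
      \<open>h\<close>, is the hypothesis of \<open>Gronwall_backward\<close> for the averages
      \<open>\<Phi>\<close>.\<close>
    have main: "\<Phi> b \<le> \<Phi> s + 3 * e - k * integral {s..b} \<Phi>" if s: "s \<in> {a..b}" for s
    proof -
      have s': "0 < s" "s \<le> b" "b + h \<le> T" "b < T" using s a h by (auto simp: T_def)
      let ?L = "\<lambda>t. G (t + h) - G t"
      let ?R = "\<lambda>t. - k * (I (t + h) - I t) + (J (t + h) - J t) + h * (Q t + Q (t + h))"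
      note sh = integral_shift_diff[of _ T s b h]
      note dv = integral_interval_diff[of _ T s b]
      have Li: "?L integrable_on {s..b}" and Ri: "?R integrable_on {s..b}"
        using s' h GT Ii Qi sh(2) dv(2)
        by (auto intro!: integrable_diff integrable_add integrable_on_mult_right)
      have L: "integral {s..b} ?L = h * (\<Phi> b - \<Phi> s)"
      proof -
        have "h * (\<Phi> b - \<Phi> s) = (I (b + h) - I b) - (I (s + h) - I s)"
          using h(1) by (simp add: \<Phi>_def diff_divide_distrib[symmetric])
        then show ?thesis
          using s' h GT sh[of G] dv[of G] by (simp add: I_def[symmetric] integral_diff)
      qed
      have \<Phi>i: "integral {s..b} (\<lambda>t. I (t + h) - I t) = h * integral {s..b} \<Phi>"
      proof -
        have "(\<lambda>t. I (t + h) - I t) = (\<lambda>t. h * \<Phi> t)" using h(1) by (simp add: \<Phi>_def)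
        then show ?thesis by (simp only: integral_mult_right)
      qed
      \<comment> \<open>The shifted difference telescopes to integrals of \<open>J\<close> over two
        intervals of length \<open>h\<close>, where \<open>J\<close> lies between 0 and e.\<close>
      have Jle: "integral {s..b} (\<lambda>t. J (t + h) - J t) \<le> h * e"
      proof -
        have *: "integral {u..u+h} J \<ge> 0 \<and> integral {u..u+h} J \<le> h * e" if "0 \<le> u" "u + h \<le> T" for u
        proof -
          have "J integrable_on {u..u+h}" using integral_interval_diff(2)[OF Ii(2)] that h(1) by simp
          moreover have "integral {u..u+h} J \<le> integral {u..u+h} (\<lambda>_. e)"
            using that J by (intro integral_le calculation) auto
          ultimately show ?thesis
            using that J h(1) by (auto intro!: Henstock_Kurzweil_Integration.integral_nonneg)
        qed
        have "integral {s..b} (\<lambda>t. J (t + h) - J t) = integral {b..b+h} J - integral {s..s+h} J"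
          using s' h sh[OF Ii(2)] dv[OF Ii(2)] integral_interval_diff[OF Ii(2), of b "b+h"]
            integral_interval_diff[OF Ii(2), of s "s+h"]
          by (simp add: integral_diff)
        then show ?thesis using *[of b] *[of s] s' by linarith
      qed
      have Qle: "integral {s..b} (\<lambda>t. Q t + Q (t + h)) \<le> 2 * e"
      proof -
        have q: "integral {u..v} Q \<le> e" if "0 \<le> u" "v \<le> T" for u v
          using that Qe
          by (intro order_trans[OF integral_subset_le[of "{u..v}" "{0..T}" Q] Qe]
              integrable_subinterval_real[OF Qi] Qi) (auto simp: Q0)
        have "integral {s..b} (\<lambda>t. Q t + Q (t + h)) = integral {s..b} Q + integral {s..b} (\<lambda>t. Q (t + h))"
          using dv(2)[OF Qi] sh(2)[OF Qi] s' h by (intro integral_add) auto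
        also have "integral {s..b} (\<lambda>t. Q (t + h)) = integral {s+h..b+h} Q"
          using sh(1)[OF Qi] integral_interval_diff(1)[OF Qi, of "s+h" "b+h"] s' h by simp
        finally show ?thesis using q[of s b] q[of "s+h" "b+h"] s' h by simp
      qed
      have R: "integral {s..b} ?R \<le> - k * (h * integral {s..b} \<Phi>) + h * e + h * (2 * e)"
      proof -
        have i: "(\<lambda>t. I (t + h) - I t) integrable_on {s..b}" "(\<lambda>t. J (t + h) - J t) integrable_on {s..b}"
            "(\<lambda>t. Q t + Q (t + h)) integrable_on {s..b}"
          using s' h Ii Qi sh(2) dv(2) by (auto intro!: integrable_diff integrable_add)
        have "integral {s..b} ?R = - k * integral {s..b} (\<lambda>t. I (t + h) - I t)
            + integral {s..b} (\<lambda>t. J (t + h) - J t) + h * integral {s..b} (\<lambda>t. Q t + Q (t + h))"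
          using i by (simp only: integral_add integrable_add integrable_on_mult_right integral_mult_right)
        also have "\<dots> \<le> - k * (h * integral {s..b} \<Phi>) + h * e + h * (2 * e)"
          unfolding \<Phi>i by (intro add_mono order_refl Jle mult_left_mono[OF Qle]) (use h(1) in simp)
        finally show ?thesis .
      qed
      have "integral {s..b} ?L \<le> integral {s..b} ?R"
      proof (rule integral_le_negligible[OF Li Ri])
        \<comment> \<open>Both \<open>t\<close> and \<open>t + h\<close> have to avoid
          \<open>N\<close>, hence the translate.\<close>
        show "negligible (N \<union> (+) (- h) ` N \<union> {T - h})"
          using N by (intro negligible_Un negligible_translation) auto
        fix t assume t: "t \<in> {s..b}" "t \<notin> N \<union> (+) (- h) ` N \<union> {T - h}"
        have "t + h \<notin> N"
        proof
          assume "t + h \<in> N"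
          then have "- h + (t + h) \<in> (+) (- h) ` N" by (rule imageI)
          then show False using t by simp
        qed
        moreover have "integral {t..t+h} G = I (t + h) - I t" "integral {t..t+h} P = J (t + h) - J t"
          using integral_interval_diff(1)[OF GT, of t "t+h"] integral_interval_diff(1)[OF Pi, of t "t+h"] t s' h
          by (auto simp: I_def J_def)
        moreover have "t + h < T" using t s' by auto
        ultimately show "?L t \<le> ?R t"
          using st[of t h] t s' h by auto
      qed
      then have "h * (\<Phi> b - \<Phi> s) \<le> h * (3 * e - k * integral {s..b} \<Phi>)"
        using L R by (simp add: algebra_simps)
      then show ?thesis using h(1) by simp
    qed
    have "\<Phi> b \<le> 3 * e + \<Phi> a * exp (- k * (b - a))"
      by (rule Gronwall_backward[OF \<Phi>c k]) (use a main in auto)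
    moreover have "\<Phi> a \<le> M"
    proof -
      have "integral {a..a+h} G \<le> integral {a..a+h} (\<lambda>_. M)"
      proof (rule integral_le_negligible[OF _ _ bdd(1)])
        show "G integrable_on {a..a+h}" using integral_interval_diff(2)[OF GT, of a "a+h"] a h by (simp add: T_def)
      qed (use bdd(2) a h in auto)
      then show ?thesis
        using integral_interval_diff(1)[OF GT, of a "a+h"] a h by (simp add: \<Phi>_def I_def T_def field_simps)
    qed
    then have "\<Phi> a * exp (- k * (b - a)) \<le> M * exp (- k * (b - a))" by (intro mult_right_mono) auto
    moreover have "G b - e \<le> \<Phi> b"
    proof -
      have "integral {b..b+h} (\<lambda>_. G b - e) \<le> integral {b..b+h} G"
        using integral_interval_diff(2)[OF GT, of b "b+h"] b h \<eta>(2) by (intro integral_le) (auto simp: T_def)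
      then show ?thesis
        using integral_interval_diff(1)[OF GT, of b "b+h"] b h by (simp add: \<Phi>_def I_def T_def field_simps)
    qed
    ultimately show ?thesis by linarith
  qed
  have "G b \<le> M * exp (- k * (b - a))" if "0 < a" "a < b" "a < 1/2" for a
  proof (rule field_le_epsilon)
    fix e :: real assume "e > 0"
    then show "G b \<le> M * exp (- k * (b - a)) + e" using key[OF that, of "e / 4"] by simp
  qed
  then have ev: "\<forall>\<^sub>F a in at_right 0. G b \<le> M * exp (- k * (b - a))"
    using b by (intro eventually_at_rightI[of 0 "min b (1/2)"]) auto
  have "((\<lambda>a. M * exp (- k * (b - a))) \<longlongrightarrow> M * exp (- k * (b - 0))) (at_right 0)"
    by (intro tendsto_intros)
  from tendsto_lowerbound[OF this ev] show ?thesis by simp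
qed

section \<open>Weak derivatives in time and their primitives\<close>

definition plateau_deriv :: "real \<Rightarrow> real \<Rightarrow> real \<Rightarrow> real \<Rightarrow> real" where
  "plateau_deriv k a b x = k * (bump (k * (x - a) - 1) * smooth_step (k * (b - x) - 1)
     - smooth_step (k * (x - a) - 1) * bump (k * (b - x) - 1)) / integral {0..1} bump"

lemma plateau_has_derivative:
  "(plateau k a b has_real_derivative plateau_deriv k a b x) (at x)"
  unfolding plateau_def[abs_def] plateau_deriv_def
  by (auto intro!: derivative_eq_intros DERIV_chain2[OF smooth_step_has_derivative]
      simp: diff_divide_distrib right_diff_distrib mult_ac)

lemma plateau_deriv_continuous: "continuous_on A (plateau_deriv k a b)"
proof -
  have "deriv (plateau k a b) = plateau_deriv k a b"
    using DERIV_imp_deriv[OF plateau_has_derivative] by blast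
  then have "C_k 0 (plateau_deriv k a b)"
    using C_k_Suc_realD(2)[OF C_k_plateau[of "Suc 0" k a b]] by simp
  then show ?thesis using continuous_on_subset by auto
qed

text \<open>The condition on \<open>k\<close> separates the rising layer near \<open>a\<close> and
  the falling layer near \<open>b\<close> by the midpoint, so on the left half the second factor of
  the plateau is already 1.\<close>

lemma plateau_deriv_left:
  assumes "k * (b - a) \<ge> 4" "k > 0" "x \<le> (a + b) / 2"
  shows "0 \<le> plateau_deriv k a b x" "x \<ge> a + 2 / k \<Longrightarrow> plateau_deriv k a b x = 0"
proof -
  have "(b - a) / 2 \<le> b - x" using assms(3) by (simp add: field_simps)
  then have "k * ((b - a) / 2) \<le> k * (b - x)" by (rule mult_left_mono) (use assms in simp)
  moreover have "k * ((b - a) / 2) = k * (b - a) / 2" by simp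
  ultimately have "k * (b - x) - 1 \<ge> 1" using assms(1) by linarith
  then have *: "bump (k * (b - x) - 1) = 0" by (simp add: bump_eq_0)
  show "0 \<le> plateau_deriv k a b x"
    using assms bump_integral_pos bump_nonneg smooth_step_bounds
    by (auto simp: plateau_deriv_def * intro!: divide_nonneg_pos mult_nonneg_nonneg)
  assume "x \<ge> a + 2 / k"
  then have "k * (x - a) - 1 \<ge> 1" using assms(2) by (simp add: field_simps)
  then show "plateau_deriv k a b x = 0" by (simp add: plateau_deriv_def * bump_eq_0)
qed

lemma plateau_deriv_reflect: "plateau_deriv k a b (a + b - x) = - plateau_deriv k a b x"
proof -
  have "a + b - x - a = b - x" "b - (a + b - x) = x - a" by auto
  then show ?thesis
    unfolding plateau_deriv_def by (simp add: mult.commute minus_divide_left right_diff_distrib)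
qed

lemma plateau_deriv_outside:
  assumes "k > 0" "x \<le> a \<or> x \<ge> b" shows "plateau_deriv k a b x = 0"
proof (cases "x \<le> a")
  case True
  then have "k * (x - a) - 1 \<le> 0" using assms by (smt (verit) mult_nonneg_nonpos)
  then show ?thesis by (simp add: plateau_deriv_def bump_eq_0 smooth_step_0)
next
  case False
  then have "k * (b - x) - 1 \<le> 0" using assms by (smt (verit) mult_nonneg_nonpos)
  then show ?thesis by (simp add: plateau_deriv_def bump_eq_0 smooth_step_0)
qed

lemma plateau_midpoint:
  assumes "k * (b - a) \<ge> 4" "k > 0"
  shows "plateau k a b ((a + b) / 2) = 1"
  using assms by (intro plateau_eq_1) (auto simp: field_simps)

text \<open>On the left half the derivative of the plateau is an approximate identity at
  \<open>a\<close>: nonnegative, zero beyond distance 2/k, and of integral 1 because the plateau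
  rises from 0 to 1.\<close>

lemma integral_plateau_deriv_left:
  assumes g: "continuous_on {a..b} g" and ab: "a < b"
  shows "(\<lambda>n. integral {a..(a+b)/2} (\<lambda>x. g x * plateau_deriv (Suc n) a b x)) \<longlonglongrightarrow> g a"
proof (rule LIMSEQ_I)
  fix e :: real assume "e > 0"
  obtain d where d: "d > 0" "\<And>x. x \<in> {a..b} \<Longrightarrow> \<bar>x - a\<bar> < d \<Longrightarrow> \<bar>g x - g a\<bar> < e / 2"
    using g ab \<open>e > 0\<close> unfolding continuous_on_iff
    unfolding dist_real_def by (metis atLeastAtMost_iff half_gt_zero less_eq_real_def)
  \<comment> \<open>Above 2/d the layer lies where \<open>g\<close> is within e/2 of
    \<open>g a\<close>; above 4/(b - a) the two layers are separated.\<close>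
  obtain n0 where n0: "real n0 > max (2 / d) (4 / (b - a))" using reals_Archimedean2 by blast
  show "\<exists>no. \<forall>n\<ge>no. norm (integral {a..(a+b)/2} (\<lambda>x. g x * plateau_deriv (Suc n) a b x) - g a) < e"
  proof (intro exI allI impI)
    fix n assume "n \<ge> n0"
    define k where "k = real (Suc n)"
    have k: "k > 0" "k > 2 / d" "k > 4 / (b - a)" using n0 \<open>n \<ge> n0\<close> by (auto simp: k_def)
    then have k4: "k * (b - a) \<ge> 4" and kd: "2 / k < d" using ab d(1) by (auto simp: field_simps)
    let ?D = "plateau_deriv k a b" and ?m = "(a + b) / 2"
    have "(?D has_integral (plateau k a b ?m - plateau k a b a)) {a..?m}"
      using ab by (intro fundamental_theorem_of_calculus)
        (auto intro!: has_field_derivative_at_within plateau_has_derivative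
           simp: has_real_derivative_iff_has_vector_derivative[symmetric])
    then have D: "(?D has_integral 1) {a..?m}"
      using plateau_midpoint[OF k4 k(1)] plateau_eq_0[OF k(1), of a a b] k(1) by simp
    have gi: "(\<lambda>x. g x * ?D x) integrable_on {a..?m}"
      using ab by (intro integrable_continuous_interval continuous_intros plateau_deriv_continuous
          continuous_on_subset[OF g]) auto
    have ci: "(\<lambda>x. g a * ?D x) integrable_on {a..?m}"
      using D by (intro integrable_on_mult_right) (auto simp: has_integral_integrable)
    have "norm (integral {a..?m} (\<lambda>x. g x * ?D x - g a * ?D x)) \<le> integral {a..?m} (\<lambda>x. e / 2 * ?D x)"
    proof (rule Henstock_Kurzweil_Integration.integral_norm_bound_integral)
      show "(\<lambda>x. g x * ?D x - g a * ?D x) integrable_on {a..?m}" by (intro integrable_diff gi ci)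
      show "(\<lambda>x. e / 2 * ?D x) integrable_on {a..?m}"
        using D by (intro integrable_on_mult_right) (auto simp: has_integral_integrable)
      fix x assume x: "x \<in> {a..?m}"
      note pos = plateau_deriv_left[OF k4 k(1), of x]
      show "norm (g x * ?D x - g a * ?D x) \<le> e / 2 * ?D x"
      proof (cases "x \<ge> a + 2 / k")
        case True
        then show ?thesis using pos x by simp
      next
        case False
        then have "\<bar>g x - g a\<bar> \<le> e / 2" using d(2)[of x] x kd ab by auto
        then have "\<bar>g x - g a\<bar> * ?D x \<le> e / 2 * ?D x" using pos x by (intro mult_right_mono) auto
        then show ?thesis using pos x by (simp add: left_diff_distrib[symmetric] abs_mult)
      qed
    qed
    moreover have "integral {a..?m} (\<lambda>x. e / 2 * ?D x) = e / 2"
      "integral {a..?m} (\<lambda>x. g a * ?D x) = g a"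
      using integral_unique[OF D] by (auto simp del: times_divide_eq_left)
    ultimately show "norm (integral {a..?m} (\<lambda>x. g x * plateau_deriv (Suc n) a b x) - g a) < e"
      using \<open>e > 0\<close> by (simp add: integral_diff[OF gi ci] k_def[symmetric] del: of_nat_Suc)
  qed
qed

text \<open>The derivative of the plateau tends to the difference of the Dirac masses at
  \<open>a\<close> and \<open>b\<close>. It is odd under reflection about the midpoint, which
  reduces the right end to the left one.\<close>

lemma integral_plateau_deriv:
  assumes g: "continuous_on {a..b} g" and ab: "a < b"
  shows "(\<lambda>n. integral {a..b} (\<lambda>x. g x * plateau_deriv (Suc n) a b x)) \<longlonglongrightarrow> g a - g b"
proof -
  let ?m = "(a + b) / 2"
  let ?f = "\<lambda>n x. g x * plateau_deriv (Suc n) a b x"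
  define g' where "g' x = g (a + b - x)" for x
  have g': "continuous_on {a..b} g'"
    unfolding g'_def by (intro continuous_intros continuous_on_compose2[OF g]) auto
  have "integral {a..b} (?f n) = integral {a..?m} (?f n)
      - integral {a..?m} (\<lambda>x. g' x * plateau_deriv (Suc n) a b x)" for n
  proof -
    have fc: "continuous_on {a..b} (?f n)" by (intro continuous_intros g plateau_deriv_continuous)
    have "integral {a..b} (?f n) = integral {a..?m} (?f n) + integral {?m..b} (?f n)"
      using Henstock_Kurzweil_Integration.integral_combine[OF _ _ integrable_continuous_interval[OF fc], of ?m] ab by simp
    also have "integral {?m..b} (?f n) = integral {- b..- ?m} (\<lambda>x. ?f n (- x))"
      by (rule Henstock_Kurzweil_Integration.integral_reflect_real[symmetric])
    also have "\<dots> = integral {- b + (a + b)..- ?m + (a + b)} (\<lambda>x. ?f n (a + b - x))"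
      using integral_shift_Icc_real[of "- b" "- ?m" "\<lambda>x. ?f n (a + b - x)" "a + b"] by (simp add: o_def)
    also have "- b + (a + b) = a" by simp
    also have "- ?m + (a + b) = ?m" by (simp add: field_simps)
    also have "(\<lambda>x. ?f n (a + b - x)) = (\<lambda>x. - (g' x * plateau_deriv (Suc n) a b x))"
      by (simp add: g'_def plateau_deriv_reflect del: of_nat_Suc)
    finally show ?thesis by simp
  qed
  moreover have "(\<lambda>n. integral {a..?m} (?f n) - integral {a..?m} (\<lambda>x. g' x * plateau_deriv (Suc n) a b x))
      \<longlonglongrightarrow> g a - g' a"
    by (intro tendsto_diff integral_plateau_deriv_left g g' ab)
  ultimately show ?thesis by (simp add: g'_def)
qed

text \<open>Plateaus over the interval from \<open>s\<close> to \<open>t\<close> tend to its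
  indicator and their derivatives to a difference of Dirac masses, so the weak identity becomes the
  fundamental theorem, at every pair of times thanks to the continuity of \<open>g\<close>.\<close>

lemma du_Bois_Reymond:
  fixes g h :: "real \<Rightarrow> real"
  assumes g: "continuous_on {0..} g" and h: "integrable (lebesgue_on {0<..<T}) h"
    and weak: "\<And>\<psi>. test_function {0<..<T} \<psi> \<Longrightarrow>
      (\<integral>t. g t * deriv \<psi> t \<partial>lebesgue_on {0<..<T}) = - (\<integral>t. h t * \<psi> t \<partial>lebesgue_on {0<..<T})"
    and st: "0 < s" "s \<le> t" "t < T"
  shows "g t - g s = integral {s..t} h"
proof (cases "s = t")
  case False
  define \<psi> where "\<psi> n = plateau (Suc n) s t" for n
  have test: "test_function {0<..<T} (\<psi> n)" for n
    unfolding \<psi>_def using st by (intro test_function_plateau) auto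
  have d: "deriv (\<psi> n) x = plateau_deriv (Suc n) s t x" for n x
    unfolding \<psi>_def by (rule DERIV_imp_deriv[OF plateau_has_derivative])
  have "(\<integral>x. g x * deriv (\<psi> n) x \<partial>lebesgue_on {0<..<T}) = integral {s..t} (\<lambda>x. g x * plateau_deriv (Suc n) s t x)" for n
  proof -
    let ?f = "\<lambda>x. g x * plateau_deriv (Suc n) s t x"
    have c: "continuous_on {0..T} ?f"
      by (intro continuous_intros plateau_deriv_continuous continuous_on_subset[OF g]) auto
    have "integrable (lebesgue_on {0..T}) ?f"
      by (rule absolutely_integrable_imp_integrable[OF absolutely_integrable_continuous_real[OF c]]) simp
    then have "integrable (lebesgue_on {0<..<T}) ?f"
      by (rule integrable_lebesgue_on_subset) auto
    then have "(\<integral>x. ?f x \<partial>lebesgue_on {0<..<T}) = integral {0..T} ?f"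
      by (rule integrable_on_from_open(2)[symmetric])
    also have "\<dots> = integral {s..t} ?f"
    proof (rule integral_unique[OF has_integral_on_superset])
      show "(?f has_integral integral {s..t} ?f) {s..t}"
        by (intro integrable_integral integrable_continuous_interval continuous_on_subset[OF c]) (use st in auto)
      show "?f x = 0" if "x \<notin> {s..t}" for x
        using that plateau_deriv_outside[of "real (Suc n)" x s t] by (auto simp del: of_nat_Suc)
    qed (use st in auto)
    finally show ?thesis by (simp add: d)
  qed
  then have "(\<lambda>n. \<integral>x. g x * deriv (\<psi> n) x \<partial>lebesgue_on {0<..<T}) \<longlonglongrightarrow> g s - g t"
    using integral_plateau_deriv[of s t g] False st continuous_on_subset[OF g, of "{s..t}"] by auto
  moreover have "(\<lambda>n. \<integral>x. h x * \<psi> n x \<partial>lebesgue_on {0<..<T}) \<longlonglongrightarrow> (\<integral>x. h x * indicator {s<..<t} x \<partial>lebesgue_on {0<..<T})"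
  proof (rule integral_dominated_convergence)
    have [measurable]: "h \<in> borel_measurable (lebesgue_on {0<..<T})" using h by simp
    have [measurable]: "\<psi> n \<in> borel_measurable (lebesgue_on {0<..<T})" for n
      by (rule test_function_measurable[OF test])
    have [measurable]: "(indicator {s<..<t} :: real \<Rightarrow> real) \<in> borel_measurable (lebesgue_on {0<..<T})"
      by (intro measurable_restrict_space1 borel_measurable_indicator) simp
    show "(\<lambda>x. h x * indicator {s<..<t} x) \<in> borel_measurable (lebesgue_on {0<..<T})"
      "\<And>n. (\<lambda>x. h x * \<psi> n x) \<in> borel_measurable (lebesgue_on {0<..<T})" by measurable
    show "integrable (lebesgue_on {0<..<T}) (\<lambda>x. \<bar>h x\<bar>)" using h by simp
    show "AE x in lebesgue_on {0<..<T}. (\<lambda>n. h x * \<psi> n x) \<longlonglongrightarrow> h x * indicator {s<..<t} x"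
      unfolding \<psi>_def by (intro AE_I2 tendsto_intros plateau_tendsto)
    show "AE x in lebesgue_on {0<..<T}. norm (h x * \<psi> n x) \<le> \<bar>h x\<bar>" for n
      using plateau_bounds by (intro AE_I2) (auto simp: abs_mult \<psi>_def intro!: mult_left_le)
  qed
  then have "(\<lambda>n. \<integral>x. g x * deriv (\<psi> n) x \<partial>lebesgue_on {0<..<T})
      \<longlonglongrightarrow> - (\<integral>x. h x * indicator {s<..<t} x \<partial>lebesgue_on {0<..<T})"
    using weak[OF test] by (simp add: tendsto_minus)
  ultimately have "g s - g t = - (\<integral>x. h x * indicator {s<..<t} x \<partial>lebesgue_on {0<..<T})"
    by (rule LIMSEQ_unique)
  also have "(\<integral>x. h x * indicator {s<..<t} x \<partial>lebesgue_on {0<..<T}) = (\<integral>x. h x \<partial>lebesgue_on {s<..<t})"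
  proof -
    have "(\<integral>x. h x * indicator {s<..<t} x \<partial>lebesgue_on {0<..<T}) = (\<integral>x. indicator {0<..<T} x *\<^sub>R (h x * indicator {s<..<t} x) \<partial>lebesgue)"
      by (rule integral_restrict_space) simp
    also have "\<dots> = (\<integral>x. indicator {s<..<t} x *\<^sub>R h x \<partial>lebesgue)"
      using st by (intro Bochner_Integration.integral_cong) (auto simp: indicator_def)
    also have "\<dots> = (\<integral>x. h x \<partial>lebesgue_on {s<..<t})"
      by (rule integral_restrict_space[symmetric]) simp
    finally show ?thesis .
  qed
  also have "\<dots> = integral {s..t} h"
  proof -
    have "integrable (lebesgue_on {s<..<t}) h" by (rule integrable_lebesgue_on_subset[OF h]) (use st in auto)
    then show ?thesis
      by (subst lebesgue_integral_eq_integral) (auto simp: integral_open_interval_real)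
  qed
  finally show ?thesis by simp
qed simp

section \<open>Bochner spaces\<close>

lemma borel_measurable_lebesgue_on_AE:
  fixes f g :: "'a::euclidean_space \<Rightarrow> real"
  assumes f: "f \<in> borel_measurable (lebesgue_on S)" and ae: "AE x in lebesgue_on S. f x = g x"
    and S: "S \<in> sets lebesgue"
  shows "g \<in> borel_measurable (lebesgue_on S)"
proof -
  have "(\<lambda>x. if x \<in> S then f x else 0) \<in> borel_measurable lebesgue"
    using f S by (simp add: borel_measurable_if)
  moreover have "AE x in lebesgue. (if x \<in> S then f x else 0) = (if x \<in> S then g x else 0)"
    using ae S by (subst (asm) AE_restrict_space_iff) (auto elim: eventually_mono)
  ultimately have "(\<lambda>x. if x \<in> S then g x else 0) \<in> borel_measurable lebesgue"
    by (rule borel_measurable_AE)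
  then show ?thesis using S by (simp add: borel_measurable_if)
qed

text \<open>The limit agrees almost everywhere with the measurable function \<open>lim\<close>, and
  completeness of Lebesgue measure disposes of the exceptional set.\<close>

lemma borel_measurable_lebesgue_on_AE_limit:
  fixes f :: "'a::euclidean_space \<Rightarrow> real"
  assumes s: "\<And>k::nat. s k \<in> borel_measurable (lebesgue_on S)"
    and lim: "AE x in lebesgue_on S. (\<lambda>k. s k x) \<longlonglongrightarrow> f x" and S: "S \<in> sets lebesgue"
  shows "f \<in> borel_measurable (lebesgue_on S)"
proof (rule borel_measurable_lebesgue_on_AE[OF _ _ S])
  show "(\<lambda>x. lim (\<lambda>k. s k x)) \<in> borel_measurable (lebesgue_on S)"
    using s by (rule borel_measurable_lim_metric)
  show "AE x in lebesgue_on S. lim (\<lambda>k. s k x) = f x"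
    using lim by eventually_elim (rule limI)
qed

text \<open>Preimages are finite unions of level sets, so an arbitrary functional \<open>F\<close>
  of a simple function is measurable.\<close>

lemma finite_valued_measurable:
  fixes F :: "'b \<Rightarrow> real" and I :: "real set"
  assumes fin: "finite (s ` I)" and sets: "\<And>y. {t \<in> I. s t = y} \<in> sets lebesgue" and I: "I \<in> sets lebesgue"
  shows "(\<lambda>t. F (s t)) \<in> borel_measurable (lebesgue_on I)"
proof (rule measurableI)
  fix A :: "real set" assume "A \<in> sets borel"
  have "(\<lambda>t. F (s t)) -` A \<inter> I = (\<Union>y\<in>{y\<in>s ` I. F y \<in> A}. {t \<in> I. s t = y})" by auto
  also have "\<dots> \<in> sets lebesgue" using fin sets by (intro sets.finite_UN) auto
  finally show "(\<lambda>t. F (s t)) -` A \<inter> space (lebesgue_on I) \<in> sets (lebesgue_on I)"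
    using I by (auto simp: sets_restrict_space_iff)
qed simp

text \<open>The claim is clear for the simple approximants, and the triangle inequality bounds the
  error by N(u - s). The rules for \<open>N\<close> are hypotheses relative to \<open>X\<close>
  because the type of values carries only a subtraction.\<close>

lemma strongly_measurable_norm_diff:
  fixes N :: "'b::minus \<Rightarrow> real"
  assumes u: "strongly_measurable T X N u" and y: "y \<in> X"
    and tri: "\<And>a b c. a \<in> X \<Longrightarrow> b \<in> X \<Longrightarrow> c \<in> X \<Longrightarrow> N (a - c) \<le> N (a - b) + N (b - c)"
    and sym: "\<And>a b. a \<in> X \<Longrightarrow> b \<in> X \<Longrightarrow> N (a - b) = N (b - a)"
  shows "(\<lambda>t. N (u t - y)) \<in> borel_measurable (lebesgue_on {0<..<T})"
proof -
  obtain s where uX: "AE t in lebesgue_on {0<..<T}. u t \<in> X"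
    and s: "\<And>k::nat. finite (s k ` {0<..<T})" "\<And>k. s k ` {0<..<T} \<subseteq> X"
        "\<And>k y. {t \<in> {0<..<T}. s k t = y} \<in> sets lebesgue"
    and lim: "AE t in lebesgue_on {0<..<T}. (\<lambda>k. N (u t - s k t)) \<longlonglongrightarrow> 0"
    using u unfolding strongly_measurable_def by blast
  show ?thesis
  proof (rule borel_measurable_lebesgue_on_AE_limit)
    show "(\<lambda>t. N (s k t - y)) \<in> borel_measurable (lebesgue_on {0<..<T})" for k
      using s by (intro finite_valued_measurable[of "s k" _ "\<lambda>z. N (z - y)"]) auto
    show "AE t in lebesgue_on {0<..<T}. (\<lambda>k. N (s k t - y)) \<longlonglongrightarrow> N (u t - y)"
      using uX lim AE_space
    proof eventually_elim
      case (elim t)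
      have sk: "s k t \<in> X" for k using s(2)[of k] elim(3) by (auto simp: space_restrict_space)
      have "\<bar>N (s k t - y) - N (u t - y)\<bar> \<le> N (u t - s k t)" for k
        using tri[OF sk elim(1) y, of k] tri[OF elim(1) sk y, of k] sym[OF sk elim(1), of k] by linarith
      then have "(\<lambda>k. N (s k t - y) - N (u t - y)) \<longlonglongrightarrow> 0"
        by (intro Lim_null_comparison[OF _ elim(2)]) auto
      then show ?case by (simp add: LIM_zero_iff)
    qed
  qed simp
qed

lemma borel_measurable_from_square:
  fixes f :: "'a \<Rightarrow> real"
  assumes "(\<lambda>t. (f t)\<^sup>2) \<in> borel_measurable M" "\<And>t. f t \<ge> 0"
  shows "f \<in> borel_measurable M"
proof -
  have "(\<lambda>t. sqrt ((f t)\<^sup>2)) \<in> borel_measurable M" using assms(1) by measurable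
  then show ?thesis using assms(2) by simp
qed

text \<open>Regularity gives K \<subseteq> A \<subseteq> U with K compact and U open. A point of K
  and a point outside U have distance at least d, so of two closer points on different sides of
  \<open>A\<close> one lies in the thin sets A - K or U - A.\<close>

lemma compact_open_gap:
  fixes A :: "real set"
  assumes A: "A \<in> sets lebesgue" "bounded A" and e: "e > 0"
  obtains W d where "W \<in> lmeasurable" "measure lebesgue W < e" "d > 0"
    "\<And>r t. r \<in> A \<Longrightarrow> t \<notin> A \<Longrightarrow> \<bar>r - t\<bar> < d \<Longrightarrow> r \<in> W \<or> t \<in> W"
proof -
  obtain U where U: "open U" "A \<subseteq> U" "U - A \<in> lmeasurable" "emeasure lebesgue (U - A) < ennreal (e / 2)"
    using sets_lebesgue_outer_open[OF A(1), of "e / 2"] e by auto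
  obtain K where K: "closed K" "K \<subseteq> A" "A - K \<in> lmeasurable" "emeasure lebesgue (A - K) < ennreal (e / 2)"
    using sets_lebesgue_inner_closed[OF A(1), of "e / 2"] e by auto
  have "compact K" using K A(2) bounded_subset by (auto simp: compact_eq_bounded_closed)
  then obtain d where d: "d > 0" "\<And>x y. x \<in> K \<Longrightarrow> y \<in> - U \<Longrightarrow> d \<le> dist x y"
    using separate_compact_closed[of K "- U"] U K by blast
  show ?thesis
  proof (rule that[of "(U - A) \<union> (A - K)" d])
    show "(U - A) \<union> (A - K) \<in> lmeasurable" using U K by (intro fmeasurable.Un)
    have "measure lebesgue (U - A) < e / 2" "measure lebesgue (A - K) < e / 2"
      using U(4) K(4) emeasure_eq_measure2[OF U(3)] emeasure_eq_measure2[OF K(3)] by (auto simp: ennreal_less_iff)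
    then show "measure lebesgue ((U - A) \<union> (A - K)) < e"
      using measure_Un_le[of "U - A" lebesgue "A - K"] U(3) K(3) by (auto dest!: fmeasurableD)
    show "r \<in> (U - A) \<union> (A - K) \<or> t \<in> (U - A) \<union> (A - K)"
      if "r \<in> A" "t \<notin> A" "\<bar>r - t\<bar> < d" for r t
      using that d(2)[of r t] U(2) by (auto simp: dist_real_def)
  qed (rule d(1))
qed

text \<open>Approximating \<open>u\<close> by a simple function with values on sets \<open>A\<close>, and these by compact sets from
  inside and open sets from outside, shows that translation is continuous in \<open>L\<^sup>2(0,T;X)\<close>, in a form
  which needs no joint measurability.\<close>

lemma bochner_L2_translation:
  fixes N :: "'b::minus \<Rightarrow> real"
  assumes u: "bochner_L2 T X N u" and T: "T > 0" and e: "e > 0"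
    and tri: "\<And>a b c. a \<in> X \<Longrightarrow> b \<in> X \<Longrightarrow> c \<in> X \<Longrightarrow> N (a - c) \<le> N (a - b) + N (b - c)"
    and sym: "\<And>a b. a \<in> X \<Longrightarrow> b \<in> X \<Longrightarrow> N (a - b) = N (b - a)"
    and N0: "\<And>a. N a \<ge> 0" and Nself: "\<And>a. a \<in> X \<Longrightarrow> N (a - a) = 0"
    and z: "z \<in> X" "\<And>a. a \<in> X \<Longrightarrow> N (a - z) = N a"
  obtains \<delta> \<alpha> where "\<delta> > 0" "\<And>t. \<alpha> t \<ge> 0" "integrable (lebesgue_on {0<..<T}) (\<lambda>t. (\<alpha> t)\<^sup>2)"
    "(\<integral>t. (\<alpha> t)\<^sup>2 \<partial>lebesgue_on {0<..<T}) < e"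
    "\<And>r t. r \<in> {0<..<T} \<Longrightarrow> t \<in> {0<..<T} \<Longrightarrow> u r \<in> X \<Longrightarrow> u t \<in> X \<Longrightarrow> \<bar>r - t\<bar> < \<delta> \<Longrightarrow>
       N (u r - u t) \<le> \<alpha> r + \<alpha> t"
proof -
  let ?I = "{0<..<T}" and ?M = "lebesgue_on {0<..<T}"
  have sm: "strongly_measurable T X N u" and int: "integrable ?M (\<lambda>t. (N (u t))\<^sup>2)"
    using u by (auto simp: bochner_L2_def)
  obtain s where uX: "AE t in ?M. u t \<in> X"
    and s: "\<And>k::nat. finite (s k ` ?I)" "\<And>k. s k ` ?I \<subseteq> X" "\<And>k y. {t \<in> ?I. s k t = y} \<in> sets lebesgue"
    and lim: "AE t in ?M. (\<lambda>k. N (u t - s k t)) \<longlonglongrightarrow> 0"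
    using sm unfolding strongly_measurable_def by blast
  have Nu [measurable]: "(\<lambda>t. N (u t)) \<in> borel_measurable ?M"
    using borel_measurable_integrable[OF int] N0 by (rule borel_measurable_from_square)
  \<comment> \<open>Truncation: where the approximant exceeds twice the size of \<open>u\<close> it
    is replaced by the zero element \<open>z\<close>. This gives the majorant 3 N(u) for dominated
    convergence and does not disturb the limit, because good approximants pass the test.\<close>
  define v where "v k t = (if N (s k t) \<le> 2 * N (u t) then s k t else z)" for k t
  have vX: "v k t \<in> X" if "t \<in> ?I" for k t using s(2)[of k] z that by (auto simp: v_def)
  have vsub: "v k ` ?I \<subseteq> insert z (s k ` ?I)" for k by (auto simp: v_def)
  have vfin: "finite (v k ` ?I)" for k by (rule finite_subset[OF vsub]) (use s(1) in simp)
  have vset: "{t \<in> ?I. v k t = y} \<in> sets lebesgue" for k y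
  proof -
    have Ns: "(\<lambda>t. N (s k t)) \<in> borel_measurable ?M"
      by (rule finite_valued_measurable[OF s(1) s(3)]) simp
    have "{t \<in> space ?M. N (s k t) \<le> 2 * N (u t)} \<in> sets ?M"
      using Ns Nu by measurable
    then have 1: "{t \<in> ?I. N (s k t) \<le> 2 * N (u t)} \<in> sets lebesgue"
      by (simp add: sets_restrict_space_iff)
    have "{t \<in> ?I. v k t = y} = ({t \<in> ?I. s k t = y} \<inter> {t \<in> ?I. N (s k t) \<le> 2 * N (u t)})
        \<union> (if y = z then ?I - {t \<in> ?I. N (s k t) \<le> 2 * N (u t)} else {})"
      by (auto simp: v_def)
    also have "\<dots> \<in> sets lebesgue"
    proof -
      have "(A \<inter> B) \<union> (if y = z then J - B else {}) \<in> sets lebesgue"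
        if "A \<in> sets lebesgue" "B \<in> sets lebesgue" "J \<in> sets lebesgue" for A B J :: "real set"
        using that by auto
      from this[OF s(3) 1] show ?thesis by simp
    qed
    finally show ?thesis .
  qed
  have a_meas [measurable]: "(\<lambda>t. N (u t - v k t)) \<in> borel_measurable ?M" for k
  proof (rule borel_measurable_lebesgue_on_AE)
    \<comment> \<open>Splitting by the finitely many values reduces measurability to distances from
      a fixed element of \<open>X\<close>.\<close>
    show "(\<lambda>t. \<Sum>y\<in>v k ` ?I. N (u t - y) * (if v k t = y then 1 else 0)) \<in> borel_measurable ?M"
    proof (intro borel_measurable_sum borel_measurable_times)
      fix y assume "y \<in> v k ` ?I"
      then have "y \<in> X" using vX by auto
      then show "(\<lambda>t. N (u t - y)) \<in> borel_measurable ?M"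
        by (rule strongly_measurable_norm_diff[OF sm _ tri sym])
      show "(\<lambda>t. if v k t = y then 1 else 0 :: real) \<in> borel_measurable ?M"
        by (rule finite_valued_measurable[where s = "v k" and F = "\<lambda>x. if x = y then 1 else 0", OF vfin vset]) simp
    qed
    show "AE t in ?M. (\<Sum>y\<in>v k ` ?I. N (u t - y) * (if v k t = y then 1 else 0)) = N (u t - v k t)"
      using vfin by (intro AE_I2) (simp add: sum.delta' if_distrib cong: if_cong)
  qed simp
  have bnd: "N (u t - v k t) \<le> 3 * N (u t)" if "u t \<in> X" "t \<in> ?I" for k t
  proof -
    have "N (u t - v k t) \<le> N (u t - z) + N (z - v k t)" using tri[OF that(1) z(1) vX[OF that(2)]] .
    moreover have "N (z - v k t) = N (v k t)" using sym[OF z(1) vX[OF that(2)]] z(2)[OF vX[OF that(2)]] by simp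
    moreover have "N (v k t) \<le> 2 * N (u t)"
      using N0[of "u t"] z(2)[OF z(1)] Nself[OF z(1)] by (auto simp: v_def)
    ultimately show ?thesis using z(2)[OF that(1)] by simp
  qed
  have "(\<lambda>k. \<integral>t. (N (u t - v k t))\<^sup>2 \<partial>?M) \<longlonglongrightarrow> (\<integral>t. 0 \<partial>?M)"
  proof (rule integral_dominated_convergence)
    show "integrable ?M (\<lambda>t. 9 * (N (u t))\<^sup>2)" using int by simp
    show "AE t in ?M. (\<lambda>k. (N (u t - v k t))\<^sup>2) \<longlonglongrightarrow> 0"
      using uX lim AE_space
    proof eventually_elim
      case (elim t)
      then have t: "t \<in> ?I" by (simp add: space_restrict_space)
      have sX: "s k t \<in> X" for k using s(2)[of k] t by auto
      have "(\<lambda>k. N (u t - v k t)) \<longlonglongrightarrow> 0"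
      proof (cases "N (u t) = 0")
        case True
        then have "N (u t - v k t) = 0" for k using bnd[OF elim(1) t, of k] N0[of "u t - v k t"] by simp
        then show ?thesis by simp
      next
        case False
        then have "\<forall>\<^sub>F k in sequentially. N (u t - s k t) < N (u t)"
          using N0[of "u t"] by (intro order_tendstoD(2)[OF elim(2)]) auto
        then have "\<forall>\<^sub>F k in sequentially. N (u t - s k t) = N (u t - v k t)"
        proof eventually_elim
          case (elim k)
          have "N (s k t) \<le> N (s k t - u t) + N (u t)"
            using tri[OF sX \<open>u t \<in> X\<close> z(1), of k] z(2)[OF sX, of k] z(2)[OF \<open>u t \<in> X\<close>] by simp
          then have "N (s k t) \<le> 2 * N (u t)" using elim sym[OF sX \<open>u t \<in> X\<close>, of k] by simp
          then show ?case by (simp add: v_def)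
        qed
        then show ?thesis by (rule Lim_transform_eventually[OF elim(2)])
      qed
      from tendsto_power[OF this, of 2] show ?case by simp
    qed
    show "AE t in ?M. norm ((N (u t - v k t))\<^sup>2) \<le> 9 * (N (u t))\<^sup>2" for k
      using uX AE_space
    proof eventually_elim
      case (elim t)
      then have "(N (u t - v k t))\<^sup>2 \<le> (3 * N (u t))\<^sup>2"
        by (intro power_mono bnd N0) (auto simp: space_restrict_space)
      then show ?case by (simp add: power_mult_distrib)
    qed
  qed auto
  then have "\<forall>\<^sub>F k in sequentially. (\<integral>t. (N (u t - v k t))\<^sup>2 \<partial>?M) < e / 4"
    using e by (intro order_tendstoD(2)) auto
  then obtain k where k: "(\<integral>t. (N (u t - v k t))\<^sup>2 \<partial>?M) < e / 4" by (auto simp: eventually_sequentially)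
  define w where "w = v k"
  define Y where "Y = w ` ?I"
  have Y: "finite Y" "Y \<subseteq> X" using vfin vX by (auto simp: Y_def w_def)
  define \<alpha>0 where "\<alpha>0 t = N (u t - w t)" for t
  have \<alpha>0i: "integrable ?M (\<lambda>t. (\<alpha>0 t)\<^sup>2)"
  proof (rule Bochner_Integration.integrable_bound)
    show "integrable ?M (\<lambda>t. 9 * (N (u t))\<^sup>2)" using int by simp
    show "AE t in ?M. norm ((\<alpha>0 t)\<^sup>2) \<le> norm (9 * (N (u t))\<^sup>2)"
      using uX AE_space
    proof eventually_elim
      case (elim t)
      then have "(\<alpha>0 t)\<^sup>2 \<le> (3 * N (u t))\<^sup>2"
        unfolding \<alpha>0_def w_def by (intro power_mono bnd N0) (auto simp: space_restrict_space)
      then show ?case by (simp add: power_mult_distrib)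
    qed
  qed (use a_meas[of k] in \<open>auto simp: \<alpha>0_def w_def\<close>)
  define C where "C = (\<Sum>y\<in>Y. \<Sum>y'\<in>Y. N (y - y'))"
  have C: "N (y - y') \<le> C" if "y \<in> Y" "y' \<in> Y" for y y'
  proof -
    have "N (y - y') \<le> (\<Sum>y'\<in>Y. N (y - y'))"
      using that Y N0 by (intro member_le_sum) auto
    also have "\<dots> \<le> C" unfolding C_def
      using that Y N0 by (intro member_le_sum[of y Y "\<lambda>y. \<Sum>y'\<in>Y. N (y - y')"] sum_nonneg) auto
    finally show ?thesis .
  qed
  have C0: "C \<ge> 0" unfolding C_def by (intro sum_nonneg N0)
  \<comment> \<open>Chosen so that the exceptional set \<open>V\<close>, a union of at most
    \<open>card Y\<close> sets of measure below \<open>\<eta>\<close>, contributes at most e/2 to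
    the integral of \<alpha>^2; each +1 excludes a zero denominator. The approximation error
    contributes less than 2 (e/4).\<close>
  define \<eta> where "\<eta> = e / (4 * (C\<^sup>2 + 1) * (real (card Y) + 1))"
  have \<eta>: "\<eta> > 0" using e by (auto simp: \<eta>_def intro!: divide_pos_pos mult_pos_pos add_nonneg_pos)
  define sep where "sep y W d \<longleftrightarrow> W \<in> lmeasurable \<and> measure lebesgue W < \<eta> \<and> d > 0 \<and>
      (\<forall>r t. r \<in> {t \<in> ?I. w t = y} \<longrightarrow> t \<notin> {t \<in> ?I. w t = y} \<longrightarrow> \<bar>r - t\<bar> < d \<longrightarrow> r \<in> W \<or> t \<in> W)"
    for y and W :: "real set" and d :: real
  have "\<forall>y. \<exists>W d. sep y W d"
  proof
    fix y
    show "\<exists>W d. sep y W d"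
    proof (rule compact_open_gap[OF _ _ \<eta>])
      show "{t \<in> ?I. w t = y} \<in> sets lebesgue" using vset by (simp add: w_def)
      show "bounded {t \<in> ?I. w t = y}" by (rule bounded_subset[of ?I]) auto
    qed (unfold sep_def, blast)
  qed
  then obtain W where "\<forall>y. \<exists>d. sep y (W y) d" by (rule choice[THEN exE])
  then obtain d where "\<forall>y. sep y (W y) (d y)" by (rule choice[THEN exE])
  then have W: "\<And>y. W y \<in> lmeasurable" "\<And>y. measure lebesgue (W y) < \<eta>" and d: "\<And>y. d y > 0"
    and gap: "\<And>y r t. r \<in> {t \<in> ?I. w t = y} \<Longrightarrow> t \<notin> {t \<in> ?I. w t = y} \<Longrightarrow> \<bar>r - t\<bar> < d y \<Longrightarrow> r \<in> W y \<or> t \<in> W y"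
    unfolding sep_def by blast+
  define V where "V = (\<Union>y\<in>Y. W y)"
  have V: "V \<in> lmeasurable" using Y W by (auto simp: V_def intro!: fmeasurable.finite_UN)
  have "measure lebesgue V \<le> (\<Sum>y\<in>Y. measure lebesgue (W y))"
    unfolding V_def using Y W by (intro measure_UNION_le) (auto dest: fmeasurableD)
  also have "\<dots> \<le> (\<Sum>y\<in>Y. \<eta>)" by (intro sum_mono less_imp_le W)
  finally have mV: "measure lebesgue V \<le> card Y * \<eta>" by simp
  define \<delta> where "\<delta> = Min (insert 1 (d ` Y))"
  have \<delta>: "\<delta> > 0" "\<And>y. y \<in> Y \<Longrightarrow> \<delta> \<le> d y" using Y d by (auto simp: \<delta>_def)
  \<comment> \<open>Two values of the simple function differ by at most \<open>C\<close>, and at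
    close times they differ only if one of the times lies in \<open>V\<close>.\<close>
  define \<alpha> where "\<alpha> t = \<alpha>0 t + C * indicator V t" for t
  have [measurable]: "\<alpha>0 \<in> borel_measurable ?M" using a_meas[of k] by (simp add: \<alpha>0_def[abs_def] w_def)
  have indV [measurable]: "(indicator V :: real \<Rightarrow> real) \<in> borel_measurable ?M"
    by (intro measurable_restrict_space1 borel_measurable_indicator fmeasurableD V)
  have indVi: "integrable ?M (indicator V :: real \<Rightarrow> real)"
  proof (rule integrable_lebesgue_on_subset[of UNIV])
    show "integrable (lebesgue_on UNIV) (indicator V :: real \<Rightarrow> real)"
      unfolding lebesgue_on_UNIV_eq
      using fmeasurableD[OF V] fmeasurableD2[OF V] by (intro integrable_real_indicator) (simp_all add: top.not_eq_extremum)
  qed simp_all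
  have ub: "(\<alpha> t)\<^sup>2 \<le> 2 * (\<alpha>0 t)\<^sup>2 + 2 * C\<^sup>2 * indicator V t" for t
  proof -
    have "(a + b)\<^sup>2 \<le> 2 * a\<^sup>2 + 2 * b\<^sup>2" for a b :: real
      using sum_squares_bound[of a b] by (simp add: power2_sum)
    from this[of "\<alpha>0 t" "C * indicator V t"] show ?thesis
      by (cases "t \<in> V") (simp_all add: \<alpha>_def power_mult_distrib)
  qed
  have ubi: "integrable ?M (\<lambda>t. 2 * (\<alpha>0 t)\<^sup>2 + 2 * C\<^sup>2 * indicator V t)" using \<alpha>0i indVi by simp
  have \<alpha>i: "integrable ?M (\<lambda>t. (\<alpha> t)\<^sup>2)"
  proof (rule Bochner_Integration.integrable_bound[OF ubi])
    show "(\<lambda>t. (\<alpha> t)\<^sup>2) \<in> borel_measurable ?M" unfolding \<alpha>_def by measurable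
    show "AE t in ?M. norm ((\<alpha> t)\<^sup>2) \<le> norm (2 * (\<alpha>0 t)\<^sup>2 + 2 * C\<^sup>2 * indicator V t)"
    proof (rule AE_I2)
      fix t show "norm ((\<alpha> t)\<^sup>2) \<le> norm (2 * (\<alpha>0 t)\<^sup>2 + 2 * C\<^sup>2 * indicator V t)"
        using order_trans[OF ub[of t] abs_ge_self] by simp
    qed
  qed
  have "(\<integral>t. indicator V t \<partial>?M) \<le> measure lebesgue V"
  proof -
    have "(\<integral>t. indicator V t \<partial>?M) = measure ?M (V \<inter> ?I)" by simp
    also have "\<dots> = measure lebesgue (V \<inter> ?I)" by (rule measure_restrict_space) auto
    also have "\<dots> \<le> measure lebesgue V" using V by (intro measure_mono_fmeasurable) auto
    finally show ?thesis .
  qed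
  then have iV: "2 * C\<^sup>2 * (\<integral>t. indicator V t \<partial>?M) \<le> 2 * C\<^sup>2 * (card Y * \<eta>)"
    using mV by (intro mult_left_mono) auto
  have "2 * C\<^sup>2 * (card Y * \<eta>) \<le> 2 * (C\<^sup>2 + 1) * ((card Y + 1) * \<eta>)"
    using \<eta> by (intro mult_mono mult_right_mono) auto
  also have "\<dots> = e / 2"
  proof -
    have "2 * A * (B * (e / (4 * A * B))) = e / 2" if "A > 0" "B > 0" for A B :: real
      using that by (simp add: field_simps)
    from this[of "C\<^sup>2 + 1" "real (card Y) + 1"] have "2 * (C\<^sup>2 + 1) * ((real (card Y) + 1) * \<eta>) = e / 2"
      unfolding \<eta>_def by (simp only: add_nonneg_pos zero_le_power2 of_nat_0_le_iff zero_less_one)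
    then show ?thesis by (simp only: of_nat_add of_nat_1)
  qed
  finally have "2 * C\<^sup>2 * (card Y * \<eta>) \<le> e / 2" .
  moreover have "(\<integral>t. (\<alpha> t)\<^sup>2 \<partial>?M) \<le> (\<integral>t. 2 * (\<alpha>0 t)\<^sup>2 + 2 * C\<^sup>2 * indicator V t \<partial>?M)"
    using \<alpha>i ubi ub by (intro integral_mono) auto
  moreover have "\<dots> = 2 * (\<integral>t. (\<alpha>0 t)\<^sup>2 \<partial>?M) + 2 * C\<^sup>2 * (\<integral>t. indicator V t \<partial>?M)"
    using \<alpha>0i indVi by simp
  moreover have "(\<integral>t. (\<alpha>0 t)\<^sup>2 \<partial>?M) < e / 4" using k by (simp add: \<alpha>0_def w_def)
  ultimately have \<alpha>e: "(\<integral>t. (\<alpha> t)\<^sup>2 \<partial>?M) < e" using iV by linarith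
  have \<alpha>0: "\<alpha> t \<ge> 0" for t using N0 C0 by (auto simp: \<alpha>_def \<alpha>0_def)
  show ?thesis
  proof (rule that[OF \<delta>(1) \<alpha>0 \<alpha>i \<alpha>e])
    fix r t assume rt: "r \<in> ?I" "t \<in> ?I" "u r \<in> X" "u t \<in> X" "\<bar>r - t\<bar> < \<delta>"
    have w: "w r \<in> Y" "w t \<in> Y" "w r \<in> X" "w t \<in> X" using rt Y by (auto simp: Y_def)
    have "N (u r - u t) \<le> N (u r - w r) + (N (w r - w t) + N (w t - u t))"
      using tri[OF rt(3) w(3) rt(4)] tri[OF w(3,4) rt(4)] by linarith
    moreover have "N (w t - u t) = \<alpha>0 t" using sym[OF w(4) rt(4)] by (simp add: \<alpha>0_def)
    moreover have "N (w r - w t) \<le> C * indicator V r + C * indicator V t"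
    proof (cases "w r = w t")
      case True
      then show ?thesis using Nself[OF w(4)] C0 by (simp add: indicator_def)
    next
      case False
      have "r \<in> W (w r) \<or> t \<in> W (w r)"
        using gap[of r "w r" t] False rt \<delta>(2)[OF w(1)] by auto
      then have "r \<in> V \<or> t \<in> V" using w by (auto simp: V_def)
      then show ?thesis using C[OF w(1,2)] C0 by (auto simp: indicator_def)
    qed
    ultimately show "N (u r - u t) \<le> \<alpha> r + \<alpha> t" by (simp add: \<alpha>_def \<alpha>0_def)
  qed
qed

subsection \<open>The dual space\<close>

context
  fixes \<Omega> :: "'a::euclidean_space set"
  assumes op: "open \<Omega>" and bd: "bounded \<Omega>"
begin

lemma Hminus1_bound_ex:
  assumes "F \<in> Hminus1 \<Omega>"
  obtains M where "M \<ge> 0" "\<And>\<phi>. \<phi> \<in> H10 \<Omega> \<Longrightarrow> \<bar>F \<phi>\<bar> \<le> M * H1_norm \<Omega> \<phi>"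
proof -
  obtain M where M: "\<And>\<phi>. \<phi> \<in> H10 \<Omega> \<Longrightarrow> \<bar>F \<phi>\<bar> \<le> M * H1_norm \<Omega> \<phi>"
    using assms unfolding Hminus1_def by blast
  have "\<bar>F \<phi>\<bar> \<le> \<bar>M\<bar> * H1_norm \<Omega> \<phi>" if "\<phi> \<in> H10 \<Omega>" for \<phi>
    by (rule order_trans[OF M[OF that] mult_right_mono[OF abs_ge_self H1_norm_nonneg]])
  then show ?thesis using that[of "\<bar>M\<bar>"] by auto
qed

lemma zero_H10: "(\<lambda>x. 0) \<in> H10 \<Omega>"
  by (rule test_function_H10[OF op bd test_function_zero])

lemma H1_norm_zero: "H1_norm \<Omega> (\<lambda>x. 0) = 0"
  using H1_norm_lin[OF op bd H10_H1[OF zero_H10] H10_H1[OF zero_H10], of 0 0] H1_norm_nonneg[of \<Omega> "\<lambda>x. 0"] by simp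

lemma H1_norm_cmult:
  assumes "u \<in> H1 \<Omega>" shows "H1_norm \<Omega> (\<lambda>x. c * u x) \<le> \<bar>c\<bar> * H1_norm \<Omega> u"
  using H1_norm_lin[OF op bd assms assms, of c 0] by simp

text \<open>A supremum of reals dominates its set only if the set is bounded above; the continuity
  bound in \<open>Hminus1\<close> guarantees this on the unit ball.\<close>

lemma Hminus1_norm_upper:
  assumes F: "F \<in> Hminus1 \<Omega>" and "\<psi> \<in> H10 \<Omega>" "H1_norm \<Omega> \<psi> \<le> 1"
  shows "\<bar>F \<psi>\<bar> \<le> Hminus1_norm \<Omega> F"
proof -
  obtain M where M: "M \<ge> 0" "\<And>\<phi>. \<phi> \<in> H10 \<Omega> \<Longrightarrow> \<bar>F \<phi>\<bar> \<le> M * H1_norm \<Omega> \<phi>"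
    using Hminus1_bound_ex[OF F] by blast
  have "bdd_above ((\<lambda>\<phi>. \<bar>F \<phi>\<bar>) ` {\<phi> \<in> H10 \<Omega>. H1_norm \<Omega> \<phi> \<le> 1})"
  proof (rule bdd_aboveI2)
    fix \<phi> assume "\<phi> \<in> {\<phi> \<in> H10 \<Omega>. H1_norm \<Omega> \<phi> \<le> 1}"
    then show "\<bar>F \<phi>\<bar> \<le> M" using M(2)[of \<phi>] mult_left_le[of "H1_norm \<Omega> \<phi>" M] M(1) by auto
  qed
  then show ?thesis unfolding Hminus1_norm_def using assms by (intro cSUP_upper) auto
qed

lemma Hminus1_norm_nonneg: "F \<in> Hminus1 \<Omega> \<Longrightarrow> Hminus1_norm \<Omega> F \<ge> 0"
  by (rule order_trans[OF abs_ge_zero Hminus1_norm_upper[OF _ zero_H10]]) (simp_all add: H1_norm_zero)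

lemma Hminus1_bound:
  assumes F: "F \<in> Hminus1 \<Omega>" and \<phi>: "\<phi> \<in> H10 \<Omega>"
  shows "\<bar>F \<phi>\<bar> \<le> Hminus1_norm \<Omega> F * H1_norm \<Omega> \<phi>"
proof (cases "H1_norm \<Omega> \<phi> = 0")
  \<comment> \<open>\<open>H1_norm\<close> is a seminorm, so normalization may be impossible; the
    continuity bound in \<open>Hminus1\<close> then forces \<open>F \<phi> = 0\<close>.\<close>
  case True
  obtain M where "\<And>\<phi>. \<phi> \<in> H10 \<Omega> \<Longrightarrow> \<bar>F \<phi>\<bar> \<le> M * H1_norm \<Omega> \<phi>"
    using Hminus1_bound_ex[OF F] by blast
  from this[OF \<phi>] show ?thesis using True by simp
next
  case False
  define c where "c = H1_norm \<Omega> \<phi>"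
  have c: "c > 0" using False H1_norm_nonneg[of \<Omega> \<phi>] by (simp add: c_def)
  let ?\<psi> = "\<lambda>x. (1 / c) * \<phi> x"
  have \<psi>: "?\<psi> \<in> H10 \<Omega>" using H10_lin[OF op bd \<phi> \<phi>, of "1 / c" 0] by simp
  have "H1_norm \<Omega> ?\<psi> \<le> 1" using H1_norm_cmult[OF H10_H1[OF \<phi>], of "1 / c"] c by (simp add: c_def)
  then have "\<bar>F ?\<psi>\<bar> \<le> Hminus1_norm \<Omega> F" by (rule Hminus1_norm_upper[OF F \<psi>])
  moreover have "F ?\<psi> = (1 / c) * F \<phi>" using F \<phi> unfolding Hminus1_def by blast
  moreover have "c * \<bar>1 / c * F \<phi>\<bar> = \<bar>F \<phi>\<bar>" using c by (simp add: abs_mult)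
  ultimately show ?thesis
    using mult_left_mono[of "\<bar>F ?\<psi>\<bar>" "Hminus1_norm \<Omega> F" c] c by (simp add: c_def mult.commute)
qed

lemma Hminus1_add: "F \<in> Hminus1 \<Omega> \<Longrightarrow> \<phi> \<in> H10 \<Omega> \<Longrightarrow> \<psi> \<in> H10 \<Omega> \<Longrightarrow> F (\<lambda>x. \<phi> x + \<psi> x) = F \<phi> + F \<psi>"
  unfolding Hminus1_def by blast

lemma Hminus1_cmult: "F \<in> Hminus1 \<Omega> \<Longrightarrow> \<phi> \<in> H10 \<Omega> \<Longrightarrow> F (\<lambda>x. c * \<phi> x) = c * F \<phi>"
  unfolding Hminus1_def by blast

lemma Hminus1_diff_arg:
  assumes "F \<in> Hminus1 \<Omega>" "\<phi> \<in> H10 \<Omega>" "\<psi> \<in> H10 \<Omega>"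
  shows "F (\<phi> - \<psi>) = F \<phi> - F \<psi>"
proof -
  have "(\<lambda>x. (-1) * \<psi> x) \<in> H10 \<Omega>" using H10_lin[OF op bd assms(3,3), of "-1" 0] by simp
  then have "F (\<lambda>x. \<phi> x + (-1) * \<psi> x) = F \<phi> + F (\<lambda>x. (-1) * \<psi> x)" using assms by (intro Hminus1_add)
  then show ?thesis using Hminus1_cmult[OF assms(1,3), of "-1"] by (simp add: fun_diff_def)
qed

lemma Hminus1_diff:
  assumes F: "F \<in> Hminus1 \<Omega>" and G: "G \<in> Hminus1 \<Omega>"
  shows "F - G \<in> Hminus1 \<Omega>"
proof -
  obtain M where M: "\<And>\<phi>. \<phi> \<in> H10 \<Omega> \<Longrightarrow> \<bar>F \<phi>\<bar> \<le> M * H1_norm \<Omega> \<phi>"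
    using Hminus1_bound_ex[OF F] by blast
  obtain M' where M': "\<And>\<phi>. \<phi> \<in> H10 \<Omega> \<Longrightarrow> \<bar>G \<phi>\<bar> \<le> M' * H1_norm \<Omega> \<phi>"
    using Hminus1_bound_ex[OF G] by blast
  have "\<bar>(F - G) \<phi>\<bar> \<le> (M + M') * H1_norm \<Omega> \<phi>" if "\<phi> \<in> H10 \<Omega>" for \<phi>
    using M[OF that] M'[OF that] by (simp add: distrib_right)
  moreover have "(F - G) (\<lambda>x. \<phi> x + \<psi> x) = (F - G) \<phi> + (F - G) \<psi>" if "\<phi> \<in> H10 \<Omega>" "\<psi> \<in> H10 \<Omega>" for \<phi> \<psi>
    by (simp add: Hminus1_add[OF F that] Hminus1_add[OF G that])
  moreover have "(F - G) (\<lambda>x. c * \<phi> x) = c * (F - G) \<phi>" if "\<phi> \<in> H10 \<Omega>" for \<phi> c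
    by (simp add: Hminus1_cmult[OF F that] Hminus1_cmult[OF G that] right_diff_distrib)
  ultimately show ?thesis
    unfolding Hminus1_def mem_Collect_eq by blast
qed

lemma bochner_Hminus1_apply_measurable:
  assumes w: "strongly_measurable T (Hminus1 \<Omega>) (Hminus1_norm \<Omega>) w" and \<phi>: "\<phi> \<in> H10 \<Omega>"
  shows "(\<lambda>t. w t \<phi>) \<in> borel_measurable (lebesgue_on {0<..<T})"
proof -
  obtain s where wX: "AE t in lebesgue_on {0<..<T}. w t \<in> Hminus1 \<Omega>"
    and s: "\<And>k::nat. finite (s k ` {0<..<T})" "\<And>k. s k ` {0<..<T} \<subseteq> Hminus1 \<Omega>"
        "\<And>k y. {t \<in> {0<..<T}. s k t = y} \<in> sets lebesgue"
    and lim: "AE t in lebesgue_on {0<..<T}. (\<lambda>k. Hminus1_norm \<Omega> (w t - s k t)) \<longlonglongrightarrow> 0"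
    using w unfolding strongly_measurable_def by blast
  show ?thesis
  proof (rule borel_measurable_lebesgue_on_AE_limit)
    show "(\<lambda>t. s k t \<phi>) \<in> borel_measurable (lebesgue_on {0<..<T})" for k
      using s by (intro finite_valued_measurable[of "s k" _ "\<lambda>F. F \<phi>"]) auto
    show "AE t in lebesgue_on {0<..<T}. (\<lambda>k. s k t \<phi>) \<longlonglongrightarrow> w t \<phi>"
      using wX lim AE_space
    proof eventually_elim
      case (elim t)
      have sk: "s k t \<in> Hminus1 \<Omega>" for k using s(2)[of k] elim(3) by (auto simp: space_restrict_space)
      have "\<bar>s k t \<phi> - w t \<phi>\<bar> \<le> Hminus1_norm \<Omega> (w t - s k t) * H1_norm \<Omega> \<phi>" for k
        using Hminus1_bound[OF Hminus1_diff[OF elim(1) sk] \<phi>, of k] by (simp add: abs_minus_commute)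
      then have ev: "\<forall>\<^sub>F k in sequentially. norm (s k t \<phi> - w t \<phi>) \<le> Hminus1_norm \<Omega> (w t - s k t) * H1_norm \<Omega> \<phi>"
        by simp
      have "(\<lambda>k. Hminus1_norm \<Omega> (w t - s k t) * H1_norm \<Omega> \<phi>) \<longlonglongrightarrow> 0"
        by (rule tendsto_mult_left_zero) (rule elim(2))
      from Lim_null_comparison[OF ev this] have "(\<lambda>k. s k t \<phi> - w t \<phi>) \<longlonglongrightarrow> 0" .
      then show ?case by (simp add: LIM_zero_iff)
    qed
  qed simp
qed

lemma bochner_Hminus1_apply_integrable:
  assumes w: "bochner_L2 T (Hminus1 \<Omega>) (Hminus1_norm \<Omega>) w" and \<phi>: "\<phi> \<in> H10 \<Omega>"
  shows "integrable (lebesgue_on {0<..<T}) (\<lambda>t. w t \<phi>)"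
proof (rule Bochner_Integration.integrable_bound)
  have sm: "strongly_measurable T (Hminus1 \<Omega>) (Hminus1_norm \<Omega>) w"
    and int: "integrable (lebesgue_on {0<..<T}) (\<lambda>t. (Hminus1_norm \<Omega> (w t))\<^sup>2)"
    using w by (auto simp: bochner_L2_def)
  interpret finite_measure "lebesgue_on {0<..<T}" by (rule finite_measure_lebesgue_on) auto
  show "integrable (lebesgue_on {0<..<T}) (\<lambda>t. (Hminus1_norm \<Omega> (w t))\<^sup>2 + (H1_norm \<Omega> \<phi>)\<^sup>2)"
    using int by simp
  show "(\<lambda>t. w t \<phi>) \<in> borel_measurable (lebesgue_on {0<..<T})"
    by (rule bochner_Hminus1_apply_measurable[OF sm \<phi>])
  have "AE t in lebesgue_on {0<..<T}. w t \<in> Hminus1 \<Omega>" using sm by (simp add: strongly_measurable_def)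
  then show "AE t in lebesgue_on {0<..<T}. norm (w t \<phi>) \<le> norm ((Hminus1_norm \<Omega> (w t))\<^sup>2 + (H1_norm \<Omega> \<phi>)\<^sup>2)"
  proof eventually_elim
    case (elim t)
    have "\<bar>w t \<phi>\<bar> \<le> Hminus1_norm \<Omega> (w t) * H1_norm \<Omega> \<phi>" by (rule Hminus1_bound[OF elim \<phi>])
    also have "\<dots> \<le> (Hminus1_norm \<Omega> (w t))\<^sup>2 + (H1_norm \<Omega> \<phi>)\<^sup>2"
    proof -
      have "0 \<le> Hminus1_norm \<Omega> (w t) * H1_norm \<Omega> \<phi>"
        by (intro mult_nonneg_nonneg Hminus1_norm_nonneg elim H1_norm_nonneg)
      then show ?thesis
        using sum_squares_bound[of "Hminus1_norm \<Omega> (w t)" "H1_norm \<Omega> \<phi>"] by linarith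
    qed
    finally show ?case by simp
  qed
qed

text \<open>Applied to a fixed \<phi>, the functional valued weak derivative becomes a scalar one,
  and the continuous representative makes its increments meaningful between individual
  times.\<close>

lemma H1_time_Hminus1_increment:
  assumes n: "H1_time_Hminus1 \<Omega> T n n'" and \<phi>: "\<phi> \<in> H10 \<Omega>"
    and c: "continuous_on {0..} (\<lambda>t. L2_inner \<Omega> (n t) \<phi>)" and st: "0 < s" "s \<le> t" "t < T"
  shows "L2_inner \<Omega> (n t) \<phi> - L2_inner \<Omega> (n s) \<phi> = integral {s..t} (\<lambda>r. n' r \<phi>)"
proof (rule du_Bois_Reymond[OF c _ _ st])
  show "integrable (lebesgue_on {0<..<T}) (\<lambda>r. n' r \<phi>)"
    using n \<phi> by (intro bochner_Hminus1_apply_integrable) (auto simp: H1_time_Hminus1_def bochner_H1_def)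
  show "(\<integral>t. L2_inner \<Omega> (n t) \<phi> * deriv \<psi> t \<partial>lebesgue_on {0<..<T}) = - (\<integral>t. n' t \<phi> * \<psi> t \<partial>lebesgue_on {0<..<T})"
    if "test_function {0<..<T} \<psi>" for \<psi>
    using n \<phi> that by (auto simp: H1_time_Hminus1_def bochner_H1_def)
qed

section \<open>Translations and semicontinuity in time\<close>

lemma H1_norm_triangle3:
  assumes "a \<in> H1 \<Omega>" "b \<in> H1 \<Omega>" "c \<in> H1 \<Omega>"
  shows "H1_norm \<Omega> (a - c) \<le> H1_norm \<Omega> (a - b) + H1_norm \<Omega> (b - c)"
proof -
  have "(\<lambda>x. 1 * (a - b) x + 1 * (b - c) x) = a - c" by auto
  then show ?thesis
    using H1_norm_lin[OF op bd H1_diff(1)[OF op bd assms(1,2)] H1_diff(1)[OF op bd assms(2,3)], of 1 1] by simp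
qed

lemma H1_norm_commute:
  assumes "a \<in> H1 \<Omega>" "b \<in> H1 \<Omega>"
  shows "H1_norm \<Omega> (a - b) = H1_norm \<Omega> (b - a)"
proof -
  have "H1_norm \<Omega> (a - b) \<le> H1_norm \<Omega> (b - a)" if "a \<in> H1 \<Omega>" "b \<in> H1 \<Omega>" for a b
  proof -
    have "(\<lambda>x. (-1) * (b - a) x) = a - b" by auto
    then show ?thesis using H1_norm_cmult[OF H1_diff(1)[OF op bd that(2,1)], of "-1"] by simp
  qed
  then show ?thesis using assms by (intro antisym) auto
qed

lemma bochner_H1_translation:
  assumes "bochner_L2 T (H1 \<Omega>) (H1_norm \<Omega>) u" "T > 0" "e > 0"
  obtains \<delta> \<alpha> where "\<delta> > 0" "\<And>t. \<alpha> t \<ge> 0" "integrable (lebesgue_on {0<..<T}) (\<lambda>t. (\<alpha> t)\<^sup>2)"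
    "(\<integral>t. (\<alpha> t)\<^sup>2 \<partial>lebesgue_on {0<..<T}) < e"
    "\<And>r t. r \<in> {0<..<T} \<Longrightarrow> t \<in> {0<..<T} \<Longrightarrow> u r \<in> H1 \<Omega> \<Longrightarrow> u t \<in> H1 \<Omega> \<Longrightarrow> \<bar>r - t\<bar> < \<delta> \<Longrightarrow>
       H1_norm \<Omega> (u r - u t) \<le> \<alpha> r + \<alpha> t"
proof -
  have self: "H1_norm \<Omega> (a - a) = 0" for a :: "'a \<Rightarrow> real" using H1_norm_zero by (simp add: fun_diff_def)
  have zero: "(\<lambda>x. 0) \<in> H1 \<Omega>" by (rule H10_H1[OF zero_H10])
  have diff0: "H1_norm \<Omega> (a - (\<lambda>x. 0)) = H1_norm \<Omega> a" for a by (simp add: fun_diff_def)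
  show ?thesis
    by (rule bochner_L2_translation[where N = "H1_norm \<Omega>" and X = "H1 \<Omega>" and z = "\<lambda>x. 0",
          OF assms H1_norm_triangle3 H1_norm_commute H1_norm_nonneg self zero diff0 that])
qed

lemma L2_norm_triangle3:
  assumes "a \<in> L2 \<Omega>" "b \<in> L2 \<Omega>" "c \<in> L2 \<Omega>"
  shows "L2_norm \<Omega> (a - c) \<le> L2_norm \<Omega> (a - b) + L2_norm \<Omega> (b - c)"
  using L2_norm_triangle[OF L2_diff[OF assms(1,2)] L2_diff[OF assms(2,3)]] by (simp add: fun_diff_def)

lemma L2_norm_commute: "L2_norm \<Omega> (a - b) = L2_norm \<Omega> (b - a)" for a b :: "'a \<Rightarrow> real"
  by (simp add: L2_norm_def power2_commute)

text \<open>Weak lower semicontinuity; the density of \<open>H10 \<Omega>\<close> allows to test with \<open>H10 \<Omega>\<close> only.\<close>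

lemma L2_norm_weak_lsc:
  fixes n :: "real \<Rightarrow> 'a \<Rightarrow> real"
  assumes n: "\<And>t. t \<ge> 0 \<Longrightarrow> n t \<in> L2 \<Omega>" and c: "\<And>\<phi>. \<phi> \<in> H10 \<Omega> \<Longrightarrow> continuous_on {0..} (\<lambda>t. L2_inner \<Omega> (n t) \<phi>)"
    and m: "m \<in> L2 \<Omega>" and b: "b \<ge> 0" and e: "e > 0"
  shows "\<exists>\<delta>>0. \<forall>t\<in>{b..b+\<delta>}. L2_norm \<Omega> (n b - m) - e \<le> L2_norm \<Omega> (n t - m)"
proof (cases "L2_norm \<Omega> (n b - m) = 0")
  case True
  then have "L2_norm \<Omega> (n b - m) - e \<le> L2_norm \<Omega> (n t - m)" for t using e L2_norm_nonneg[of \<Omega> "n t - m"] by linarith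
  then show ?thesis by (intro exI[of _ "1::real"] conjI ballI) simp_all
next
  case False
  define f where "f = n b - m"
  have f: "f \<in> L2 \<Omega>" unfolding f_def by (intro L2_fun_diff n b m)
  have f0: "L2_norm \<Omega> f > 0" using False L2_norm_nonneg[of \<Omega> f] by (simp add: f_def)
  \<comment> \<open>Half of |f| keeps |\<phi>| positive; e/4 covers three losses of size d: one from
    approximating \<open>f\<close> and two in the inner product with \<phi>.\<close>
  define d where "d = min (L2_norm \<Omega> f / 2) (e / 4)"
  have d: "d > 0" "d \<le> L2_norm \<Omega> f / 2" "d \<le> e / 4" using f0 e by (auto simp: d_def)
  obtain \<phi> where \<phi>: "test_function \<Omega> \<phi>" "L2_norm \<Omega> (\<lambda>x. f x - \<phi> x) < d"
    using test_function_approx[OF op bd f d(1)] by blast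
  have \<phi>2: "\<phi> \<in> L2 \<Omega>" by (rule test_function_mem_L2[OF op bd \<phi>(1)])
  have \<phi>H: "\<phi> \<in> H10 \<Omega>" by (rule test_function_H10[OF op bd \<phi>(1)])
  define P where "P = L2_norm \<Omega> \<phi>"
  have Pf: "L2_norm \<Omega> f \<le> P + d"
  proof -
    have "L2_norm \<Omega> (\<lambda>x. (f x - \<phi> x) + \<phi> x) \<le> L2_norm \<Omega> (\<lambda>x. f x - \<phi> x) + L2_norm \<Omega> \<phi>"
      by (intro L2_norm_triangle L2_diff f \<phi>2)
    then show ?thesis using \<phi>(2) by (simp add: P_def)
  qed
  then have P: "P > 0" using d f0 by linarith
  have inn: "L2_inner \<Omega> (g - h) \<phi> = L2_inner \<Omega> g \<phi> - L2_inner \<Omega> h \<phi>" if "g \<in> L2 \<Omega>" "h \<in> L2 \<Omega>" for g h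
    using L2_mult_integrable[OF that(1) \<phi>2] L2_mult_integrable[OF that(2) \<phi>2]
    by (simp add: L2_inner_def left_diff_distrib)
  have "L2_inner \<Omega> f \<phi> = P\<^sup>2 + L2_inner \<Omega> (f - \<phi>) \<phi>"
    using inn[OF f \<phi>2] by (simp add: P_def L2_norm_sq_eq_inner)
  moreover have "\<bar>L2_inner \<Omega> (f - \<phi>) \<phi>\<bar> \<le> d * P"
  proof -
    have "\<bar>L2_inner \<Omega> (f - \<phi>) \<phi>\<bar> \<le> L2_norm \<Omega> (f - \<phi>) * P"
      unfolding P_def by (intro L2_inner_Cauchy_Schwarz L2_fun_diff f \<phi>2)
    also have "\<dots> \<le> d * P" using \<phi>(2) P by (intro mult_right_mono) (auto simp: fun_diff_def)
    finally show ?thesis .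
  qed
  ultimately have low: "L2_inner \<Omega> f \<phi> \<ge> (P - d) * P" by (simp add: power2_eq_square left_diff_distrib)
  have "continuous_on {0..} (\<lambda>t. L2_inner \<Omega> (n t) \<phi>)" by (rule c[OF \<phi>H])
  then obtain \<delta> where \<delta>: "\<delta> > 0" "\<And>t. t \<ge> 0 \<Longrightarrow> dist t b < \<delta> \<Longrightarrow>
      dist (L2_inner \<Omega> (n t) \<phi>) (L2_inner \<Omega> (n b) \<phi>) < d * P"
    unfolding continuous_on_iff using b d(1) P by (metis atLeast_iff mult_pos_pos)
  show ?thesis
  proof (intro exI[of _ "\<delta> / 2"] conjI ballI)
    show "\<delta> / 2 > 0" using \<delta> by simp
    fix t assume t: "t \<in> {b..b + \<delta> / 2}"
    then have t0: "t \<ge> 0" using b by simp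
    have "\<bar>L2_inner \<Omega> (n t) \<phi> - L2_inner \<Omega> (n b) \<phi>\<bar> < d * P"
      using \<delta>(2)[OF t0] t \<delta>(1) by (simp add: dist_real_def)
    then have "L2_inner \<Omega> (n t - m) \<phi> \<ge> L2_inner \<Omega> f \<phi> - d * P"
      unfolding f_def using inn[OF n[OF t0] m] inn[OF n[OF b] m] by linarith
    also have "L2_inner \<Omega> (n t - m) \<phi> \<le> L2_norm \<Omega> (n t - m) * P"
      using L2_inner_Cauchy_Schwarz[OF L2_fun_diff[OF n[OF t0] m] \<phi>2] by (simp add: P_def)
    finally have "(P - 2 * d) * P \<le> L2_norm \<Omega> (n t - m) * P" using low by (simp add: left_diff_distrib)
    then have "P - 2 * d \<le> L2_norm \<Omega> (n t - m)" using P by simp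
    then show "L2_norm \<Omega> (n b - m) - e \<le> L2_norm \<Omega> (n t - m)"
      using Pf d by (simp add: f_def[symmetric])
  qed
qed

end

section \<open>The drift-diffusion equations\<close>

lemma sum_atMost_3: "(\<Sum>i\<le>(3::nat). f i) = f 0 + f 1 + f 2 + f 3"
  by (simp add: numeral_eq_Suc atMost_Suc add_ac)

lemma norm_cart_3: "(norm (m :: real^3))\<^sup>2 = (m $ of_nat 1)\<^sup>2 + (m $ of_nat 2)\<^sup>2 + (m $ of_nat 3)\<^sup>2"
  unfolding power2_norm_eq_inner by (simp add: inner_vec_def sum_3 power2_eq_square)

text \<open>Lagrange's identity: for a unit coefficient vector the gap is the sum of the squared 2x2
  minors.\<close>

lemma norm_sum3_le:
  fixes x y z :: "'a::real_inner"
  assumes "a\<^sup>2 + b\<^sup>2 + c\<^sup>2 = 1"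
  shows "(norm (a *\<^sub>R x + b *\<^sub>R y + c *\<^sub>R z))\<^sup>2 \<le> (norm x)\<^sup>2 + (norm y)\<^sup>2 + (norm z)\<^sup>2"
proof -
  have "(norm x)\<^sup>2 + (norm y)\<^sup>2 + (norm z)\<^sup>2 - (norm (a *\<^sub>R x + b *\<^sub>R y + c *\<^sub>R z))\<^sup>2
    = (a\<^sup>2 + b\<^sup>2 + c\<^sup>2) * ((norm x)\<^sup>2 + (norm y)\<^sup>2 + (norm z)\<^sup>2) - (norm (a *\<^sub>R x + b *\<^sub>R y + c *\<^sub>R z))\<^sup>2"
    by (simp add: assms)
  also have "\<dots> = (norm (a *\<^sub>R y - b *\<^sub>R x))\<^sup>2 + (norm (a *\<^sub>R z - c *\<^sub>R x))\<^sup>2 + (norm (b *\<^sub>R z - c *\<^sub>R y))\<^sup>2"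
    unfolding power2_norm_eq_inner by (simp add: inner_simps inner_commute power2_eq_square algebra_simps)
  also have "\<dots> \<ge> 0" by simp
  finally show ?thesis by simp
qed

text \<open>The bound 1 - |p| \<le> \<eta> is the decisive one, since it fixes the sign of the
  coefficient 1 - \<eta> - |p| on which coercivity hinges. Squared, it amounts to 2 |p| (1 - |p|)
  \<ge> 0.\<close>

lemma polarization_bounds:
  fixes p q :: real
  assumes "\<bar>p\<bar> \<le> q" "q < 1"
  defines "\<eta> \<equiv> sqrt (1 - p\<^sup>2)"
  shows "0 < \<eta>" "\<eta> \<le> 1" "1 - q\<^sup>2 \<le> \<eta>\<^sup>2" "1 - \<bar>p\<bar> \<le> \<eta>" "0 < 1 - q\<^sup>2" "p\<^sup>2 < 1"
proof -
  have p: "p\<^sup>2 \<le> q\<^sup>2" using assms(1) by (metis abs_ge_zero power2_abs power_mono)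
  have q: "q\<^sup>2 < 1" using assms by (simp add: abs_square_less_1)
  show "0 < 1 - q\<^sup>2" "p\<^sup>2 < 1" using p q by auto
  then show "0 < \<eta>" "\<eta> \<le> 1" "1 - q\<^sup>2 \<le> \<eta>\<^sup>2" using p by (auto simp: \<eta>_def)
  have "(1 - \<bar>p\<bar>)\<^sup>2 \<le> 1 - p\<^sup>2"
  proof -
    have "0 \<le> 2 * \<bar>p\<bar> * (1 - \<bar>p\<bar>)" using assms by (intro mult_nonneg_nonneg) auto
    moreover have "(1 - \<bar>p\<bar>)\<^sup>2 = 1 - p\<^sup>2 - 2 * \<bar>p\<bar> * (1 - \<bar>p\<bar>)"
      by (simp add: power2_eq_square algebra_simps)
    ultimately show ?thesis by linarith
  qed
  then show "1 - \<bar>p\<bar> \<le> \<eta>" unfolding \<eta>_def by (rule real_le_rsqrt)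
qed

text \<open>With G the combination of the spin entries with coefficients m_k and S the sum of their
  squared norms, the form is D/\<eta>^2 times |g_0|^2 - 2 p g_0.G + \<eta> S + (1 - \<eta>) |G|^2.
  Young's inequality for the mixed term leaves |G|^2 with the nonpositive coefficient 1 - \<eta> -
  |p|, and |G|^2 \<le> S turns everything into 1 - |p| times the full sum. Finally D/\<eta>^2 \<ge>
  \<delta> because \<eta> \<le> 1.\<close>

lemma diffusion_matrix_coercive:
  fixes g :: "nat \<Rightarrow> 'a::real_inner"
  assumes m: "norm m = 1" and p: "\<bar>p\<bar> \<le> q" "q < 1" and D: "\<delta> \<le> D" "\<delta> > 0"
  shows "\<delta> * (1 - q) * (\<Sum>i\<le>3. (norm (g i))\<^sup>2)
    \<le> (\<Sum>i\<le>3. (\<Sum>j\<le>3. diffusion_matrix D p m i j *\<^sub>R g j) \<bullet> g i)"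
proof -
  define \<eta> where "\<eta> = sqrt (1 - p\<^sup>2)"
  note pb = polarization_bounds[OF p, folded \<eta>_def]
  define a b c where "a = m $ of_nat 1" "b = m $ of_nat 2" "c = m $ of_nat 3"
  have abc: "a\<^sup>2 + b\<^sup>2 + c\<^sup>2 = 1" using norm_cart_3[of m] m by (simp add: a_b_c_def)
  define G where "G = a *\<^sub>R g 1 + b *\<^sub>R g 2 + c *\<^sub>R g 3"
  define S where "S = (norm (g 1))\<^sup>2 + (norm (g 2))\<^sup>2 + (norm (g 3))\<^sup>2"
  define Q where "Q = (norm (g 0))\<^sup>2 - 2 * p * (g 0 \<bullet> G) + \<eta> * S + (1 - \<eta>) * (norm G)\<^sup>2"
  define d where "d = D / \<eta>\<^sup>2"
  have dm: "diffusion_matrix D p m i j = d *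
       (if i = 0 \<and> j = 0 then 1
        else if i = 0 then - p * m $ of_nat j
        else if j = 0 then - p * m $ of_nat i
        else \<eta> * (if i = j then 1 else 0) + (1 - \<eta>) * (m $ of_nat i * m $ of_nat j))" for i j
    by (simp add: diffusion_matrix_def Let_def d_def \<eta>_def)
  have m3: "m $ of_nat 1 = a" "m $ of_nat 2 = b" "m $ of_nat 3 = c" "m $ of_nat (Suc 0) = a" by (auto simp: a_b_c_def)
  have e: "diffusion_matrix D p m 0 0 = d * 1" "diffusion_matrix D p m 0 1 = d * (- p * a)"
    "diffusion_matrix D p m 0 2 = d * (- p * b)" "diffusion_matrix D p m 0 3 = d * (- p * c)"
    "diffusion_matrix D p m 1 0 = d * (- p * a)" "diffusion_matrix D p m 2 0 = d * (- p * b)"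
    "diffusion_matrix D p m 3 0 = d * (- p * c)"
    "diffusion_matrix D p m 1 1 = d * (\<eta> + (1 - \<eta>) * (a * a))" "diffusion_matrix D p m 1 2 = d * ((1 - \<eta>) * (a * b))"
    "diffusion_matrix D p m 1 3 = d * ((1 - \<eta>) * (a * c))" "diffusion_matrix D p m 2 1 = d * ((1 - \<eta>) * (b * a))"
    "diffusion_matrix D p m 2 2 = d * (\<eta> + (1 - \<eta>) * (b * b))" "diffusion_matrix D p m 2 3 = d * ((1 - \<eta>) * (b * c))"
    "diffusion_matrix D p m 3 1 = d * ((1 - \<eta>) * (c * a))" "diffusion_matrix D p m 3 2 = d * ((1 - \<eta>) * (c * b))"
    "diffusion_matrix D p m 3 3 = d * (\<eta> + (1 - \<eta>) * (c * c))"
    unfolding dm m3 by simp_all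
  have "(\<Sum>i\<le>3. (\<Sum>j\<le>3. diffusion_matrix D p m i j *\<^sub>R g j) \<bullet> g i) = d * Q"
    unfolding sum_atMost_3 e Q_def G_def S_def power2_norm_eq_inner
    by (simp add: inner_simps inner_commute algebra_simps)
  moreover have "(1 - q) * ((norm (g 0))\<^sup>2 + S) \<le> Q"
  proof -
    have GS: "(norm G)\<^sup>2 \<le> S" unfolding G_def S_def by (rule norm_sum3_le[OF abc])
    have "\<bar>g 0 \<bullet> G\<bar> \<le> norm (g 0) * norm G" by (rule Cauchy_Schwarz_ineq2)
    moreover have "2 * (norm (g 0) * norm G) \<le> (norm (g 0))\<^sup>2 + (norm G)\<^sup>2"
      using sum_squares_bound[of "norm (g 0)" "norm G"] by simp
    ultimately have "2 * \<bar>g 0 \<bullet> G\<bar> \<le> (norm (g 0))\<^sup>2 + (norm G)\<^sup>2" by linarith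
    then have "\<bar>p\<bar> * (2 * \<bar>g 0 \<bullet> G\<bar>) \<le> \<bar>p\<bar> * ((norm (g 0))\<^sup>2 + (norm G)\<^sup>2)" by (rule mult_left_mono) simp
    moreover have "2 * p * (g 0 \<bullet> G) \<le> \<bar>p\<bar> * (2 * \<bar>g 0 \<bullet> G\<bar>)"
      using abs_ge_self[of "2 * p * (g 0 \<bullet> G)"] by (simp add: abs_mult)
    moreover have "(1 - \<eta> - \<bar>p\<bar>) * S \<le> (1 - \<eta> - \<bar>p\<bar>) * (norm G)\<^sup>2"
      using pb(4) GS by (intro mult_left_mono_neg) auto
    moreover have "(1 - q) * ((norm (g 0))\<^sup>2 + S) \<le> (1 - \<bar>p\<bar>) * ((norm (g 0))\<^sup>2 + S)"
      using p by (intro mult_right_mono) (auto simp: S_def)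
    ultimately show ?thesis unfolding Q_def by (simp add: algebra_simps)
  qed
  moreover have "\<delta> \<le> d"
  proof -
    have "\<eta>\<^sup>2 \<le> 1" using pb by (simp add: power_le_one)
    then have "\<delta> * \<eta>\<^sup>2 \<le> D" using D mult_left_le[of "\<eta>\<^sup>2" \<delta>] by linarith
    then show ?thesis using pb by (simp add: d_def pos_le_divide_eq)
  qed
  moreover have "\<delta> * ((1 - q) * ((norm (g 0))\<^sup>2 + S)) \<le> d * ((1 - q) * ((norm (g 0))\<^sup>2 + S))"
    using calculation(3) p by (intro mult_right_mono mult_nonneg_nonneg) (auto simp: S_def)
  moreover have "d * ((1 - q) * ((norm (g 0))\<^sup>2 + S)) \<le> d * Q"
    using calculation(2,3) D by (intro mult_left_mono) auto
  ultimately show ?thesis by (simp add: sum_atMost_3 S_def algebra_simps)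
qed

lemma diffusion_matrix_bound:
  assumes m: "norm m = 1" and p: "\<bar>p\<bar> \<le> q" "q < 1" and D: "\<bar>D\<bar> \<le> DM"
  shows "\<bar>diffusion_matrix D p m i j\<bar> \<le> DM / (1 - q\<^sup>2)"
proof -
  define \<eta> where "\<eta> = sqrt (1 - p\<^sup>2)"
  note pb = polarization_bounds[OF p, folded \<eta>_def]
  have mk: "\<bar>m $ k\<bar> \<le> 1" for k using component_le_norm_cart[of m k] m by simp
  define e where "e = (if i = 0 \<and> j = 0 then 1
        else if i = 0 then - p * m $ of_nat j
        else if j = 0 then - p * m $ of_nat i
        else \<eta> * (if i = j then 1 else 0) + (1 - \<eta>) * (m $ of_nat i * m $ of_nat j))"
  have pm: "\<bar>p * m $ k\<bar> \<le> 1" for k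
    using p mk[of k] by (auto simp: abs_mult intro!: mult_le_one)
  have "\<bar>\<eta> * (if i = j then 1 else 0) + (1 - \<eta>) * (m $ of_nat i * m $ of_nat j)\<bar> \<le> 1"
  proof -
    have "\<bar>m $ of_nat i * m $ of_nat j\<bar> \<le> 1"
      using mk[of "of_nat i"] mk[of "of_nat j"] by (auto simp: abs_mult intro!: mult_le_one)
    then have "(1 - \<eta>) * \<bar>m $ of_nat i * m $ of_nat j\<bar> \<le> 1 - \<eta>" using pb by (intro mult_left_le) auto
    then have "\<bar>(1 - \<eta>) * (m $ of_nat i * m $ of_nat j)\<bar> \<le> 1 - \<eta>" using pb by (simp add: abs_mult)
    moreover have "\<bar>\<eta> * (if i = j then 1 else 0)\<bar> \<le> \<eta>" using pb by auto
    ultimately show ?thesis by linarith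
  qed
  then have "\<bar>e\<bar> \<le> 1" using pm by (auto simp: e_def)
  have "diffusion_matrix D p m i j = D / \<eta>\<^sup>2 * e"
    unfolding diffusion_matrix_def Let_def \<eta>_def e_def by simp
  then have "\<bar>diffusion_matrix D p m i j\<bar> = \<bar>D\<bar> / \<eta>\<^sup>2 * \<bar>e\<bar>" by (simp add: abs_mult)
  also have "\<dots> \<le> \<bar>D\<bar> / \<eta>\<^sup>2" using \<open>\<bar>e\<bar> \<le> 1\<close> by (intro mult_left_le) auto
  also have "\<dots> \<le> DM / (1 - q\<^sup>2)" using pb D by (intro frac_le) auto
  finally show ?thesis .
qed

text \<open>The Levi-Civita part is skew and drops out of the quadratic form; the spin components
  keep the factor -1/\<tau>.\<close>

lemma relaxation_matrix_dissipative:
  assumes "\<tau> > 0"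
  shows "(\<Sum>i\<le>3. (\<Sum>j\<le>3. relaxation_matrix \<gamma> \<tau> m i j * w j) * w i) \<le> 0"
proof -
  have 3: "{1..3} = {1, 2, 3::nat}" by auto
  have "(\<Sum>i\<le>3. (\<Sum>j\<le>3. relaxation_matrix \<gamma> \<tau> m i j * w j) * w i)
    = - (1 / \<tau>) * ((w 1)\<^sup>2 + (w 2)\<^sup>2 + (w 3)\<^sup>2)"
    unfolding sum_atMost_3 relaxation_matrix_def 3 levi_civita_def
    by (simp add: algebra_simps power2_eq_square)
  also have "\<dots> \<le> 0" using assms by (simp add: mult_nonneg_nonneg)
  finally show ?thesis .
qed

lemma relaxation_matrix_bound:
  assumes "norm m = 1"
  shows "\<bar>relaxation_matrix \<gamma> \<tau> m i j\<bar> \<le> 6 * \<bar>\<gamma>\<bar> + \<bar>1 / \<tau>\<bar>"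
proof -
  have mk: "\<bar>m $ k\<bar> \<le> 1" for k using component_le_norm_cart[of m k] assms by simp
  have "\<bar>levi_civita i j k\<bar> \<le> 1" for k by (simp add: levi_civita_def)
  then have "\<bar>levi_civita i j k * m $ of_nat k\<bar> \<le> 1" for k
    using mk by (simp add: abs_mult mult_le_one)
  then have "\<bar>\<Sum>k=1..3. levi_civita i j k * m $ of_nat k\<bar> \<le> (\<Sum>k=1..(3::nat). 1)"
    by (intro order_trans[OF sum_abs] sum_mono)
  then have "2 * \<bar>\<gamma>\<bar> * \<bar>\<Sum>k=1..3. levi_civita i j k * m $ of_nat k\<bar> \<le> 2 * \<bar>\<gamma>\<bar> * 3"
    by (intro mult_left_mono) auto
  then have "\<bar>2 * \<gamma> * (\<Sum>k=1..3. levi_civita i j k * m $ of_nat k)\<bar> \<le> 6 * \<bar>\<gamma>\<bar>" by (simp add: abs_mult)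
  moreover have "\<bar>if i = j then 1 / \<tau> else 0\<bar> \<le> \<bar>1 / \<tau>\<bar>" by simp
  ultimately have "\<bar>2 * \<gamma> * (\<Sum>k=1..3. levi_civita i j k * m $ of_nat k) - (if i = j then 1 / \<tau> else 0)\<bar>
      \<le> 6 * \<bar>\<gamma>\<bar> + \<bar>1 / \<tau>\<bar>"
    by linarith
  then show ?thesis unfolding relaxation_matrix_def by (cases "i \<in> {1..3} \<and> j \<in> {1..3}") (simp_all only: if_True if_False, simp)
qed

lemma mobility_bounds:
  assumes "mobility \<mu> v_sat L"
  shows "v_sat > 0" "L > 0" "\<And>s. s \<ge> 0 \<Longrightarrow> \<mu> s > 0" "\<And>s. s \<ge> 0 \<Longrightarrow> s * \<mu> s \<le> v_sat"
    "\<And>s s'. s \<ge> 0 \<Longrightarrow> s' \<ge> 0 \<Longrightarrow> \<bar>s * \<mu> s - s' * \<mu> s'\<bar> \<le> L * \<bar>s - s'\<bar>"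
    "continuous_on {0..} \<mu>"
  using assms by (auto simp: mobility_def continuous_on_eq_continuous_within intro: DERIV_continuous)

lemma mobility_field_bound:
  assumes "mobility \<mu> v_sat L"
  shows "norm (\<mu> (norm x) *\<^sub>R x) \<le> v_sat"
  using mobility_bounds(3,4)[OF assms, of "norm x"] by (simp add: mult.commute)

text \<open>With s = |x| and t = |y| the squared difference is (s \<mu>(s) - t \<mu>(t))^2 + 2
  \<mu>(s) \<mu>(t) (s t - x.y). The Lipschitz condition bounds the first term and, with one
  argument 0, gives \<mu> \<le> L for the second. The same identity with L in place of both
  mobilities recombines the bounds to L^2 |x - y|^2.\<close>

lemma mobility_field_Lipschitz:
  fixes x y :: "'a::real_inner"
  assumes \<mu>: "mobility \<mu> v_sat L"
  shows "norm (\<mu> (norm x) *\<^sub>R x - \<mu> (norm y) *\<^sub>R y) \<le> L * norm (x - y)"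
proof (rule power2_le_imp_le)
  note mb = mobility_bounds[OF \<mu>]
  define s t where "s = norm x" "t = norm y"
  have st: "s \<ge> 0" "t \<ge> 0" by (auto simp: s_t_def)
  have xy: "x \<bullet> x = s\<^sup>2" "y \<bullet> y = t\<^sup>2" by (auto simp: s_t_def power2_norm_eq_inner)
  have cs: "x \<bullet> y \<le> s * t" using norm_cauchy_schwarz[of x y] by (simp add: s_t_def)
  have "(norm (\<mu> s *\<^sub>R x - \<mu> t *\<^sub>R y))\<^sup>2 = (s * \<mu> s - t * \<mu> t)\<^sup>2 + 2 * (\<mu> s * \<mu> t * (s * t - x \<bullet> y))"
    unfolding power2_norm_eq_inner
    by (simp add: inner_simps xy inner_commute[of y x] power2_eq_square algebra_simps)
  also have "\<dots> \<le> L\<^sup>2 * (s - t)\<^sup>2 + 2 * (L\<^sup>2 * (s * t - x \<bullet> y))"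
  proof (intro add_mono mult_left_mono)
    have "\<bar>s * \<mu> s - t * \<mu> t\<bar>\<^sup>2 \<le> (L * \<bar>s - t\<bar>)\<^sup>2" using mb(5)[OF st] by (intro power_mono) auto
    then show "(s * \<mu> s - t * \<mu> t)\<^sup>2 \<le> L\<^sup>2 * (s - t)\<^sup>2" by (simp add: power_mult_distrib)
    show "\<mu> s * \<mu> t * (s * t - x \<bullet> y) \<le> L\<^sup>2 * (s * t - x \<bullet> y)"
    proof (cases "s = 0 \<or> t = 0")
      case True
      then show ?thesis by (auto simp: s_t_def)
    next
      case False
      have "\<mu> r \<le> L" if "r > 0" for r
        using mb(5)[of r 0] mb(3)[of r] that by (simp add: abs_mult mult.commute)
      then have "\<mu> s * \<mu> t \<le> L * L" using False st mb by (intro mult_mono) (auto simp: less_imp_le)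
      then show ?thesis using cs by (intro mult_right_mono) (auto simp: power2_eq_square)
    qed
  qed simp
  also have "\<dots> = L\<^sup>2 * (norm (x - y))\<^sup>2"
    unfolding power2_norm_eq_inner
    by (simp add: inner_simps xy inner_commute[of y x] power2_eq_square algebra_simps)
  finally show "(norm (\<mu> (norm x) *\<^sub>R x - \<mu> (norm y) *\<^sub>R y))\<^sup>2 \<le> (L * norm (x - y))\<^sup>2"
    by (simp add: s_t_def power_mult_distrib)
  show "0 \<le> L * norm (x - y)" using mb by simp
qed

text \<open>Half of the coercivity pays for the perturbation: each of the 16 pairs (i,j) takes
  \<kappa>/8, hence \<kappa>/2 per gradient after summing over j, and the complementary weight 2
  a^2/\<kappa> becomes 8 a^2/\<kappa> after summing over i.\<close>

lemma flux_estimate: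
  fixes g z :: "nat \<Rightarrow> 'a::real_inner"
  assumes m: "norm m = 1" and p: "\<bar>p\<bar> \<le> q" "q < 1" and D: "\<delta> \<le> D" "\<delta> > 0" "\<bar>D\<bar> \<le> DM"
  defines "\<kappa> \<equiv> \<delta> * (1 - q)" and "a \<equiv> DM / (1 - q\<^sup>2)"
  shows "\<kappa> / 2 * (\<Sum>i\<le>3. (norm (g i))\<^sup>2) - 8 * a\<^sup>2 / \<kappa> * (\<Sum>i\<le>3. (norm (z i))\<^sup>2)
    \<le> (\<Sum>i\<le>3. (\<Sum>j\<le>3. diffusion_matrix D p m i j *\<^sub>R (g j - z j)) \<bullet> g i)"
proof -
  have \<kappa>: "\<kappa> > 0" using p D by (simp add: \<kappa>_def)
  let ?A = "diffusion_matrix D p m"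
  have "(\<Sum>i\<le>3. (\<Sum>j\<le>3. ?A i j *\<^sub>R z j) \<bullet> g i) \<le> (\<Sum>i\<le>(3::nat). \<Sum>j\<le>(3::nat). \<kappa> / 8 * (norm (g i))\<^sup>2 + 2 * a\<^sup>2 / \<kappa> * (norm (z j))\<^sup>2)"
    unfolding inner_sum_left
  proof (intro sum_mono)
    fix i j :: nat
    have "?A i j *\<^sub>R z j \<bullet> g i \<le> \<bar>?A i j\<bar> * (norm (z j) * norm (g i))"
      using order_trans[OF abs_ge_self[of "?A i j * (z j \<bullet> g i)"]]
        mult_left_mono[OF Cauchy_Schwarz_ineq2[of "z j" "g i"] abs_ge_zero[of "?A i j"]]
      by (simp add: abs_mult)
    also have "\<dots> \<le> a * (norm (z j) * norm (g i))"
      unfolding a_def by (intro mult_right_mono diffusion_matrix_bound[OF m p D(3)]) auto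
    also have "\<dots> \<le> \<kappa> / 8 * (norm (g i))\<^sup>2 + 2 * a\<^sup>2 / \<kappa> * (norm (z j))\<^sup>2"
    proof -
      have "0 \<le> (\<kappa> * norm (g i) - 4 * a * norm (z j))\<^sup>2 / (8 * \<kappa>)" using \<kappa> by simp
      also have "\<dots> = \<kappa> / 8 * (norm (g i))\<^sup>2 + 2 * a\<^sup>2 / \<kappa> * (norm (z j))\<^sup>2 - a * (norm (z j) * norm (g i))"
        using \<kappa> by (simp add: power2_eq_square field_simps)
      finally show ?thesis by simp
    qed
    finally show "?A i j *\<^sub>R z j \<bullet> g i \<le> \<kappa> / 8 * (norm (g i))\<^sup>2 + 2 * a\<^sup>2 / \<kappa> * (norm (z j))\<^sup>2" .
  qed
  also have "\<dots> = \<kappa> / 2 * (\<Sum>i\<le>3. (norm (g i))\<^sup>2) + 8 * a\<^sup>2 / \<kappa> * (\<Sum>i\<le>3. (norm (z i))\<^sup>2)"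
    by (simp add: sum_atMost_3 algebra_simps)
  finally have "(\<Sum>i\<le>3. (\<Sum>j\<le>3. ?A i j *\<^sub>R z j) \<bullet> g i)
    \<le> \<kappa> / 2 * (\<Sum>i\<le>3. (norm (g i))\<^sup>2) + 8 * a\<^sup>2 / \<kappa> * (\<Sum>i\<le>3. (norm (z i))\<^sup>2)" .
  moreover have "\<kappa> * (\<Sum>i\<le>3. (norm (g i))\<^sup>2) \<le> (\<Sum>i\<le>3. (\<Sum>j\<le>3. ?A i j *\<^sub>R g j) \<bullet> g i)"
    unfolding \<kappa>_def by (rule diffusion_matrix_coercive[OF m p D(1,2)])
  moreover have "(\<Sum>i\<le>3. (\<Sum>j\<le>3. ?A i j *\<^sub>R (g j - z j)) \<bullet> g i)
      = (\<Sum>i\<le>3. (\<Sum>j\<le>3. ?A i j *\<^sub>R g j) \<bullet> g i) - (\<Sum>i\<le>3. (\<Sum>j\<le>3. ?A i j *\<^sub>R z j) \<bullet> g i)"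
    by (simp add: scaleR_diff_right sum_subtractf inner_diff_left)
  ultimately show ?thesis by linarith
qed

subsection \<open>Dissipation of the distance to the steady state\<close>

lemma Linf_bound:
  assumes "f \<in> Linf \<Omega>"
  obtains B where "B \<ge> 0" "AE x in lebesgue_on \<Omega>. \<bar>f x\<bar> \<le> B" "Linf_norm \<Omega> f = ennreal B"
proof -
  have "Linf_norm \<Omega> f < \<infinity>" using assms by (simp add: Linf_def)
  then obtain B where B: "B \<ge> 0" "Linf_norm \<Omega> f = ennreal B" by (cases "Linf_norm \<Omega> f") auto
  have "AE x in lebesgue_on \<Omega>. ennreal \<bar>f x\<bar> \<le> Linf_norm \<Omega> f" unfolding Linf_norm_def by (rule esssup_AE)
  then have "AE x in lebesgue_on \<Omega>. \<bar>f x\<bar> \<le> B" by eventually_elim (simp add: B)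
  then show ?thesis using that B by blast
qed

lemma L2_scaleR_bounded:
  fixes f :: "'a::euclidean_space \<Rightarrow> real"
  assumes "f \<in> borel_measurable (lebesgue_on S)" "AE x in lebesgue_on S. \<bar>f x\<bar> \<le> c" "g \<in> L2 S"
  shows "(\<lambda>x. f x *\<^sub>R g x) \<in> L2 S"
proof (rule L2_bound[OF _ assms(3), of _ c])
  show "(\<lambda>x. f x *\<^sub>R g x) \<in> borel_measurable (lebesgue_on S)"
    by (intro borel_measurable_scaleR assms L2_measurable)
  show "AE x in lebesgue_on S. norm (f x *\<^sub>R g x) \<le> c * norm (g x)"
    using assms(2) by eventually_elim (auto intro: mult_right_mono)
qed

lemma L2_sum: "finite I \<Longrightarrow> (\<And>i. i \<in> I \<Longrightarrow> f i \<in> L2 S) \<Longrightarrow> (\<lambda>x. \<Sum>i\<in>I. f i x) \<in> L2 S"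
  by (induction I rule: finite_induct) (auto intro: L2_add L2_zero)

lemma diffusion_matrix_measurable:
  assumes [measurable]: "D \<in> borel_measurable M" "p \<in> borel_measurable M" and m: "\<And>k. (\<lambda>x. m x $ k) \<in> borel_measurable M"
  shows "(\<lambda>x. diffusion_matrix (D x) (p x) (m x) i j) \<in> borel_measurable M"
proof -
  have [measurable]: "(\<lambda>x. m x $ k) \<in> borel_measurable M" for k by (rule m)
  show ?thesis unfolding diffusion_matrix_def Let_def by measurable
qed

lemma relaxation_matrix_measurable:
  assumes m: "\<And>k. (\<lambda>x. m x $ k) \<in> borel_measurable M"
  shows "(\<lambda>x. relaxation_matrix \<gamma> \<tau> (m x) i j) \<in> borel_measurable M"
proof -
  have [measurable]: "(\<lambda>x. m x $ k) \<in> borel_measurable M" for k by (rule m)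
  show ?thesis unfolding relaxation_matrix_def by measurable
qed

lemma mobility_measurable:
  assumes \<mu>: "mobility \<mu> v_sat L" and f: "f \<in> borel_measurable M"
  shows "(\<lambda>x. \<mu> (norm (f x))) \<in> borel_measurable M"
proof -
  \<comment> \<open>\<open>\<mu>\<close> is controlled only on the half-line; composing with
    \<open>max 0\<close> extends it continuously without changing its value at a norm.\<close>
  have "continuous_on UNIV (\<lambda>s. \<mu> (max 0 s))"
    by (intro continuous_on_compose2[OF mobility_bounds(6)[OF \<mu>]] continuous_intros) auto
  then have "(\<lambda>s. \<mu> (max 0 s)) \<in> borel_measurable borel" by (rule borel_measurable_continuous_onI)
  then have "(\<lambda>x. \<mu> (max 0 (norm (f x)))) \<in> borel_measurable M"
  proof (rule measurable_compose[rotated])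
    show "(\<lambda>x. norm (f x)) \<in> borel_measurable M" using f by measurable
  qed
  then show ?thesis by simp
qed

context
  fixes \<Omega> :: "'a::euclidean_space set"
  assumes op: "open \<Omega>" and bd: "bounded \<Omega>"
begin

text \<open>\<open>grad\<close> is only a chosen weak gradient, so uniqueness is what makes it
  vanish. This serves the spin components of the steady state, which are zero merely almost
  everywhere.\<close>

lemma grad_AE_zero:
  assumes u: "u \<in> H1 \<Omega>" and 0: "AE x in lebesgue_on \<Omega>. u x = 0"
  shows "AE x in lebesgue_on \<Omega>. grad \<Omega> u x = 0"
proof (rule weak_gradient_unique[OF op bd H1_grad(1)[OF u] L2_zero H1_grad(2)[OF u]])
  show "weak_gradient \<Omega> u (\<lambda>x. 0)"
    unfolding weak_gradient_def
  proof (intro allI impI ballI)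
    fix \<phi> :: "'a \<Rightarrow> real" and e :: 'a
    have "AE x in lebesgue_on \<Omega>. u x * pderiv_fn e \<phi> x = 0" using 0 by eventually_elim simp
    then have "(\<integral>x. u x * pderiv_fn e \<phi> x \<partial>lebesgue_on \<Omega>) = 0" by (rule integral_eq_zero_AE)
    then show "(\<integral>x. u x * pderiv_fn e \<phi> x \<partial>lebesgue_on \<Omega>) = - (\<integral>x. (0 \<bullet> e) * \<phi> x \<partial>lebesgue_on \<Omega>)" by simp
  qed
qed

lemma drift_measurable:
  assumes "mobility \<mu> v_sat L" "V \<in> H1 \<Omega>"
  shows "drift \<Omega> \<mu> V \<in> borel_measurable (lebesgue_on \<Omega>)"
proof -
  note g = L2_measurable[OF H1_grad(1)[OF assms(2)]]
  have "(\<lambda>x. (- \<mu> (norm (grad \<Omega> V x))) *\<^sub>R grad \<Omega> V x) \<in> borel_measurable (lebesgue_on \<Omega>)"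
    by (intro borel_measurable_scaleR borel_measurable_uminus mobility_measurable[OF assms(1)] g)
  then show ?thesis by (simp add: drift_def[abs_def])
qed

lemma drift_bound: "mobility \<mu> v_sat L \<Longrightarrow> norm (drift \<Omega> \<mu> V x) \<le> v_sat"
  using mobility_field_bound by (simp add: drift_def)

lemma drift_Lipschitz:
  "mobility \<mu> v_sat L \<Longrightarrow> norm (drift \<Omega> \<mu> V x - drift \<Omega> \<mu> W x) \<le> L * norm (grad \<Omega> V x - grad \<Omega> W x)"
  using mobility_field_Lipschitz[of \<mu> v_sat L "grad \<Omega> W x" "grad \<Omega> V x"]
  by (simp add: drift_def norm_minus_commute)

text \<open>Both Poisson equations are tested with V - V', and the doping profile cancels. The 2
  comes from the source 2 n, the \<open>c\<close> from Poincare's inequality.\<close>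

lemma potential_estimate:
  assumes c: "c > 0" "\<And>u. u \<in> H10 \<Omega> \<Longrightarrow> L2_norm \<Omega> u \<le> c * L2_norm \<Omega> (grad \<Omega> u)"
    and C: "C \<in> L2 \<Omega>" and n: "n \<in> L2 \<Omega>" "n' \<in> L2 \<Omega>" and V: "V \<in> H1 \<Omega>" "V' \<in> H1 \<Omega>" "V - V' \<in> H10 \<Omega>"
    and eq: "poisson_equation \<Omega> lam C n V" "poisson_equation \<Omega> lam C n' V'" and lam: "lam > 0"
  shows "L2_norm \<Omega> (\<lambda>x. grad \<Omega> V x - grad \<Omega> V' x) \<le> 2 * c / lam\<^sup>2 * L2_norm \<Omega> (n - n')"
proof -
  define \<phi> where "\<phi> = V - V'"
  have \<phi>: "\<phi> \<in> H10 \<Omega>" "\<phi> \<in> H1 \<Omega>" "\<phi> \<in> L2 \<Omega>" using V H10_H1 H1_L2 by (auto simp: \<phi>_def)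
  note gr = H1_grad(1)[OF V(1)] H1_grad(1)[OF V(2)] H1_grad(1)[OF \<phi>(2)]
  define N where "N = L2_norm \<Omega> (grad \<Omega> \<phi>)"
  have geq: "AE x in lebesgue_on \<Omega>. grad \<Omega> \<phi> x = grad \<Omega> V x - grad \<Omega> V' x"
    unfolding \<phi>_def by (rule H1_diff(2)[OF op bd V(1,2)])
  have N: "L2_norm \<Omega> (\<lambda>x. grad \<Omega> V x - grad \<Omega> V' x) = N"
    unfolding N_def by (rule L2_norm_cong_AE[symmetric])
      (use geq in \<open>auto intro!: L2_measurable L2_diff gr\<close>)
  have "lam\<^sup>2 * N\<^sup>2 = lam\<^sup>2 * (\<integral>x. (grad \<Omega> V x - grad \<Omega> V' x) \<bullet> grad \<Omega> \<phi> x \<partial>lebesgue_on \<Omega>)"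
  proof -
    have "N\<^sup>2 = (\<integral>x. (norm (grad \<Omega> \<phi> x))\<^sup>2 \<partial>lebesgue_on \<Omega>)" by (simp add: N_def L2_norm_sq)
    also have "\<dots> = (\<integral>x. (grad \<Omega> V x - grad \<Omega> V' x) \<bullet> grad \<Omega> \<phi> x \<partial>lebesgue_on \<Omega>)"
    proof (rule Bochner_Integration.integral_cong_AE)
      show "(\<lambda>x. (norm (grad \<Omega> \<phi> x))\<^sup>2) \<in> borel_measurable (lebesgue_on \<Omega>)"
        using L2_integrable_square[OF gr(3)] by (rule borel_measurable_integrable)
      show "(\<lambda>x. (grad \<Omega> V x - grad \<Omega> V' x) \<bullet> grad \<Omega> \<phi> x) \<in> borel_measurable (lebesgue_on \<Omega>)"
        using L2_inner_integrable[OF L2_diff[OF gr(1,2)] gr(3)] by (rule borel_measurable_integrable)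
      show "AE x in lebesgue_on \<Omega>. (norm (grad \<Omega> \<phi> x))\<^sup>2 = (grad \<Omega> V x - grad \<Omega> V' x) \<bullet> grad \<Omega> \<phi> x"
        using geq by eventually_elim (simp add: power2_norm_eq_inner)
    qed
    finally show ?thesis by simp
  qed
  also have "\<dots> = lam\<^sup>2 * (\<integral>x. grad \<Omega> V x \<bullet> grad \<Omega> \<phi> x \<partial>lebesgue_on \<Omega>) - lam\<^sup>2 * (\<integral>x. grad \<Omega> V' x \<bullet> grad \<Omega> \<phi> x \<partial>lebesgue_on \<Omega>)"
    using L2_inner_integrable[OF gr(1,3)] L2_inner_integrable[OF gr(2,3)] by (simp add: inner_diff_left right_diff_distrib)
  also have "\<dots> = (\<integral>x. (2 * n x - C x) * \<phi> x \<partial>lebesgue_on \<Omega>) - (\<integral>x. (2 * n' x - C x) * \<phi> x \<partial>lebesgue_on \<Omega>)"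
    using eq \<phi>(1) by (simp add: poisson_equation_def)
  also have "\<dots> = (\<integral>x. (2 * n x - C x) * \<phi> x - (2 * n' x - C x) * \<phi> x \<partial>lebesgue_on \<Omega>)"
    by (intro Bochner_Integration.integral_diff[symmetric] L2_mult_integrable L2_diff L2_cmult n C \<phi>)
  also have "\<dots> = (\<integral>x. 2 * ((n - n') x * \<phi> x) \<partial>lebesgue_on \<Omega>)"
    by (intro Bochner_Integration.integral_cong refl) (simp add: algebra_simps)
  also have "\<dots> = 2 * L2_inner \<Omega> (n - n') \<phi>" by (simp add: L2_inner_def)
  also have "\<dots> \<le> 2 * (L2_norm \<Omega> (n - n') * L2_norm \<Omega> \<phi>)"
    using L2_inner_Cauchy_Schwarz[OF L2_fun_diff[OF n] \<phi>(3)] by linarith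
  also have "\<dots> \<le> 2 * (L2_norm \<Omega> (n - n') * (c * N))"
    unfolding N_def by (intro mult_left_mono c \<phi> L2_norm_nonneg) auto
  finally have *: "lam\<^sup>2 * N * N \<le> 2 * c * L2_norm \<Omega> (n - n') * N" by (simp add: power2_eq_square algebra_simps)
  have "lam\<^sup>2 * N \<le> 2 * c * L2_norm \<Omega> (n - n')"
  proof (cases "N = 0")
    case True
    then show ?thesis using c L2_norm_nonneg[of \<Omega> "n - n'"] by simp
  next
    case False
    then have "N > 0" using L2_norm_nonneg[of \<Omega> "grad \<Omega> \<phi>"] by (simp add: N_def)
    with * show ?thesis by simp
  qed
  then show ?thesis unfolding N using lam by (simp add: field_simps)
qed

text \<open>Since the steady flux vanishes, grad n - n v = grad w - z with z = n v - n_e v_e.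
  Coercivity leaves \<kappa>/2 |grad w|^2, hence \<kappa>/(2 c^2) |w|^2 by Poincare, and the
  assumptions on \<open>K\<close> allow \<open>z\<close> to consume half of this. In 16 a^2/\<kappa>
  a factor 2 comes from squaring a sum of two terms; 1 + 4 c^2 collects the bound of v and the
  potential estimate.\<close>

lemma energy_dissipation:
  fixes D p :: "'a \<Rightarrow> real" and n ne :: "nat \<Rightarrow> 'a \<Rightarrow> real" and m :: "'a \<Rightarrow> real^3"
  assumes c: "c > 0" "\<And>u. u \<in> H10 \<Omega> \<Longrightarrow> L2_norm \<Omega> u \<le> c * L2_norm \<Omega> (grad \<Omega> u)"
    and D: "D \<in> borel_measurable (lebesgue_on \<Omega>)" "AE x in lebesgue_on \<Omega>. \<delta> \<le> D x" "AE x in lebesgue_on \<Omega>. \<bar>D x\<bar> \<le> DM" "\<delta> > 0"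
    and p: "p \<in> borel_measurable (lebesgue_on \<Omega>)" "AE x in lebesgue_on \<Omega>. \<bar>p x\<bar> \<le> q" "q < 1"
    and m: "\<And>k. (\<lambda>x. m x $ k) \<in> borel_measurable (lebesgue_on \<Omega>)" "AE x in lebesgue_on \<Omega>. norm (m x) = 1"
    and n: "\<And>j. j \<le> 3 \<Longrightarrow> n j \<in> H1 \<Omega>" and ne: "\<And>j. j \<le> 3 \<Longrightarrow> ne j \<in> H1 \<Omega>"
    and w: "\<And>j. j \<le> 3 \<Longrightarrow> n j - ne j \<in> H10 \<Omega>"
    and V: "V \<in> H1 \<Omega>" "V' \<in> H1 \<Omega>" "V - V' \<in> H10 \<Omega>" and C: "C \<in> L2 \<Omega>"
    and eq: "poisson_equation \<Omega> lam C (n 0) V" "poisson_equation \<Omega> lam C (ne 0) V'" and lam: "lam > 0"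
    and \<mu>: "mobility \<mu> v_sat L" and \<tau>: "\<tau> > 0"
    and st: "AE x in lebesgue_on \<Omega>. grad \<Omega> (ne 0) x + (ne 0 x * \<mu> (norm (grad \<Omega> V' x))) *\<^sub>R grad \<Omega> V' x = 0"
      "\<And>j. j \<in> {1..3} \<Longrightarrow> AE x in lebesgue_on \<Omega>. ne j x = 0"
    and B: "AE x in lebesgue_on \<Omega>. \<bar>ne 0 x\<bar> \<le> B"
  defines "\<kappa> \<equiv> \<delta> * (1 - q)" and "a \<equiv> DM / (1 - q\<^sup>2)"
  assumes K: "v_sat\<^sup>2 \<le> K" "L\<^sup>2 / lam ^ 4 * B\<^sup>2 \<le> K" "16 * a\<^sup>2 / \<kappa> * (1 + 4 * c\<^sup>2) * K \<le> \<kappa> / (4 * c\<^sup>2)"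
  shows "(\<Sum>i\<le>3. - (\<integral>x. (\<Sum>j\<le>3. diffusion_matrix (D x) (p x) (m x) i j *\<^sub>R
                       (grad \<Omega> (n j) x - n j x *\<^sub>R drift \<Omega> \<mu> V x)) \<bullet> grad \<Omega> (n i - ne i) x
                \<partial>lebesgue_on \<Omega>)
           + (\<integral>x. (\<Sum>j\<le>3. relaxation_matrix \<gamma> \<tau> (m x) i j * n j x) * (n i - ne i) x
                \<partial>lebesgue_on \<Omega>))
    \<le> - (\<kappa> / (4 * c\<^sup>2)) * (\<Sum>i\<le>3. (L2_norm \<Omega> (n i - ne i))\<^sup>2)"
proof -
  let ?M = "lebesgue_on \<Omega>"
  define f where "f i x = (\<Sum>j\<le>3. diffusion_matrix (D x) (p x) (m x) i j *\<^sub>R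
                       (grad \<Omega> (n j) x - n j x *\<^sub>R drift \<Omega> \<mu> V x))" for i x
  define r where "r i x = (\<Sum>j\<le>3. relaxation_matrix \<gamma> \<tau> (m x) i j * n j x)" for i x
  define gw where "gw i = grad \<Omega> (n i - ne i)" for i
  define z where "z j x = n j x *\<^sub>R drift \<Omega> \<mu> V x - ne j x *\<^sub>R drift \<Omega> \<mu> V' x" for j x
  define gV where "gV x = grad \<Omega> V x - grad \<Omega> V' x" for x
  have \<kappa>: "\<kappa> > 0" using D(4) p(3) by (simp add: \<kappa>_def)
  have wL2: "n j - ne j \<in> L2 \<Omega>" if "j \<le> 3" for j using w[OF that] H10_H1 H1_L2 by auto
  have gwL2: "gw j \<in> L2 \<Omega>" if "j \<le> 3" for j unfolding gw_def by (intro H1_grad H10_H1 w that)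
  have gVL2: "gV \<in> L2 \<Omega>" unfolding gV_def by (intro L2_diff H1_grad V)
  have vb: "norm (drift \<Omega> \<mu> U x) \<le> v_sat" for U :: "'a \<Rightarrow> real" and x by (rule drift_bound[OF \<mu>])
  have nv: "(\<lambda>x. n j x *\<^sub>R drift \<Omega> \<mu> V x) \<in> L2 \<Omega>" if "j \<le> 3" for j
  proof (rule L2_bound[OF _ H1_L2[OF n[OF that]], of _ v_sat])
    show "(\<lambda>x. n j x *\<^sub>R drift \<Omega> \<mu> V x) \<in> borel_measurable ?M"
      by (intro borel_measurable_scaleR L2_measurable H1_L2 n that drift_measurable[OF \<mu>] V)
    show "AE x in ?M. norm (n j x *\<^sub>R drift \<Omega> \<mu> V x) \<le> v_sat * norm (n j x)"
      using vb by (intro AE_I2) (auto simp: mult.commute[of _ "\<bar>n j _\<bar>"] intro: mult_left_mono)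
  qed
  have fL2: "f i \<in> L2 \<Omega>" for i
    unfolding f_def
  proof (intro L2_sum L2_scaleR_bounded[where c = a])
    show "(\<lambda>x. diffusion_matrix (D x) (p x) (m x) i j) \<in> borel_measurable ?M" for j
      by (intro diffusion_matrix_measurable D p m)
    show "AE x in ?M. \<bar>diffusion_matrix (D x) (p x) (m x) i j\<bar> \<le> a" for j
      using D(3) p(2) m(2) unfolding a_def by eventually_elim (rule diffusion_matrix_bound[OF _ _ p(3)])
  qed (auto intro!: L2_diff H1_grad n nv)
  have rL2: "r i \<in> L2 \<Omega>" for i
  proof -
    have "(\<lambda>x. \<Sum>j\<le>3. relaxation_matrix \<gamma> \<tau> (m x) i j *\<^sub>R n j x) \<in> L2 \<Omega>"
    proof (intro L2_sum L2_scaleR_bounded[where c = "6 * \<bar>\<gamma>\<bar> + \<bar>1 / \<tau>\<bar>"])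
      show "AE x in ?M. \<bar>relaxation_matrix \<gamma> \<tau> (m x) i j\<bar> \<le> 6 * \<bar>\<gamma>\<bar> + \<bar>1 / \<tau>\<bar>" for j
        using m(2) by eventually_elim (rule relaxation_matrix_bound)
    qed (auto intro!: relaxation_matrix_measurable m H1_L2 n)
    then show ?thesis by (simp add: r_def[abs_def])
  qed
  have i1: "integrable ?M (\<lambda>x. f i x \<bullet> gw i x)" and i2: "integrable ?M (\<lambda>x. r i x * (n i - ne i) x)" if "i \<le> 3" for i
    using that by (intro L2_inner_integrable L2_mult_integrable fL2 gwL2 rL2 wL2; simp)+
  have i3: "integrable ?M (\<lambda>x. (norm (gw i x))\<^sup>2)" and i4: "integrable ?M (\<lambda>x. ((n i - ne i) x)\<^sup>2)" if "i \<le> 3" for i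
    using L2_integrable_square[OF gwL2[OF that]] L2_integrable_square[OF wL2[OF that]] by auto
  have i5: "integrable ?M (\<lambda>x. (norm (gV x))\<^sup>2)" by (rule L2_integrable_square[OF gVL2])
  have neg: "AE x in ?M. \<forall>j\<le>3. grad \<Omega> (ne j) x = ne j x *\<^sub>R drift \<Omega> \<mu> V' x"
  proof -
    have "AE x in ?M. grad \<Omega> (ne 0) x = ne 0 x *\<^sub>R drift \<Omega> \<mu> V' x"
      using st(1) by eventually_elim (simp add: drift_def eq_neg_iff_add_eq_0)
    moreover have "AE x in ?M. grad \<Omega> (ne j) x = ne j x *\<^sub>R drift \<Omega> \<mu> V' x" if "j \<in> {1..3}" for j
      using st(2)[OF that] grad_AE_zero[OF ne st(2)[OF that]] that by (auto elim: eventually_elim2)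
    ultimately have "AE x in ?M. grad \<Omega> (ne j) x = ne j x *\<^sub>R drift \<Omega> \<mu> V' x" if "j \<in> {..3}" for j
      using that by (cases "j = 0") auto
    then have "AE x in ?M. \<forall>j\<in>{..3}. grad \<Omega> (ne j) x = ne j x *\<^sub>R drift \<Omega> \<mu> V' x"
      by (intro AE_finite_allI) auto
    then show ?thesis by eventually_elim auto
  qed
  have gwe: "AE x in ?M. \<forall>j\<le>3. gw j x = grad \<Omega> (n j) x - grad \<Omega> (ne j) x"
  proof -
    have "AE x in ?M. \<forall>j\<in>{..3}. gw j x = grad \<Omega> (n j) x - grad \<Omega> (ne j) x"
      unfolding gw_def by (intro AE_finite_allI H1_diff(2)[OF op bd]) (auto intro: n ne)
    then show ?thesis by eventually_elim auto
  qed
  have ne0: "AE x in ?M. \<forall>j\<in>{1..3}. ne j x = 0" using st(2) by (intro AE_finite_allI) auto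
  let ?R = "\<lambda>x. - (\<kappa> / 2) * (\<Sum>i\<le>3. (norm (gw i x))\<^sup>2)
      + 16 * a\<^sup>2 / \<kappa> * (v_sat\<^sup>2 * (\<Sum>i\<le>3. ((n i - ne i) x)\<^sup>2) + B\<^sup>2 * L\<^sup>2 * (norm (gV x))\<^sup>2)"
  have point: "AE x in ?M. (\<Sum>i\<le>3. - (f i x \<bullet> gw i x) + r i x * (n i - ne i) x) \<le> ?R x"
    using D(2,3) p(2) m(2) neg gwe ne0 B
  proof eventually_elim
    case (elim x)
    have g: "grad \<Omega> (n j) x - n j x *\<^sub>R drift \<Omega> \<mu> V x = gw j x - z j x" if "j \<le> 3" for j
      using elim that by (simp add: z_def)
    have "f i x = (\<Sum>j\<le>3. diffusion_matrix (D x) (p x) (m x) i j *\<^sub>R (gw j x - z j x))" for i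
      unfolding f_def by (intro sum.cong refl) (simp add: g)
    then have 1: "\<kappa> / 2 * (\<Sum>i\<le>3. (norm (gw i x))\<^sup>2) - 8 * a\<^sup>2 / \<kappa> * (\<Sum>i\<le>3. (norm (z i x))\<^sup>2) \<le> (\<Sum>i\<le>3. f i x \<bullet> gw i x)"
      using flux_estimate[OF \<open>norm (m x) = 1\<close> \<open>\<bar>p x\<bar> \<le> q\<close> p(3) \<open>\<delta> \<le> D x\<close> D(4) \<open>\<bar>D x\<bar> \<le> DM\<close>,
        of "\<lambda>i. gw i x" "\<lambda>i. z i x"] by (simp add: \<kappa>_def a_def)
    \<comment> \<open>\<open>n\<close> may be replaced by \<open>n - ne\<close>: the column j = 0 of
      the matrix is zero, and the other components of \<open>ne\<close> vanish at
      \<open>x\<close>.\<close>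
    have "r i x = (\<Sum>j\<le>3. relaxation_matrix \<gamma> \<tau> (m x) i j * (n j - ne j) x)" for i
      unfolding r_def
    proof (intro sum.cong refl)
      fix j :: nat assume "j \<in> {..3}"
      then show "relaxation_matrix \<gamma> \<tau> (m x) i j * n j x = relaxation_matrix \<gamma> \<tau> (m x) i j * (n j - ne j) x"
        using elim(7) by (cases "j = 0") (auto simp: relaxation_matrix_def)
    qed
    then have 2: "(\<Sum>i\<le>3. r i x * (n i - ne i) x) \<le> 0"
      using relaxation_matrix_dissipative[OF \<tau>, of \<gamma> "m x" "\<lambda>j. (n j - ne j) x"] by simp
    have zj: "(norm (z j x))\<^sup>2 \<le> 2 * v_sat\<^sup>2 * ((n j - ne j) x)\<^sup>2 + (if j = 0 then 2 * B\<^sup>2 * L\<^sup>2 * (norm (gV x))\<^sup>2 else 0)"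
      if "j \<le> 3" for j
    proof -
      define s where "s = \<bar>(n j - ne j) x\<bar> * v_sat"
      define t where "t = (if j = 0 then B * (L * norm (gV x)) else 0)"
      \<comment> \<open>Writing z as w v + n_e (v - v_e) separates the saturation bound from the
        Lipschitz bound; the second term survives only for the charge density j = 0.\<close>
      have "z j x = (n j - ne j) x *\<^sub>R drift \<Omega> \<mu> V x + ne j x *\<^sub>R (drift \<Omega> \<mu> V x - drift \<Omega> \<mu> V' x)"
        by (simp add: z_def algebra_simps)
      then have "norm (z j x) \<le> \<bar>(n j - ne j) x\<bar> * norm (drift \<Omega> \<mu> V x) + \<bar>ne j x\<bar> * norm (drift \<Omega> \<mu> V x - drift \<Omega> \<mu> V' x)"
        using norm_triangle_ineq[of "(n j - ne j) x *\<^sub>R drift \<Omega> \<mu> V x" "ne j x *\<^sub>R (drift \<Omega> \<mu> V x - drift \<Omega> \<mu> V' x)"] by simp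
      also have "\<dots> \<le> s + t"
      proof (intro add_mono)
        show "\<bar>(n j - ne j) x\<bar> * norm (drift \<Omega> \<mu> V x) \<le> s" unfolding s_def by (intro mult_left_mono vb) simp
        show "\<bar>ne j x\<bar> * norm (drift \<Omega> \<mu> V x - drift \<Omega> \<mu> V' x) \<le> t"
        proof (cases "j = 0")
          case True
          then show ?thesis using elim(8) drift_Lipschitz[OF \<mu>, of V x V'] by (auto simp: t_def gV_def intro!: mult_mono)
        next
          case False
          then show ?thesis using elim(7) that by (auto simp: t_def)
        qed
      qed
      finally have "(norm (z j x))\<^sup>2 \<le> (s + t)\<^sup>2" by (intro power_mono) auto
      also have "\<dots> \<le> 2 * s\<^sup>2 + 2 * t\<^sup>2" using sum_squares_bound[of s t] by (simp add: power2_sum)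
      finally show ?thesis by (cases "j = 0") (simp_all add: s_def t_def power_mult_distrib mult_ac)
    qed
    have "(\<Sum>j\<le>3. (norm (z j x))\<^sup>2) \<le> (\<Sum>j\<le>3. 2 * v_sat\<^sup>2 * ((n j - ne j) x)\<^sup>2 + (if j = 0 then 2 * B\<^sup>2 * L\<^sup>2 * (norm (gV x))\<^sup>2 else 0))"
      by (intro sum_mono zj) auto
    also have "\<dots> = 2 * (v_sat\<^sup>2 * (\<Sum>i\<le>3. ((n i - ne i) x)\<^sup>2) + B\<^sup>2 * L\<^sup>2 * (norm (gV x))\<^sup>2)"
      unfolding sum_atMost_3 by (simp add: algebra_simps)
    finally have "8 * a\<^sup>2 / \<kappa> * (\<Sum>j\<le>3. (norm (z j x))\<^sup>2)
        \<le> 8 * a\<^sup>2 / \<kappa> * (2 * (v_sat\<^sup>2 * (\<Sum>i\<le>3. ((n i - ne i) x)\<^sup>2) + B\<^sup>2 * L\<^sup>2 * (norm (gV x))\<^sup>2))"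
      using \<kappa> by (intro mult_left_mono) auto
    also have "\<dots> = 16 * a\<^sup>2 / \<kappa> * (v_sat\<^sup>2 * (\<Sum>i\<le>3. ((n i - ne i) x)\<^sup>2) + B\<^sup>2 * L\<^sup>2 * (norm (gV x))\<^sup>2)"
      by simp
    finally have "- (\<Sum>i\<le>3. f i x \<bullet> gw i x) + (\<Sum>i\<le>3. r i x * (n i - ne i) x) \<le> ?R x"
      using 1 2 by linarith
    then show ?case by (simp only: sum.distrib sum_negf)
  qed
  have "(\<Sum>i\<le>3. - (\<integral>x. f i x \<bullet> gw i x \<partial>?M) + (\<integral>x. r i x * (n i - ne i) x \<partial>?M))
      = (\<integral>x. (\<Sum>i\<le>3. - (f i x \<bullet> gw i x) + r i x * (n i - ne i) x) \<partial>?M)"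
    using i1 i2 by (subst Bochner_Integration.integral_sum) auto
  also have "\<dots> \<le> (\<integral>x. ?R x \<partial>?M)"
    using i1 i2 i3 i4 i5 point
    by (intro integral_mono_AE Bochner_Integration.integrable_add Bochner_Integration.integrable_sum
        integrable_mult_right Bochner_Integration.integrable_minus) auto
  also have "\<dots> = - (\<kappa> / 2) * (\<Sum>i\<le>3. (L2_norm \<Omega> (gw i))\<^sup>2)
      + 16 * a\<^sup>2 / \<kappa> * (v_sat\<^sup>2 * (\<Sum>i\<le>3. (L2_norm \<Omega> (n i - ne i))\<^sup>2) + B\<^sup>2 * L\<^sup>2 * (L2_norm \<Omega> gV)\<^sup>2)"
  proof -
    have s1: "(\<integral>x. (\<Sum>i\<le>3. (norm (gw i x))\<^sup>2) \<partial>?M) = (\<Sum>i\<le>3. (L2_norm \<Omega> (gw i))\<^sup>2)"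
      using i3 by (subst Bochner_Integration.integral_sum) (auto simp: L2_norm_sq)
    have s2: "(\<integral>x. (\<Sum>i\<le>3. ((n i - ne i) x)\<^sup>2) \<partial>?M) = (\<Sum>i\<le>3. (L2_norm \<Omega> (n i - ne i))\<^sup>2)"
      using i4 by (subst Bochner_Integration.integral_sum) (auto simp: L2_norm_sq)
    have j1: "integrable ?M (\<lambda>x. \<Sum>i\<le>3. (norm (gw i x))\<^sup>2)" "integrable ?M (\<lambda>x. \<Sum>i\<le>3. ((n i - ne i) x)\<^sup>2)"
      using i3 i4 by (auto intro!: Bochner_Integration.integrable_sum)
    have s3: "(\<integral>x. (norm (gV x))\<^sup>2 \<partial>?M) = (L2_norm \<Omega> gV)\<^sup>2" by (simp add: L2_norm_sq)
    show ?thesis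
      using j1 i5 by (simp add: s1 s2 s3 del: minus_apply)
  qed
  finally have E: "(\<Sum>i\<le>3. - (\<integral>x. f i x \<bullet> gw i x \<partial>?M) + (\<integral>x. r i x * (n i - ne i) x \<partial>?M))
    \<le> - (\<kappa> / 2) * (\<Sum>i\<le>3. (L2_norm \<Omega> (gw i))\<^sup>2)
      + 16 * a\<^sup>2 / \<kappa> * (v_sat\<^sup>2 * (\<Sum>i\<le>3. (L2_norm \<Omega> (n i - ne i))\<^sup>2) + B\<^sup>2 * L\<^sup>2 * (L2_norm \<Omega> gV)\<^sup>2)" .
  define W where "W = (\<Sum>i\<le>3. (L2_norm \<Omega> (n i - ne i))\<^sup>2)"
  have W0: "W \<ge> 0" by (auto simp: W_def intro: sum_nonneg)
  have Kn: "K \<ge> 0" using K(1) zero_le_power2 order_trans by blast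
  have P: "W \<le> c\<^sup>2 * (\<Sum>i\<le>3. (L2_norm \<Omega> (gw i))\<^sup>2)"
    unfolding W_def sum_distrib_left
  proof (intro sum_mono)
    fix i :: nat assume "i \<in> {..3}"
    then have "L2_norm \<Omega> (n i - ne i) \<le> c * L2_norm \<Omega> (gw i)" unfolding gw_def using c(2) w by auto
    then have "(L2_norm \<Omega> (n i - ne i))\<^sup>2 \<le> (c * L2_norm \<Omega> (gw i))\<^sup>2" by (intro power_mono L2_norm_nonneg)
    then show "(L2_norm \<Omega> (n i - ne i))\<^sup>2 \<le> c\<^sup>2 * (L2_norm \<Omega> (gw i))\<^sup>2" by (simp add: power_mult_distrib)
  qed
  have "B\<^sup>2 * L\<^sup>2 * (L2_norm \<Omega> gV)\<^sup>2 \<le> 4 * c\<^sup>2 * K * W"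
  proof -
    have "L2_norm \<Omega> gV \<le> 2 * c / lam\<^sup>2 * L2_norm \<Omega> (n 0 - ne 0)"
      unfolding gV_def by (rule potential_estimate[OF c C _ _ V eq lam]) (auto intro: H1_L2 n ne)
    then have "(L2_norm \<Omega> gV)\<^sup>2 \<le> (2 * c / lam\<^sup>2 * L2_norm \<Omega> (n 0 - ne 0))\<^sup>2" by (intro power_mono L2_norm_nonneg)
    \<comment> \<open>Squaring the constant of the potential estimate yields lam^-4, the power in
      the smallness condition, so \<open>K\<close> can absorb L^2 lam^-4 B^2.\<close>
    also have "\<dots> = 4 * c\<^sup>2 / lam ^ 4 * (L2_norm \<Omega> (n 0 - ne 0))\<^sup>2"
      by (simp add: power_mult_distrib power_divide flip: power_mult)
    also have "\<dots> \<le> 4 * c\<^sup>2 / lam ^ 4 * W"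
      unfolding W_def by (intro mult_left_mono member_le_sum[of "0::nat" "{..3}" "\<lambda>i. (L2_norm \<Omega> (n i - ne i))\<^sup>2"]) auto
    finally have "B\<^sup>2 * L\<^sup>2 * (L2_norm \<Omega> gV)\<^sup>2 \<le> B\<^sup>2 * L\<^sup>2 * (4 * c\<^sup>2 / lam ^ 4 * W)" by (rule mult_left_mono) simp
    also have "\<dots> = (L\<^sup>2 / lam ^ 4 * B\<^sup>2) * (4 * c\<^sup>2 * W)" by (simp add: field_simps)
    also have "\<dots> \<le> K * (4 * c\<^sup>2 * W)" using W0 by (intro mult_right_mono K) auto
    finally show ?thesis by (simp add: mult_ac)
  qed
  moreover have "v_sat\<^sup>2 * W \<le> K * W" by (intro mult_right_mono K W0)
  ultimately have "v_sat\<^sup>2 * W + B\<^sup>2 * L\<^sup>2 * (L2_norm \<Omega> gV)\<^sup>2 \<le> (1 + 4 * c\<^sup>2) * K * W" by (simp add: algebra_simps)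
  then have "16 * a\<^sup>2 / \<kappa> * (v_sat\<^sup>2 * W + B\<^sup>2 * L\<^sup>2 * (L2_norm \<Omega> gV)\<^sup>2) \<le> 16 * a\<^sup>2 / \<kappa> * ((1 + 4 * c\<^sup>2) * K * W)"
    using \<kappa> by (intro mult_left_mono) auto
  also have "\<dots> = (16 * a\<^sup>2 / \<kappa> * (1 + 4 * c\<^sup>2) * K) * W" by (simp add: mult.assoc)
  also have "\<dots> \<le> \<kappa> / (4 * c\<^sup>2) * W" by (intro mult_right_mono K W0)
  finally have "16 * a\<^sup>2 / \<kappa> * (v_sat\<^sup>2 * W + B\<^sup>2 * L\<^sup>2 * (L2_norm \<Omega> gV)\<^sup>2) \<le> \<kappa> / (4 * c\<^sup>2) * W" .
  moreover have "\<kappa> / (2 * c\<^sup>2) * W \<le> \<kappa> / 2 * (\<Sum>i\<le>3. (L2_norm \<Omega> (gw i))\<^sup>2)"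
  proof -
    have "\<kappa> / (2 * c\<^sup>2) * W \<le> \<kappa> / (2 * c\<^sup>2) * (c\<^sup>2 * (\<Sum>i\<le>3. (L2_norm \<Omega> (gw i))\<^sup>2))"
      using \<kappa> by (intro mult_left_mono P) auto
    then show ?thesis using c(1) by simp
  qed
  \<comment> \<open>One half of the dissipation absorbs the perturbation, the other half is the rate
    that remains.\<close>
  moreover have "\<kappa> / (2 * c\<^sup>2) * W = \<kappa> / (4 * c\<^sup>2) * W + \<kappa> / (4 * c\<^sup>2) * W" by simp
  ultimately have "- (\<kappa> / 2) * (\<Sum>i\<le>3. (L2_norm \<Omega> (gw i))\<^sup>2)
      + 16 * a\<^sup>2 / \<kappa> * (v_sat\<^sup>2 * W + B\<^sup>2 * L\<^sup>2 * (L2_norm \<Omega> gV)\<^sup>2) \<le> - (\<kappa> / (4 * c\<^sup>2)) * W" by linarith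
  with E show ?thesis unfolding f_def r_def gw_def W_def by linarith
qed

end

subsection \<open>Decay of the solution\<close>

lemma AE_lebesgue_on_subset:
  assumes "AE x in lebesgue_on S. P x" "T \<subseteq> S" "S \<in> sets lebesgue" "T \<in> sets lebesgue"
  shows "AE x in lebesgue_on T. P x"
  using assms by (subst (asm) AE_restrict_space_iff, simp, subst AE_restrict_space_iff) (auto elim: eventually_mono)

text \<open>Young's inequality with weight \<open>l\<close>, followed by (2a + b + c)^2 \<le> 12
  (a^2 + b^2 + c^2). In its application x is a dual norm, a the translation error at the running
  time, counted once for each end of the interval, and b, c are the errors at the ends.\<close>

lemma product_le_weighted_squares:
  fixes x y a b c :: real
  assumes "l > 0"
  shows "x * (2 * a + b + c) \<le> l * x\<^sup>2 + 3 / l * (a\<^sup>2 + b\<^sup>2 + c\<^sup>2)"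
proof -
  define s where "s = 2 * a + b + c"
  have "0 \<le> (2 * l * x - s)\<^sup>2 / (4 * l)" using assms by simp
  also have "\<dots> = l * x\<^sup>2 + s\<^sup>2 / (4 * l) - x * s"
    using assms by (simp add: power2_eq_square field_simps)
  finally have "x * s \<le> l * x\<^sup>2 + s\<^sup>2 / (4 * l)" by simp
  moreover have "s\<^sup>2 \<le> 12 * (a\<^sup>2 + b\<^sup>2 + c\<^sup>2)"
  proof -
    have "12 * (a\<^sup>2 + b\<^sup>2 + c\<^sup>2) - s\<^sup>2 = 2 * (a - b)\<^sup>2 + 2 * (a - c)\<^sup>2 + (b - c)\<^sup>2 + 4 * a\<^sup>2 + 8 * b\<^sup>2 + 8 * c\<^sup>2"
      by (simp add: s_def power2_eq_square algebra_simps)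
    moreover have "\<dots> \<ge> 0" by simp
    ultimately show ?thesis by linarith
  qed
  then have "s\<^sup>2 / (4 * l) \<le> 12 * (a\<^sup>2 + b\<^sup>2 + c\<^sup>2) / (4 * l)" using assms by (intro divide_right_mono) auto
  moreover have "12 * (a\<^sup>2 + b\<^sup>2 + c\<^sup>2) / (4 * l) = 3 / l * (a\<^sup>2 + b\<^sup>2 + c\<^sup>2)"
    using assms by (simp add: field_simps)
  ultimately show ?thesis unfolding s_def by linarith
qed

context
  fixes \<Omega> :: "'a::euclidean_space set"
  assumes op: "open \<Omega>" and bd: "bounded \<Omega>"
begin

text \<open>The factorization \<open>|a|\<^sup>2 - |b|\<^sup>2 = (a - b, a + b)\<close> replaces the chain rule for \<open>|w|\<^sup>2\<close>.\<close>

lemma energy_increment: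
  assumes n: "H1_time_Hminus1 \<Omega> T n n'" and nL2: "\<And>t. t \<ge> 0 \<Longrightarrow> n t \<in> L2 \<Omega>"
    and c: "\<And>\<phi>. \<phi> \<in> H10 \<Omega> \<Longrightarrow> continuous_on {0..} (\<lambda>t. L2_inner \<Omega> (n t) \<phi>)"
    and ne: "ne \<in> L2 \<Omega>" and st: "0 < s" "s \<le> t" "t < T"
    and w: "n s - ne \<in> H10 \<Omega>" "n t - ne \<in> H10 \<Omega>"
  defines "\<phi> \<equiv> \<lambda>x. (n t - ne) x + (n s - ne) x"
  shows "(L2_norm \<Omega> (n t - ne))\<^sup>2 - (L2_norm \<Omega> (n s - ne))\<^sup>2 = integral {s..t} (\<lambda>r. n' r \<phi>)"
    and "(\<lambda>r. n' r \<phi>) integrable_on {s..t}"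
proof -
  have \<phi>: "\<phi> \<in> H10 \<Omega>" unfolding \<phi>_def by (rule H10_add[OF op bd w(2,1)])
  have wt: "n t - ne \<in> L2 \<Omega>" "n s - ne \<in> L2 \<Omega>" "n t \<in> L2 \<Omega>" "n s \<in> L2 \<Omega>"
    using nL2 st ne by (auto intro!: L2_fun_diff)
  have \<phi>2: "\<phi> \<in> L2 \<Omega>" by (intro H1_L2 H10_H1 \<phi>)
  have "(L2_norm \<Omega> (n t - ne))\<^sup>2 - (L2_norm \<Omega> (n s - ne))\<^sup>2 =
      (\<integral>x. (n t - ne) x * (n t - ne) x - (n s - ne) x * (n s - ne) x \<partial>lebesgue_on \<Omega>)"
    unfolding L2_norm_sq_eq_inner L2_inner_def
    by (intro Bochner_Integration.integral_diff[symmetric] L2_mult_integrable wt)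
  \<comment> \<open>The steady state cancels in the difference factor, so only increments of
    \<open>n\<close> itself remain.\<close>
  also have "\<dots> = (\<integral>x. n t x * \<phi> x - n s x * \<phi> x \<partial>lebesgue_on \<Omega>)"
    by (intro Bochner_Integration.integral_cong refl) (simp add: \<phi>_def algebra_simps)
  also have "\<dots> = L2_inner \<Omega> (n t) \<phi> - L2_inner \<Omega> (n s) \<phi>"
    unfolding L2_inner_def by (intro Bochner_Integration.integral_diff L2_mult_integrable wt \<phi>2)
  also have "\<dots> = integral {s..t} (\<lambda>r. n' r \<phi>)"
    by (rule H1_time_Hminus1_increment[OF op bd n \<phi> c[OF \<phi>] st])
  finally show "(L2_norm \<Omega> (n t - ne))\<^sup>2 - (L2_norm \<Omega> (n s - ne))\<^sup>2 = integral {s..t} (\<lambda>r. n' r \<phi>)" .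
  have "integrable (lebesgue_on {0<..<T}) (\<lambda>r. n' r \<phi>)"
    using n by (intro bochner_Hminus1_apply_integrable[OF op bd _ \<phi>]) (simp add: H1_time_Hminus1_def bochner_H1_def)
  from integrable_on_from_open(1)[OF this] show "(\<lambda>r. n' r \<phi>) integrable_on {s..t}"
    by (rule integrable_subinterval_real) (use st in auto)
qed

text \<open>At time r the derivative acts on w(t+h) + w(t) instead of 2 w(r), with an error of at
  most the dual norm times 2 \<alpha>(r) + \<alpha>(t+h) + \<alpha>(t). After Young's inequality the
  part depending on r goes into \<open>P\<close>; the part at the ends is constant in r and becomes
  \<open>h * (Q t + Q (t + h))\<close>. The 2 in 2 w(r) doubles the rate.\<close>

lemma energy_step:
  fixes n :: "nat \<Rightarrow> real \<Rightarrow> 'a \<Rightarrow> real" and n' :: "nat \<Rightarrow> real \<Rightarrow> ('a \<Rightarrow> real) \<Rightarrow> real"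
  assumes nH1: "\<And>i. i \<le> 3 \<Longrightarrow> bochner_L2 T (H1 \<Omega>) (H1_norm \<Omega>) (n i)"
    and n': "\<And>i. i \<le> 3 \<Longrightarrow> H1_time_Hminus1 \<Omega> T (n i) (n' i)"
    and nL2: "\<And>i t. i \<le> 3 \<Longrightarrow> t \<ge> 0 \<Longrightarrow> n i t \<in> L2 \<Omega>"
    and c: "\<And>i \<phi>. i \<le> 3 \<Longrightarrow> \<phi> \<in> H10 \<Omega> \<Longrightarrow> continuous_on {0..} (\<lambda>t. L2_inner \<Omega> (n i t) \<phi>)"
    and ne: "\<And>i. i \<le> 3 \<Longrightarrow> ne i \<in> H1 \<Omega>"
    and w: "AE t in lebesgue_on {0<..<T}. \<forall>i\<le>3. n i t - ne i \<in> H10 \<Omega>"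
    and diss: "AE t in lebesgue_on {0<..<T}. (\<Sum>i\<le>3. n' i t (n i t - ne i)) \<le> - k * (\<Sum>i\<le>3. (L2_norm \<Omega> (n i t - ne i))\<^sup>2)"
    and T: "T > 0" and e: "e > 0"
  defines "G \<equiv> \<lambda>t. \<Sum>i\<le>3. (L2_norm \<Omega> (n i t - ne i))\<^sup>2"
  assumes G: "G integrable_on {0..T}"
  shows "\<exists>\<delta>>0. \<exists>P Q N. negligible N \<and> (\<forall>t. 0 \<le> P t) \<and> (\<forall>t. 0 \<le> Q t) \<and>
       P integrable_on {0..T} \<and> Q integrable_on {0..T} \<and> integral {0..T} P \<le> e \<and> integral {0..T} Q \<le> e \<and>
       (\<forall>t h. 0 < t \<longrightarrow> t + h < T \<longrightarrow> 0 < h \<longrightarrow> h < \<delta> \<longrightarrow> t \<notin> N \<longrightarrow> t + h \<notin> N \<longrightarrow>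
          G (t + h) - G t \<le> - (2 * k) * integral {t..t+h} G + integral {t..t+h} P + h * (Q t + Q (t + h)))"
proof -
  let ?I = "{0<..<T}" and ?M = "lebesgue_on {0<..<T}"
  have n'L2: "bochner_L2 T (Hminus1 \<Omega>) (Hminus1_norm \<Omega>) (n' i)" if "i \<le> 3" for i
    using n'[OF that] by (simp add: H1_time_Hminus1_def bochner_H1_def)
  define M where "M i t = (Hminus1_norm \<Omega> (n' i t))\<^sup>2" for i t
  have Mi: "M i integrable_on {0..T}" if "i \<le> 3" for i
    using n'L2[OF that] integrable_on_from_open(1) by (simp add: bochner_L2_def M_def[abs_def])
  define S where "S = (\<Sum>i\<le>3. integral {0..T} (M i))"
  have S0: "S \<ge> 0"
    unfolding S_def by (intro sum_nonneg Henstock_Kurzweil_Integration.integral_nonneg Mi) (auto simp: M_def)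
  \<comment> \<open>This weight keeps the integral of the squared dual norms, multiplied by
    \<open>l\<close>, at most e/2.\<close>
  define l where "l = e / (2 * (S + 1))"
  have l: "l > 0" "l * S \<le> e / 2"
  proof -
    show "l > 0" using e S0 by (simp add: l_def)
    have "l * S = e / 2 * (S / (S + 1))" by (simp add: l_def)
    also have "\<dots> \<le> e / 2 * 1" using e S0 by (intro mult_left_mono) auto
    finally show "l * S \<le> e / 2" by simp
  qed
  \<comment> \<open>Four components with factor 3/l add up to 12 e'/l = e/2.\<close>
  define e' where "e' = l * e / 24"
  have e': "e' > 0" using l e by (simp add: e'_def)
  define tr where "tr i \<delta> \<alpha> \<longleftrightarrow> \<delta> > 0 \<and> (\<forall>t. \<alpha> t \<ge> 0) \<and> integrable ?M (\<lambda>t. (\<alpha> t)\<^sup>2) \<and> (\<integral>t. (\<alpha> t)\<^sup>2 \<partial>?M) < e' \<and>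
     (\<forall>r t. r \<in> ?I \<longrightarrow> t \<in> ?I \<longrightarrow> n i r \<in> H1 \<Omega> \<longrightarrow> n i t \<in> H1 \<Omega> \<longrightarrow> \<bar>r - t\<bar> < \<delta> \<longrightarrow>
       H1_norm \<Omega> (n i r - n i t) \<le> \<alpha> r + \<alpha> t)" for i and \<delta> :: real and \<alpha> :: "real \<Rightarrow> real"
  have "\<exists>\<delta> \<alpha>. tr i \<delta> \<alpha>" if "i \<le> 3" for i
    by (rule bochner_H1_translation[OF op bd nH1[OF that] T e']) (unfold tr_def, blast)
  then have "\<forall>i. \<exists>\<delta> \<alpha>. i \<le> 3 \<longrightarrow> tr i \<delta> \<alpha>" by blast
  then obtain \<delta> where "\<forall>i. \<exists>\<alpha>. i \<le> 3 \<longrightarrow> tr i (\<delta> i) \<alpha>" by (rule choice[THEN exE])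
  then obtain \<alpha> where "\<forall>i. i \<le> 3 \<longrightarrow> tr i (\<delta> i) (\<alpha> i)" by (rule choice[THEN exE])
  then have tr: "tr i (\<delta> i) (\<alpha> i)" if "i \<le> 3" for i using that by blast
  have \<alpha>i: "(\<lambda>t. (\<alpha> i t)\<^sup>2) integrable_on {0..T}" "integral {0..T} (\<lambda>t. (\<alpha> i t)\<^sup>2) \<le> e'" if "i \<le> 3" for i
    using tr[OF that] integrable_on_from_open by (auto simp: tr_def)
  define \<delta>0 where "\<delta>0 = Min (\<delta> ` {..3})"
  have \<delta>0: "\<delta>0 > 0" "\<And>i. i \<le> 3 \<Longrightarrow> \<delta>0 \<le> \<delta> i" using tr by (auto simp: \<delta>0_def tr_def)
  define Q where "Q t = (\<Sum>i\<le>3. 3 / l * (\<alpha> i t)\<^sup>2)" for t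
  define P where "P t = (\<Sum>i\<le>3. l * M i t) + Q t" for t
  have Q0: "Q t \<ge> 0" and P0: "P t \<ge> 0" for t
    using l by (auto simp: Q_def P_def M_def intro!: sum_nonneg add_nonneg_nonneg)
  have Qi: "Q integrable_on {0..T}" unfolding Q_def by (intro integrable_sum integrable_on_mult_right \<alpha>i) auto
  have MMi: "(\<lambda>t. \<Sum>i\<le>3. l * M i t) integrable_on {0..T}" by (intro integrable_sum integrable_on_mult_right Mi) auto
  have Pi: "P integrable_on {0..T}" unfolding P_def by (intro integrable_add MMi Qi)
  have Qe: "integral {0..T} Q \<le> e / 2"
  proof -
    have "integral {0..T} Q = (\<Sum>i\<le>3. 3 / l * integral {0..T} (\<lambda>t. (\<alpha> i t)\<^sup>2))"
      unfolding Q_def by (subst integral_sum)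
        (auto intro!: integrable_on_mult_right \<alpha>i simp del: times_divide_eq_left)
    also have "\<dots> \<le> (\<Sum>i\<le>(3::nat). 3 / l * e')" using l by (intro sum_mono mult_left_mono \<alpha>i) auto
    also have "\<dots> = e / 2" using l by (simp add: e'_def)
    finally show ?thesis .
  qed
  have Pe: "integral {0..T} P \<le> e"
  proof -
    have "integral {0..T} (\<lambda>t. \<Sum>i\<le>3. l * M i t) = (\<Sum>i\<le>3. l * integral {0..T} (M i))"
      by (subst integral_sum) (auto intro!: integrable_on_mult_right Mi)
    also have "\<dots> = l * S" by (simp add: S_def sum_distrib_left)
    finally show ?thesis unfolding P_def using l Qe by (subst integral_add[OF MMi Qi]) simp
  qed
  have "AE t in ?M. \<forall>i\<in>{..3}. n' i t \<in> Hminus1 \<Omega>"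
    using n'L2 by (intro AE_finite_allI) (auto simp: bochner_L2_def strongly_measurable_def)
  then have ae: "AE t in ?M. (\<forall>i\<le>3. n' i t \<in> Hminus1 \<Omega>) \<and> (\<forall>i\<le>3. n i t - ne i \<in> H10 \<Omega>) \<and>
      (\<Sum>i\<le>3. n' i t (n i t - ne i)) \<le> - k * G t"
    using w diss unfolding G_def by eventually_elim auto
  obtain N where N: "negligible N" and good: "\<And>t i. t \<in> ?I \<Longrightarrow> t \<notin> N \<Longrightarrow> i \<le> 3 \<Longrightarrow> n' i t \<in> Hminus1 \<Omega>"
    "\<And>t i. t \<in> ?I \<Longrightarrow> t \<notin> N \<Longrightarrow> i \<le> 3 \<Longrightarrow> n i t - ne i \<in> H10 \<Omega>"
    "\<And>t. t \<in> ?I \<Longrightarrow> t \<notin> N \<Longrightarrow> (\<Sum>i\<le>3. n' i t (n i t - ne i)) \<le> - k * G t"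
  proof (rule AE_negligible[OF ae])
    fix N assume "negligible N" "\<And>t. t \<in> ?I \<Longrightarrow> t \<notin> N \<Longrightarrow> (\<forall>i\<le>3. n' i t \<in> Hminus1 \<Omega>) \<and> (\<forall>i\<le>3. n i t - ne i \<in> H10 \<Omega>) \<and>
      (\<Sum>i\<le>3. n' i t (n i t - ne i)) \<le> - k * G t"
    then show thesis by (intro that[of N]) blast+
  qed simp
  have nH: "n i t \<in> H1 \<Omega>" if "t \<in> ?I" "t \<notin> N" "i \<le> 3" for i t
  proof -
    have "(\<lambda>x. (n i t - ne i) x + ne i x) \<in> H1 \<Omega>"
      by (intro H1_add(1)[OF op bd] H10_H1 good(2) that ne)
    then show ?thesis by simp
  qed
  have step: "G (t + h) - G t \<le> - (2 * k) * integral {t..t+h} G + integral {t..t+h} P + h * (Q t + Q (t + h))"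
    if th: "0 < t" "t + h < T" "0 < h" "h < \<delta>0" "t \<notin> N" "t + h \<notin> N" for t h
  proof -
    have tI: "t \<in> ?I" "t + h \<in> ?I" using th by auto
    define \<phi> where "\<phi> i x = (n i (t + h) - ne i) x + (n i t - ne i) x" for i x
    have inc: "(L2_norm \<Omega> (n i (t + h) - ne i))\<^sup>2 - (L2_norm \<Omega> (n i t - ne i))\<^sup>2 = integral {t..t+h} (\<lambda>r. n' i r (\<phi> i))"
      and ii: "(\<lambda>r. n' i r (\<phi> i)) integrable_on {t..t+h}" if "i \<le> 3" for i
    proof -
      show "(L2_norm \<Omega> (n i (t + h) - ne i))\<^sup>2 - (L2_norm \<Omega> (n i t - ne i))\<^sup>2 = integral {t..t+h} (\<lambda>r. n' i r (\<phi> i))"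
        "(\<lambda>r. n' i r (\<phi> i)) integrable_on {t..t+h}"
        unfolding \<phi>_def[abs_def] by (rule energy_increment[OF n'[OF that] nL2[OF that] c[OF that] H1_L2[OF ne[OF that]]];
          use th tI good(2) that in simp)+
    qed
    define q where "q = Q t + Q (t + h)"
    have bound: "(\<Sum>i\<le>3. n' i r (\<phi> i)) \<le> - (2 * k) * G r + (P r + q)" if r: "r \<in> {t..t+h}" "r \<notin> N" for r
    proof -
      have rI: "r \<in> ?I" using r th by auto
      have "n' i r (\<phi> i) \<le> 2 * n' i r (n i r - ne i) + (l * M i r + 3 / l * ((\<alpha> i r)\<^sup>2 + (\<alpha> i (t + h))\<^sup>2 + (\<alpha> i t)\<^sup>2))"
        if i: "i \<le> 3" for i
      proof -
        note F = good(1)[OF rI r(2) i]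
        have d: "n' i r (n i s - ne i) \<le> n' i r (n i r - ne i) + Hminus1_norm \<Omega> (n' i r) * (\<alpha> i r + \<alpha> i s)"
          if s: "s \<in> ?I" "s \<notin> N" "\<bar>r - s\<bar> < \<delta>0" for s
        proof -
          have H: "n i s - ne i \<in> H10 \<Omega>" "n i r - ne i \<in> H10 \<Omega>" using good(2) s rI r i by auto
          have "\<bar>n' i r ((n i r - ne i) - (n i s - ne i))\<bar> \<le> Hminus1_norm \<Omega> (n' i r) * H1_norm \<Omega> ((n i r - ne i) - (n i s - ne i))"
            by (rule Hminus1_bound[OF op bd F H10_diff[OF op bd H(2,1)]])
          \<comment> \<open>The steady state cancels, so translations of \<open>n i\<close> alone
            have to be controlled.\<close>
          moreover have "(n i r - ne i) - (n i s - ne i) = n i r - n i s" by auto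
          moreover have "H1_norm \<Omega> (n i r - n i s) \<le> \<alpha> i r + \<alpha> i s"
            using tr[OF i] s rI r nH[OF rI r(2) i] nH[OF s(1,2) i] \<delta>0(2)[OF i] by (auto simp: tr_def)
          then have "Hminus1_norm \<Omega> (n' i r) * H1_norm \<Omega> (n i r - n i s) \<le> Hminus1_norm \<Omega> (n' i r) * (\<alpha> i r + \<alpha> i s)"
            by (rule mult_left_mono[OF _ Hminus1_norm_nonneg[OF op bd F]])
          moreover have "n' i r ((n i r - ne i) - (n i s - ne i)) = n' i r (n i r - ne i) - n' i r (n i s - ne i)"
            by (rule Hminus1_diff_arg[OF op bd F H(2,1)])
          ultimately show ?thesis by simp
        qed
        have "Hminus1_norm \<Omega> (n' i r) * (2 * \<alpha> i r + \<alpha> i (t + h) + \<alpha> i t)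
            \<le> l * M i r + 3 / l * ((\<alpha> i r)\<^sup>2 + (\<alpha> i (t + h))\<^sup>2 + (\<alpha> i t)\<^sup>2)"
          unfolding M_def by (rule product_le_weighted_squares[OF l(1)])
        moreover have "n' i r (\<phi> i) = n' i r (n i (t + h) - ne i) + n' i r (n i t - ne i)"
          unfolding \<phi>_def[abs_def]
          by (rule Hminus1_add[OF op bd F good(2)[OF tI(2) th(6) i] good(2)[OF tI(1) th(5) i]])
        moreover have "n' i r (n i (t + h) - ne i) + n' i r (n i t - ne i)
            \<le> 2 * n' i r (n i r - ne i) + Hminus1_norm \<Omega> (n' i r) * (2 * \<alpha> i r + \<alpha> i (t + h) + \<alpha> i t)"
          using d[OF tI(1) th(5)] d[OF tI(2) th(6)] r th(4) by (simp add: algebra_simps)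
        ultimately show ?thesis by linarith
      qed
      then have "(\<Sum>i\<le>3. n' i r (\<phi> i)) \<le> (\<Sum>i\<le>3. 2 * n' i r (n i r - ne i) + (l * M i r + 3 / l * ((\<alpha> i r)\<^sup>2 + (\<alpha> i (t + h))\<^sup>2 + (\<alpha> i t)\<^sup>2)))"
        by (intro sum_mono) auto
      also have "\<dots> = 2 * (\<Sum>i\<le>3. n' i r (n i r - ne i)) + (P r + q)"
        by (simp add: P_def Q_def q_def sum.distrib sum_distrib_left distrib_left)
      also have "\<dots> \<le> - (2 * k) * G r + (P r + q)" using good(3)[OF rI r(2)] by simp
      finally show ?thesis .
    qed
    have Gi: "G integrable_on {t..t+h}" "P integrable_on {t..t+h}"
      by (rule integrable_subinterval_real[OF G] integrable_subinterval_real[OF Pi]; use th in auto)+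
    have "G (t + h) - G t = (\<Sum>i\<le>3. integral {t..t+h} (\<lambda>r. n' i r (\<phi> i)))"
      unfolding G_def sum_subtractf[symmetric] by (intro sum.cong refl inc) auto
    also have "\<dots> = integral {t..t+h} (\<lambda>r. \<Sum>i\<le>3. n' i r (\<phi> i))"
      by (rule integral_sum[symmetric]) (auto intro: ii)
    also have "\<dots> \<le> integral {t..t+h} (\<lambda>r. - (2 * k) * G r + (P r + q))"
    proof (rule integral_le_negligible[OF _ _ N bound])
      show "(\<lambda>r. \<Sum>i\<le>3. n' i r (\<phi> i)) integrable_on {t..t+h}" by (intro integrable_sum) (auto intro: ii)
      show "(\<lambda>r. - (2 * k) * G r + (P r + q)) integrable_on {t..t+h}"
        by (intro integrable_add integrable_on_mult_right Gi integrable_const_ivl)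
    qed
    also have "\<dots> = integral {t..t+h} (\<lambda>r. - (2 * k) * G r) + (integral {t..t+h} P + integral {t..t+h} (\<lambda>r. q))"
      using Gi by (simp only: integral_add integrable_add integrable_on_mult_right integrable_const_ivl)
    also have "integral {t..t+h} (\<lambda>r. - (2 * k) * G r) = - (2 * k) * integral {t..t+h} G"
      by (rule integral_mult_right)
    also have "integral {t..t+h} (\<lambda>r. q) = h * q" using th by simp
    finally show ?thesis by (simp add: q_def)
  qed
  show ?thesis
    by (intro exI[of _ \<delta>0] exI[of _ P] exI[of _ Q] exI[of _ N] conjI allI impI)
       (use \<delta>0 N P0 Q0 Pi Qi Pe Qe e step in auto)
qed

text \<open>Supplies two facts about |w|^2: integrability on bounded time intervals, and the
  essential bound near time 0 from which the prefactor of the decay is made.\<close>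

lemma bochner_Linf_diff_square:
  fixes u :: "real \<Rightarrow> 'a \<Rightarrow> real"
  assumes u: "bochner_Linf T (L2 \<Omega>) (L2_norm \<Omega>) u" and y: "y \<in> L2 \<Omega>"
  obtains M where "integrable (lebesgue_on {0<..<T}) (\<lambda>t. (L2_norm \<Omega> (u t - y))\<^sup>2)"
    "AE t in lebesgue_on {0<..<T}. (L2_norm \<Omega> (u t - y))\<^sup>2 \<le> M"
proof -
  obtain M where sm: "strongly_measurable T (L2 \<Omega>) (L2_norm \<Omega>) u" and M: "AE t in lebesgue_on {0<..<T}. L2_norm \<Omega> (u t) \<le> M"
    using u by (auto simp: bochner_Linf_def)
  have uX: "AE t in lebesgue_on {0<..<T}. u t \<in> L2 \<Omega>" using sm by (simp add: strongly_measurable_def)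
  have b: "AE t in lebesgue_on {0<..<T}. (L2_norm \<Omega> (u t - y))\<^sup>2 \<le> (M + L2_norm \<Omega> y)\<^sup>2"
    using uX M
  proof eventually_elim
    case (elim t)
    have "L2_norm \<Omega> (u t - y) \<le> M + L2_norm \<Omega> y"
      using L2_norm_triangle_diff[OF elim(1) y] elim(2) by (simp add: fun_diff_def)
    then show ?case by (intro power_mono L2_norm_nonneg)
  qed
  have meas: "(\<lambda>t. L2_norm \<Omega> (u t - y)) \<in> borel_measurable (lebesgue_on {0<..<T})"
  proof (rule strongly_measurable_norm_diff[OF sm y])
    show "L2_norm \<Omega> (a - c) \<le> L2_norm \<Omega> (a - b) + L2_norm \<Omega> (b - c)"
      if "a \<in> L2 \<Omega>" "b \<in> L2 \<Omega>" "c \<in> L2 \<Omega>" for a b c :: "'a \<Rightarrow> real"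
      by (rule L2_norm_triangle3[OF op bd that])
    show "L2_norm \<Omega> (a - b) = L2_norm \<Omega> (b - a)" for a b :: "'a \<Rightarrow> real"
      by (rule L2_norm_commute[OF op bd])
  qed
  interpret finite_measure "lebesgue_on {0<..<T}" by (rule finite_measure_lebesgue_on) auto
  have "integrable (lebesgue_on {0<..<T}) (\<lambda>t. (L2_norm \<Omega> (u t - y))\<^sup>2)"
    by (rule integrable_const_bound[of _ "(M + L2_norm \<Omega> y)\<^sup>2"]) (use b meas in auto)
  then show ?thesis using that b by blast
qed

lemma sum_L2_norm_sq_weak_lsc:
  fixes n :: "nat \<Rightarrow> real \<Rightarrow> 'a \<Rightarrow> real"
  assumes n: "\<And>i t. i \<le> 3 \<Longrightarrow> t \<ge> 0 \<Longrightarrow> n i t \<in> L2 \<Omega>"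
    and c: "\<And>i \<phi>. i \<le> 3 \<Longrightarrow> \<phi> \<in> H10 \<Omega> \<Longrightarrow> continuous_on {0..} (\<lambda>t. L2_inner \<Omega> (n i t) \<phi>)"
    and m: "\<And>i. i \<le> 3 \<Longrightarrow> m i \<in> L2 \<Omega>" and b: "b \<ge> 0" and e: "e > 0"
  shows "\<exists>\<delta>>0. \<forall>t\<in>{b..b+\<delta>}. (\<Sum>i\<le>3. (L2_norm \<Omega> (n i b - m i))\<^sup>2) - e \<le> (\<Sum>i\<le>3. (L2_norm \<Omega> (n i t - m i))\<^sup>2)"
proof -
  have "\<exists>\<delta>. i \<le> 3 \<longrightarrow> \<delta> > 0 \<and> (\<forall>t\<in>{b..b+\<delta>}. (L2_norm \<Omega> (n i b - m i))\<^sup>2 - e / 4 \<le> (L2_norm \<Omega> (n i t - m i))\<^sup>2)" for i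
  proof (cases "i \<le> 3")
    case True
    define x where "x = L2_norm \<Omega> (n i b - m i)"
    \<comment> \<open>A loss \<open>d\<close> in the norm costs at most 2 x d \<le> e/4 in its
      square, so four components lose at most e. The +1 covers x = 0.\<close>
    define d where "d = e / (8 * (x + 1))"
    have x: "x \<ge> 0" by (simp add: x_def L2_norm_nonneg)
    have d: "d > 0" using x e by (simp add: d_def)
    have "2 * x * d = e / 4 * (x / (x + 1))" using x by (simp add: d_def field_simps)
    also have "\<dots> \<le> e / 4 * 1" using x e by (intro mult_left_mono) auto
    finally have xd: "2 * x * d \<le> e / 4" by simp
    obtain \<delta> where \<delta>: "\<delta> > 0" "\<And>t. t \<in> {b..b+\<delta>} \<Longrightarrow> x - d \<le> L2_norm \<Omega> (n i t - m i)"
      using L2_norm_weak_lsc[OF op bd n[OF True] c[OF True] m[OF True] b d] unfolding x_def by blast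
    have "x\<^sup>2 - e / 4 \<le> y\<^sup>2" if y: "x - d \<le> y" for y
    proof (cases "x - d \<ge> 0")
      case True
      then have "(x - d)\<^sup>2 \<le> y\<^sup>2" using y by (intro power_mono) auto
      moreover have "(x - d)\<^sup>2 = x\<^sup>2 - 2 * x * d + d\<^sup>2" by (simp add: power2_diff)
      ultimately show ?thesis using xd zero_le_power2[of d] by linarith
    next
      \<comment> \<open>Here x < d, so x^2 is already at most e/4 and every \<open>y\<close> will
        do.\<close>
      case False
      then have "x * x \<le> x * d" using x by (intro mult_left_mono) auto
      moreover have "0 \<le> x * d" using x d by simp
      ultimately have "x\<^sup>2 \<le> e / 4" using xd by (simp add: power2_eq_square)
      then show ?thesis using zero_le_power2[of y] by linarith
    qed
    then show ?thesis using \<delta> by (intro exI[of _ \<delta>]) (auto simp: x_def[symmetric])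
  qed auto
  then have "\<forall>i. \<exists>\<delta>. i \<le> 3 \<longrightarrow> \<delta> > 0 \<and> (\<forall>t\<in>{b..b+\<delta>}. (L2_norm \<Omega> (n i b - m i))\<^sup>2 - e / 4 \<le> (L2_norm \<Omega> (n i t - m i))\<^sup>2)"
    by blast
  then obtain \<delta> where \<delta>: "\<forall>i. i \<le> 3 \<longrightarrow> \<delta> i > 0 \<and> (\<forall>t\<in>{b..b+\<delta> i}. (L2_norm \<Omega> (n i b - m i))\<^sup>2 - e / 4 \<le> (L2_norm \<Omega> (n i t - m i))\<^sup>2)"
    by (rule choice[THEN exE])
  define \<delta>0 where "\<delta>0 = Min (\<delta> ` {..3})"
  have \<delta>0: "\<delta>0 > 0" "\<And>i. i \<le> 3 \<Longrightarrow> \<delta>0 \<le> \<delta> i" using \<delta> by (auto simp: \<delta>0_def)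
  show ?thesis
  proof (intro exI[of _ \<delta>0] conjI ballI)
    fix t assume t: "t \<in> {b..b+\<delta>0}"
    have "(\<Sum>i\<le>(3::nat). (L2_norm \<Omega> (n i b - m i))\<^sup>2 - e / 4) \<le> (\<Sum>i\<le>3. (L2_norm \<Omega> (n i t - m i))\<^sup>2)"
    proof (rule sum_mono)
      fix i :: nat assume "i \<in> {..3}"
      then have i: "i \<le> 3" by simp
      have "t \<in> {b..b+\<delta> i}" using t \<delta>0(2)[OF i] by auto
      then show "(L2_norm \<Omega> (n i b - m i))\<^sup>2 - e / 4 \<le> (L2_norm \<Omega> (n i t - m i))\<^sup>2" using \<delta> i by blast
    qed
    then show "(\<Sum>i\<le>3. (L2_norm \<Omega> (n i b - m i))\<^sup>2) - e \<le> (\<Sum>i\<le>3. (L2_norm \<Omega> (n i t - m i))\<^sup>2)"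
      by (simp add: sum_subtractf)
  qed (rule \<delta>0)
qed

end

theorem theorem2:
  fixes \<Omega> :: "'a::euclidean_space set" and D p :: "'a \<Rightarrow> real"
  assumes "DIM('a) \<le> 3" and "bounded_C1_domain \<Omega>"
    and "D \<in> Linf \<Omega>" and "\<exists>\<delta>>0. AE x in lebesgue_on \<Omega>. \<delta> \<le> D x"
    and "p \<in> borel_measurable (lebesgue_on \<Omega>)"
    and "\<exists>q<1. AE x in lebesgue_on \<Omega>. \<bar>p x\<bar> \<le> q"
  shows "\<exists>K>0. \<forall>(lam::real) \<gamma> \<tau> C \<mu> v_sat L m\<^sub>I m n\<^sub>D V\<^sub>D n\<^sub>I n\<^sub>e V\<^sub>e n V.
    lam > 0 \<longrightarrow> \<gamma> > 0 \<longrightarrow> \<tau> > 0 \<longrightarrow> C \<in> Linf \<Omega> \<longrightarrow>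
    (\<forall>j\<le>3. n\<^sub>D j \<in> H1 \<Omega>) \<longrightarrow> V\<^sub>D \<in> H1 \<Omega> \<longrightarrow> (\<forall>j\<le>3. n\<^sub>I j \<in> L2 \<Omega>) \<longrightarrow>
    mobility \<mu> v_sat L \<longrightarrow>
    (AE x in lebesgue_on \<Omega>. norm (m\<^sub>I x) = 1) \<longrightarrow> landau_lifshitz_solution \<Omega> m\<^sub>I m \<longrightarrow>
    steady_state \<Omega> lam C \<mu> n\<^sub>D V\<^sub>D n\<^sub>e V\<^sub>e \<longrightarrow>
    spin_drift_diffusion_solution \<Omega> D p C lam \<gamma> \<tau> \<mu> m n\<^sub>D V\<^sub>D n\<^sub>I n V \<longrightarrow>
    ennreal (v_sat\<^sup>2) + ennreal (L\<^sup>2 / lam ^ 4) * (Linf_norm \<Omega> (\<lambda>x. L2_set (\<lambda>j. n\<^sub>e j x) {..3}))\<^sup>2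
      < ennreal K \<longrightarrow>
    (\<exists>k\<^sub>1>0. \<exists>k\<^sub>2>0. \<forall>t>0.
       L2_set (\<lambda>j. L2_norm \<Omega> (n j t - n\<^sub>e j)) {..3} \<le> k\<^sub>1 * exp (- k\<^sub>2 * t))"
proof -
  have op: "open \<Omega>" and bd: "bounded \<Omega>" using assms(2) by (auto simp: bounded_C1_domain_def)
  note dom = domain_sets[OF op bd]
  obtain c where c: "c > 0" "\<And>u. u \<in> H10 \<Omega> \<Longrightarrow> L2_norm \<Omega> u \<le> c * L2_norm \<Omega> (grad \<Omega> u)"
    using Poincare[OF op bd] by blast
  obtain DM where DM: "AE x in lebesgue_on \<Omega>. \<bar>D x\<bar> \<le> DM" using Linf_bound[OF assms(3)] by blast
  have Dm: "D \<in> borel_measurable (lebesgue_on \<Omega>)" using assms(3) by (simp add: Linf_def)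
  obtain \<delta> where \<delta>: "\<delta> > 0" "AE x in lebesgue_on \<Omega>. \<delta> \<le> D x" using assms(4) by blast
  obtain q where q: "q < 1" "AE x in lebesgue_on \<Omega>. \<bar>p x\<bar> \<le> q" using assms(6) by blast
  define \<kappa> where "\<kappa> = \<delta> * (1 - q)"
  define a where "a = DM / (1 - q\<^sup>2)"
  \<comment> \<open>The rate left over in \<open>energy_dissipation\<close>; \<open>s\<close> is the
    coefficient of \<open>K\<close> in its absorption condition.\<close>
  define k where "k = \<kappa> / (4 * c\<^sup>2)"
  define s where "s = 16 * a\<^sup>2 / \<kappa> * (1 + 4 * c\<^sup>2)"
  \<comment> \<open>Absorption requires \<open>s * K \<le> k\<close>, and the +1 allows s = 0. Only
    Poincare's constant and the bounds of \<open>D\<close> and \<open>p\<close> enter, so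
    \<open>K\<close> is fixed before all remaining data.\<close>
  define K where "K = k / (s + 1)"
  have \<kappa>: "\<kappa> > 0" using \<delta> q by (simp add: \<kappa>_def)
  have k: "k > 0" using \<kappa> c by (simp add: k_def)
  have s: "s \<ge> 0" using \<kappa> by (simp add: s_def)
  have K: "K > 0" using k s by (simp add: K_def)
  have sK: "s * K \<le> k"
  proof -
    have "s * K = k * (s / (s + 1))" by (simp add: K_def)
    also have "\<dots> \<le> k * 1" using k s by (intro mult_left_mono) auto
    finally show ?thesis by simp
  qed
  show ?thesis
  proof (rule exI[of _ K], intro conjI K allI impI)
    fix lam \<gamma> \<tau> v_sat L :: real and C V\<^sub>D V\<^sub>e :: "'a \<Rightarrow> real" and \<mu> :: "real \<Rightarrow> real"
      and m\<^sub>I :: "'a \<Rightarrow> real^3" and m :: "real \<Rightarrow> 'a \<Rightarrow> real^3"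
      and n\<^sub>D n\<^sub>I n\<^sub>e :: "nat \<Rightarrow> 'a \<Rightarrow> real" and n :: "nat \<Rightarrow> real \<Rightarrow> 'a \<Rightarrow> real" and V :: "real \<Rightarrow> 'a \<Rightarrow> real"
    assume lam: "lam > 0" and "\<gamma> > 0" and \<tau>: "\<tau> > 0" and C: "C \<in> Linf \<Omega>"
      and "\<forall>j\<le>3. n\<^sub>D j \<in> H1 \<Omega>" "V\<^sub>D \<in> H1 \<Omega>" "\<forall>j\<le>3. n\<^sub>I j \<in> L2 \<Omega>"
      and \<mu>: "mobility \<mu> v_sat L" and "AE x in lebesgue_on \<Omega>. norm (m\<^sub>I x) = 1"
      and LL: "landau_lifshitz_solution \<Omega> m\<^sub>I m"
      and SS: "steady_state \<Omega> lam C \<mu> n\<^sub>D V\<^sub>D n\<^sub>e V\<^sub>e"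
      and SD: "spin_drift_diffusion_solution \<Omega> D p C lam \<gamma> \<tau> \<mu> m n\<^sub>D V\<^sub>D n\<^sub>I n V"
      and small: "ennreal (v_sat\<^sup>2) + ennreal (L\<^sup>2 / lam ^ 4) * (Linf_norm \<Omega> (\<lambda>x. L2_set (\<lambda>j. n\<^sub>e j x) {..3}))\<^sup>2 < ennreal K"
    have CL2: "C \<in> L2 \<Omega>"
    proof -
      obtain B where "AE x in lebesgue_on \<Omega>. \<bar>C x\<bar> \<le> B" using Linf_bound[OF C] by blast
      then show ?thesis using C by (intro L2_bounded[OF bd dom, of C B]) (auto simp: Linf_def)
    qed
    have ne: "n\<^sub>e j \<in> H1 \<Omega>" if "j \<le> 3" for j using SS that by (auto simp: steady_state_def)
    have Ve: "V\<^sub>e \<in> H1 \<Omega>" using SS by (auto simp: steady_state_def)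
    have st1: "AE x in lebesgue_on \<Omega>. grad \<Omega> (n\<^sub>e 0) x + (n\<^sub>e 0 x * \<mu> (norm (grad \<Omega> V\<^sub>e x))) *\<^sub>R grad \<Omega> V\<^sub>e x = 0"
      using SS unfolding steady_state_def by blast
    have st2: "AE x in lebesgue_on \<Omega>. n\<^sub>e j x = 0" if "j \<in> {1..3}" for j using SS that unfolding steady_state_def by blast
    have pe: "poisson_equation \<Omega> lam C (n\<^sub>e 0) V\<^sub>e" using SS by (auto simp: steady_state_def)
    have te: "trace_eq \<Omega> (n\<^sub>e j) (n\<^sub>D j)" "trace_eq \<Omega> V\<^sub>e V\<^sub>D" if "j \<le> 3" for j using SS that by (auto simp: steady_state_def)
    have L: "L > 0" using \<mu> by (simp add: mobility_def)
    define E where "E = Linf_norm \<Omega> (\<lambda>x. L2_set (\<lambda>j. n\<^sub>e j x) {..3})"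
    \<comment> \<open>An infinite norm would make the left side of the smallness condition infinite,
      because its factor L^2/lam^4 is positive.\<close>
    have "E \<noteq> \<infinity>"
    proof
      assume "E = \<infinity>"
      then show False using small L lam unfolding E_def[symmetric]
        by (simp add: ennreal_mult_top power2_eq_square)
    qed
    then obtain B where B: "B \<ge> 0" "E = ennreal B" by (cases E) auto
    have neB: "AE x in lebesgue_on \<Omega>. \<bar>n\<^sub>e 0 x\<bar> \<le> B"
    proof -
      have "AE x in lebesgue_on \<Omega>. ennreal \<bar>L2_set (\<lambda>j. n\<^sub>e j x) {..3}\<bar> \<le> E"
        unfolding E_def Linf_norm_def by (rule esssup_AE)
      then show ?thesis
      proof eventually_elim
        case (elim x)
        have "\<bar>n\<^sub>e 0 x\<bar> = sqrt ((n\<^sub>e 0 x)\<^sup>2)" by simp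
        also have "\<dots> \<le> L2_set (\<lambda>j. n\<^sub>e j x) {..3}"
          unfolding L2_set_def by (intro real_sqrt_le_mono member_le_sum) auto
        also have "\<dots> \<le> B" using elim B by (simp add: ennreal_le_iff)
        finally show ?case .
      qed
    qed
    have real_small: "v_sat\<^sup>2 + L\<^sup>2 / lam ^ 4 * B\<^sup>2 < K"
    proof -
      have "ennreal (v_sat\<^sup>2) + ennreal (L\<^sup>2 / lam ^ 4) * (ennreal B)\<^sup>2 = ennreal (v_sat\<^sup>2 + L\<^sup>2 / lam ^ 4 * B\<^sup>2)"
        using B(1) lam by (simp add: ennreal_power ennreal_mult[symmetric] ennreal_plus[symmetric] del: ennreal_plus)
      then have "ennreal (v_sat\<^sup>2 + L\<^sup>2 / lam ^ 4 * B\<^sup>2) < ennreal K"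
        using small by (simp only: E_def[symmetric] B(2))
      then show ?thesis by (subst (asm) ennreal_less_iff) auto
    qed
    have vK: "v_sat\<^sup>2 \<le> K" "L\<^sup>2 / lam ^ 4 * B\<^sup>2 \<le> K"
    proof -
      have "0 \<le> L\<^sup>2 / lam ^ 4 * B\<^sup>2" "0 \<le> v_sat\<^sup>2" using lam by simp_all
      then show "v_sat\<^sup>2 \<le> K" "L\<^sup>2 / lam ^ 4 * B\<^sup>2 \<le> K" using real_small by linarith+
    qed
    note sd = SD[unfolded spin_drift_diffusion_solution_def]
    note sd1 = sd[THEN conjunct1] and sd2 = sd[THEN conjunct2, THEN conjunct1]
      and sd3 = sd[THEN conjunct2, THEN conjunct2, THEN conjunct1]
      and sd' = sd[THEN conjunct2, THEN conjunct2, THEN conjunct2]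
    note po = sd'[THEN conjunct1] and tr = sd'[THEN conjunct2, THEN conjunct1]
      and sd6 = sd'[THEN conjunct2, THEN conjunct2, THEN conjunct1]
      and sd7 = sd'[THEN conjunct2, THEN conjunct2, THEN conjunct2, THEN conjunct1]
    obtain n' where n'0: "\<forall>T>0. \<forall>i\<le>3. H1_time_Hminus1 \<Omega> T (n i) (n' i)"
      and eq: "AE t in lebesgue_on {0<..}. \<forall>i\<le>3. \<forall>\<phi>\<in>H10 \<Omega>.
           n' i t \<phi> =
           - (\<integral>x. (\<Sum>j\<le>3. diffusion_matrix (D x) (p x) (m t x) i j *\<^sub>R
                       (grad \<Omega> (n j t) x - n j t x *\<^sub>R drift \<Omega> \<mu> (V t) x)) \<bullet> grad \<Omega> \<phi> x
                \<partial>lebesgue_on \<Omega>)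
           + (\<integral>x. (\<Sum>j\<le>3. relaxation_matrix \<gamma> \<tau> (m t x) i j * n j t x) * \<phi> x
                \<partial>lebesgue_on \<Omega>)"
      using sd3 by (elim conjE exE) (rule that)
    have n': "\<And>T i. T > 0 \<Longrightarrow> i \<le> 3 \<Longrightarrow> H1_time_Hminus1 \<Omega> T (n i) (n' i)" using n'0 by blast
    have nH1: "bochner_L2 T (H1 \<Omega>) (H1_norm \<Omega>) (n i)" "bochner_Linf T (L2 \<Omega>) (L2_norm \<Omega>) (n i)" if "T > 0" "i \<le> 3" for T i
      using sd1 that by blast+
    have VH2: "bochner_L2 T (H2 \<Omega>) (H2_norm \<Omega>) V" if "T > 0" for T
      using sd2 that by blast
    have nL2: "n i t \<in> L2 \<Omega>" if "i \<le> 3" "t \<ge> 0" for i t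
      using sd6 that by blast
    have cont: "continuous_on {0..} (\<lambda>t. L2_inner \<Omega> (n i t) \<phi>)" if "i \<le> 3" "\<phi> \<in> H10 \<Omega>" for i \<phi>
      using sd7 that by blast
    have m1: "AE t in lebesgue_on {0<..}. AE x in lebesgue_on \<Omega>. norm (m t x) = 1"
      using LL unfolding landau_lifshitz_solution_def by blast
    have mL2: "(\<lambda>x. m t x $ j) \<in> L2 \<Omega>" if "t \<ge> 0" for t j
      using LL that unfolding landau_lifshitz_solution_def by blast
    have sub: "AE t in lebesgue_on {0<..<T}. Q t" if "AE t in lebesgue_on {0<..}. Q t" for Q and T :: real
      by (rule AE_lebesgue_on_subset[OF that]) auto
    define G where "G t = (\<Sum>i\<le>3. (L2_norm \<Omega> (n i t - n\<^sub>e i))\<^sup>2)" for t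
    have w: "AE t in lebesgue_on {0<..<T}. \<forall>i\<le>3. n i t - n\<^sub>e i \<in> H10 \<Omega>" for T
      using sub[OF tr]
    proof eventually_elim
      case (elim t)
      show ?case
      proof (intro allI impI)
        fix i :: nat assume "i \<le> 3"
        then show "n i t - n\<^sub>e i \<in> H10 \<Omega>"
          using elim by (intro trace_eq_diff[OF op bd _ te(1)]) simp_all
      qed
    qed
    \<comment> \<open>The functional \<open>n' i t\<close> is evaluated at
      \<open>n i t - n\<^sub>e i\<close>, which is admissible at almost every time because both
      terms have the same boundary data.\<close>
    have diss: "AE t in lebesgue_on {0<..<T}. (\<Sum>i\<le>3. n' i t (n i t - n\<^sub>e i)) \<le> - k * G t" if T: "T > 0" for T
    proof -
      have "AE t in lebesgue_on {0<..<T}. \<forall>i\<in>{..3}. n i t \<in> H1 \<Omega>"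
        using nH1(1)[OF T] by (intro AE_finite_allI) (auto simp: bochner_L2_def strongly_measurable_def)
      moreover have "AE t in lebesgue_on {0<..<T}. V t \<in> H1 \<Omega>"
        using VH2[OF T] by (auto simp: bochner_L2_def strongly_measurable_def H2_def elim: eventually_mono)
      ultimately show ?thesis
        using sub[OF eq, of T] sub[OF po, of T] sub[OF tr, of T] sub[OF m1, of T] w[of T] AE_space
      proof eventually_elim
        case (elim t)
        have t: "t \<ge> 0" using elim(8) by (simp add: space_restrict_space)
        have VV: "V t - V\<^sub>e \<in> H10 \<Omega>" by (rule trace_eq_diff[OF op bd _ te(2)[of 0]]) (use elim(5) in auto)
        have mm: "(\<lambda>x. m t x $ j) \<in> borel_measurable (lebesgue_on \<Omega>)" for j by (rule L2_measurable[OF mL2[OF t]])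
        have nn: "n j t \<in> H1 \<Omega>" "n j t - n\<^sub>e j \<in> H10 \<Omega>" if "j \<le> 3" for j using elim(1,7) that by auto
        have "(\<Sum>i\<le>3. - (\<integral>x. (\<Sum>j\<le>3. diffusion_matrix (D x) (p x) (m t x) i j *\<^sub>R
                       (grad \<Omega> (n j t) x - n j t x *\<^sub>R drift \<Omega> \<mu> (V t) x)) \<bullet> grad \<Omega> (n i t - n\<^sub>e i) x
                \<partial>lebesgue_on \<Omega>)
           + (\<integral>x. (\<Sum>j\<le>3. relaxation_matrix \<gamma> \<tau> (m t x) i j * n j t x) * (n i t - n\<^sub>e i) x
                \<partial>lebesgue_on \<Omega>)) \<le> - (\<delta> * (1 - q) / (4 * c\<^sup>2)) * (\<Sum>i\<le>3. (L2_norm \<Omega> (n i t - n\<^sub>e i))\<^sup>2)"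
          by (rule energy_dissipation[where m = "m t" and n = "\<lambda>j. n j t" and ne = n\<^sub>e and V = "V t",
                OF op bd c Dm \<delta>(2) DM \<delta>(1) assms(5) q(2,1) mm elim(6) nn(1) ne nn(2)
                elim(2) Ve VV CL2 elim(4) pe lam \<mu> \<tau> st1 st2 neB vK sK[unfolded s_def a_def \<kappa>_def k_def]])
        moreover have "(\<Sum>i\<le>3. n' i t (n i t - n\<^sub>e i)) = (\<Sum>i\<le>3. - (\<integral>x. (\<Sum>j\<le>3. diffusion_matrix (D x) (p x) (m t x) i j *\<^sub>R
                       (grad \<Omega> (n j t) x - n j t x *\<^sub>R drift \<Omega> \<mu> (V t) x)) \<bullet> grad \<Omega> (n i t - n\<^sub>e i) x
                \<partial>lebesgue_on \<Omega>)
           + (\<integral>x. (\<Sum>j\<le>3. relaxation_matrix \<gamma> \<tau> (m t x) i j * n j t x) * (n i t - n\<^sub>e i) x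
                \<partial>lebesgue_on \<Omega>))"
        proof (rule sum.cong[OF refl])
          fix i :: nat assume "i \<in> {..3}"
          then have "i \<le> 3" by simp
          then show "n' i t (n i t - n\<^sub>e i) = - (\<integral>x. (\<Sum>j\<le>3. diffusion_matrix (D x) (p x) (m t x) i j *\<^sub>R
                       (grad \<Omega> (n j t) x - n j t x *\<^sub>R drift \<Omega> \<mu> (V t) x)) \<bullet> grad \<Omega> (n i t - n\<^sub>e i) x
                \<partial>lebesgue_on \<Omega>)
           + (\<integral>x. (\<Sum>j\<le>3. relaxation_matrix \<gamma> \<tau> (m t x) i j * n j t x) * (n i t - n\<^sub>e i) x
                \<partial>lebesgue_on \<Omega>)"
            using elim(3,7) by blast
        qed
        ultimately show ?case by (simp only: G_def k_def \<kappa>_def)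
      qed
    qed
    have sqi: "integrable (lebesgue_on {0<..<T}) (\<lambda>t. (L2_norm \<Omega> (n i t - n\<^sub>e i))\<^sup>2)"
      and sqb: "\<exists>M. AE t in lebesgue_on {0<..<T}. (L2_norm \<Omega> (n i t - n\<^sub>e i))\<^sup>2 \<le> M" if "T > 0" "i \<le> 3" for T i
      using bochner_Linf_diff_square[OF op bd nH1(2)[OF that] H1_L2[OF ne[OF that(2)]]] by blast+
    have Gi: "G integrable_on {0..T}" if "T > 0" for T
      unfolding G_def[abs_def]
      by (rule integrable_on_from_open(1)) (use sqi[OF that] in \<open>auto intro!: Bochner_Integration.integrable_sum\<close>)
    \<comment> \<open>Each component has its own essential bound on (0,1); the sum of the four is
      the constant \<open>M\<close> of \<open>exponential_decay\<close>.\<close>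
    have "\<forall>i. \<exists>M. i \<le> 3 \<longrightarrow> (AE t in lebesgue_on {0<..<1::real}. (L2_norm \<Omega> (n i t - n\<^sub>e i))\<^sup>2 \<le> M)"
      using sqb[of 1] by auto
    then obtain M where "\<forall>i. i \<le> 3 \<longrightarrow> (AE t in lebesgue_on {0<..<1::real}. (L2_norm \<Omega> (n i t - n\<^sub>e i))\<^sup>2 \<le> M i)"
      by (rule choice[THEN exE])
    then have "AE t in lebesgue_on {0<..<1::real}. \<forall>i\<in>{..3}. (L2_norm \<Omega> (n i t - n\<^sub>e i))\<^sup>2 \<le> M i"
      by (intro AE_finite_allI) auto
    then have "AE t in lebesgue_on {0<..<1::real}. G t \<le> \<bar>\<Sum>i\<le>3. M i\<bar>"
      by eventually_elim (unfold G_def, intro order_trans[OF sum_mono abs_ge_self], auto)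
    then obtain N0 where N0: "negligible N0" "\<And>t. 0 < t \<Longrightarrow> t < 1 \<Longrightarrow> t \<notin> N0 \<Longrightarrow> G t \<le> \<bar>\<Sum>i\<le>3. M i\<bar>"
      by (rule AE_negligible) auto
    define M0 where "M0 = \<bar>\<Sum>i\<le>3. M i\<bar>"
    have decay: "G b \<le> M0 * exp (- (2 * k) * b)" if "b > 0" for b
    proof (rule exponential_decay[OF _ _ Gi N0(1) _ _ _ that])
      show "\<exists>\<delta>>0. \<forall>t\<in>{b..b + \<delta>}. G b - e \<le> G t" if "b > 0" "e > 0" for b e
        unfolding G_def by (rule sum_L2_norm_sq_weak_lsc[OF op bd nL2 cont H1_L2[OF ne]]) (use that in auto)
      show "\<exists>\<delta>>0. \<exists>P Q N. negligible N \<and> (\<forall>t. 0 \<le> P t) \<and> (\<forall>t. 0 \<le> Q t) \<and>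
       P integrable_on {0..T} \<and> Q integrable_on {0..T} \<and> integral {0..T} P \<le> e \<and> integral {0..T} Q \<le> e \<and>
       (\<forall>t h. 0 < t \<longrightarrow> t + h < T \<longrightarrow> 0 < h \<longrightarrow> h < \<delta> \<longrightarrow> t \<notin> N \<longrightarrow> t + h \<notin> N \<longrightarrow>
          G (t + h) - G t \<le> - (2 * k) * integral {t..t+h} G + integral {t..t+h} P + h * (Q t + Q (t + h)))"
        if "T > 0" "e > 0" for T e
        unfolding G_def[abs_def]
        by (rule energy_step[OF op bd nH1(1)[OF that(1)] n'[OF that(1)] nL2 cont ne w
              diss[OF that(1), unfolded G_def] that Gi[OF that(1), unfolded G_def[abs_def]]])
    qed (use k N0(2) in \<open>auto simp: G_def M0_def intro: sum_nonneg\<close>)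
    show "\<exists>k\<^sub>1>0. \<exists>k\<^sub>2>0. \<forall>t>0. L2_set (\<lambda>j. L2_norm \<Omega> (n j t - n\<^sub>e j)) {..3} \<le> k\<^sub>1 * exp (- k\<^sub>2 * t)"
    \<comment> \<open>Square root of the bound for \<open>G\<close>, with +1 to be positive even if
      \<open>M0\<close> is 0; the rate \<open>2 * k\<close> of the squares halves to
      \<open>k\<close>.\<close>
    proof (rule exI[of _ "sqrt M0 + 1"], rule conjI[OF _ exI[of _ k]], goal_cases)
      case 1
      show ?case by (simp add: M0_def add_nonneg_pos)
    next
      case 2
      show ?case
      proof (intro conjI allI impI k)
        fix t :: real assume t: "t > 0"
        have "L2_set (\<lambda>j. L2_norm \<Omega> (n j t - n\<^sub>e j)) {..3} = sqrt (G t)" by (simp add: L2_set_def G_def)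
        also have "\<dots> \<le> sqrt (M0 * exp (- (2 * k) * t))" by (intro real_sqrt_le_mono decay t)
        also have "exp (- (2 * k) * t) = (exp (- k * t))\<^sup>2" by (simp add: exp_double[symmetric] mult.assoc)
        also have "sqrt (M0 * (exp (- k * t))\<^sup>2) = sqrt M0 * exp (- k * t)" by (simp add: real_sqrt_mult)
        also have "\<dots> \<le> (sqrt M0 + 1) * exp (- k * t)" by (intro mult_right_mono) auto
        finally show "L2_set (\<lambda>j. L2_norm \<Omega> (n j t - n\<^sub>e j)) {..3} \<le> (sqrt M0 + 1) * exp (- k * t)" .
      qed
    qed
  qed
qed

end
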